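(* Let $\mathcal{P}$ be a hereditary graph property and $\Gamma$ a graph limit. Then the following are equivalent. (i) $\Gamma\in\widehat{\mathcal{P}}$. (ii) Every graphon representing $\Gamma$ is $G$-free for every graph $G\notin\mathcal{P}$. (iii) There exists a graphon representing $\Gamma$ that is $G$-free for every graph $G\notin\mathcal{P}$. (iv) There exists a graphon representing $\Gamma$ that is completely $G$-free for every graph $G\notin\mathcal{P}$. Moreover, suppose that $[0,1]=\bigcup_{k=1}^r A_k$ is a partition into finitely many measurable sets with positive measures, and that we are given a subset $E\subseteq [r]\times [r]$ and real numbers $a_{kl}\in [0,1]$ for $(k,l)\in E$. Suppose further that the equivalent properties (i)--(iv) hold for $\Gamma$, and that there is a graphon $W$ representing $\Gamma$ such that \[ W(x,y)=a_{kl}\quad\text{for all } (k,l)\in E \text{ and all }(x,y)\in A_k\times A_l. \] Then there exists a graphon $W'$ representing $\Gamma$ that is completely $G$-free for every graph $G\notin\mathcal{P}$ and satisfies $W'(x,y)=a_{kl}$ for all $(k,l)\in E$ and all $(x,y)\in A_k\times A_l$.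
   Context: A graphon is a measurable symmetric function $W:[0,1]^2\to[0,1]$; each graphon represents a graph limit, and two graphons are equivalent if they represent the same graph limit. For a graph class $\mathcal{P}$, $\widehat{\mathcal{P}}$ denotes the set of graph limits $\Gamma$ such that there is a sequence $G_n\in\mathcal{P}$ with $G_n\to\Gamma$. For a graph $G$ on vertex set $[n]$ and graphon $W$, let $\psi_{G,W}(x_1,\dots,x_n)=\prod_{ij\in E(G)}W(x_i,x_j)\prod_{ij\notin E(G)}(1-W(x_i,x_j))$ and $t_{\mathrm{ind}}(G,W)=\int_{[0,1]^n}\psi_{G,W}$. $W$ is $G$-free if $t_{\mathrm{ind}}(G,W)=0$, i.e. $\psi_{G,W}(x_1,\dots,x_n)=0$ for almost every $(x_1,\dots,x_n)$; $W$ is completely $G$-free if $\psi_{G,W}(x_1,\dots,x_n)=0$ for all $x_1,\dots,x_n\in[0,1]$ (not necessarily distinct). *)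

theory Defs
  imports "HOL-Analysis.Analysis"
begin

text \<open>Finite simple graphs. Every nonempty finite graph is isomorphic to one with vertices in
  \<^typ>\<open>nat\<close>. The null graph is excluded, so that densities in a graph are always defined.\<close>

typedef sgraph =
  "{(V :: nat set, E :: nat set set). finite V \<and> V \<noteq> {} \<and> (\<forall>e\<in>E. e \<subseteq> V \<and> card e = 2)}"
proof
  show "({0}, {}) \<in> {(V :: nat set, E :: nat set set). finite V \<and> V \<noteq> {} \<and>
      (\<forall>e\<in>E. e \<subseteq> V \<and> card e = 2)}" by simp
qed

setup_lifting type_definition_sgraph

lift_definition verts :: "sgraph \<Rightarrow> nat set" is fst .
lift_definition edges :: "sgraph \<Rightarrow> nat set set" is snd .

definition isomorphic :: "sgraph \<Rightarrow> sgraph \<Rightarrow> bool" where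
  "isomorphic G H \<longleftrightarrow> (\<exists>f. bij_betw f (verts G) (verts H) \<and> edges H = (\<lambda>e. f ` e) ` edges G)"

definition induced_subgraph :: "sgraph \<Rightarrow> sgraph \<Rightarrow> bool" where
  "induced_subgraph H G \<longleftrightarrow> verts H \<subseteq> verts G \<and> edges H = {e \<in> edges G. e \<subseteq> verts H}"

definition hereditary :: "sgraph set \<Rightarrow> bool" where
  "hereditary P \<longleftrightarrow>
     (\<forall>G\<in>P. \<forall>H. isomorphic G H \<longrightarrow> H \<in> P) \<and>
     (\<forall>G\<in>P. \<forall>H. induced_subgraph H G \<longrightarrow> H \<in> P)"

text \<open>The homomorphism density $t(F,G)$. A map identifying the ends of an edge is not counted:
  it sends the edge to a singleton.\<close>

definition hom_density :: "sgraph \<Rightarrow> sgraph \<Rightarrow> real" where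
  "hom_density F G =
     real (card {f \<in> verts F \<rightarrow>\<^sub>E verts G. \<forall>e\<in>edges F. f ` e \<in> edges G})
       / real (card (verts G)) ^ card (verts F)"

text \<open>Graph limits are the points added when the graphs are embedded by
  $G \mapsto ((t(F,G))_F, 1/|V(G)|)$ into a product of unit intervals and the closure is taken.
  Such a point has last coordinate 0 and so is determined by its densities $t(F,\Gamma)$;
  convergence to it includes $|V(G_n)| \to \infty$.\<close>

definition densities_converge :: "(nat \<Rightarrow> sgraph) \<Rightarrow> (sgraph \<Rightarrow> real) \<Rightarrow> bool" where
  "densities_converge G \<gamma> \<longleftrightarrow>
     filterlim (\<lambda>n. card (verts (G n))) at_top sequentially \<and>
     (\<forall>F. (\<lambda>n. hom_density F (G n)) \<longlonglongrightarrow> \<gamma> F)"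

typedef graph_limit = "{\<gamma> :: sgraph \<Rightarrow> real. \<exists>G. densities_converge G \<gamma>}"
  morphisms limit_density Abs_graph_limit
proof -
  define G where "G n = Abs_sgraph ({..n}, {})" for n
  have G: "verts (G n) = {..n}" "edges (G n) = {}" for n
    by (simp_all add: G_def verts.rep_eq edges.rep_eq Abs_sgraph_inverse)
  define \<gamma> where "\<gamma> F = (if edges F = {} then 1 else 0 :: real)" for F
  have fin: "finite (verts F)" for F
    by transfer auto
  have "hom_density F (G n) = \<gamma> F" for F n
    using fin[of F] by (auto simp: hom_density_def G \<gamma>_def card_PiE)
  moreover have "filterlim (\<lambda>n. card (verts (G n))) at_top sequentially"
    by (simp add: G filterlim_Suc)
  ultimately have "densities_converge G \<gamma>"
    by (simp add: densities_converge_def)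
  then show ?thesis by blast
qed

definition graphs_tendsto :: "(nat \<Rightarrow> sgraph) \<Rightarrow> graph_limit \<Rightarrow> bool" where
  "graphs_tendsto G \<Gamma> \<longleftrightarrow> densities_converge G (limit_density \<Gamma>)"

definition class_limits :: "sgraph set \<Rightarrow> graph_limit set" where
  "class_limits P = {\<Gamma>. \<exists>G. (\<forall>n. G n \<in> P) \<and> graphs_tendsto G \<Gamma>}"

text \<open>Measurability is Lebesgue measurability. Only the values on the unit square matter.\<close>

definition graphon :: "(real \<Rightarrow> real \<Rightarrow> real) \<Rightarrow> bool" where
  "graphon W \<longleftrightarrow>
     (\<lambda>z. W (fst z) (snd z)) \<in> borel_measurable (lebesgue_on ({0..1} \<times> {0..1})) \<and>
     (\<forall>x\<in>{0..1}. \<forall>y\<in>{0..1}. W x y = W y x \<and> 0 \<le> W x y \<and> W x y \<le> 1)"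

text \<open>Lebesgue measure on $[0,1]^V$. The completion is needed: for Lebesgue measurable \<open>W\<close> the
  integrands below need not be measurable for the product sigma-algebra, and the Bochner
  integral of a nonmeasurable function is 0.\<close>

definition cube :: "nat set \<Rightarrow> (nat \<Rightarrow> real) measure" where
  "cube V = completion (PiM V (\<lambda>_. restrict_space lborel {0..1}))"

text \<open>Each unordered pair of distinct vertices once; the orientation is immaterial because
  graphons are symmetric.\<close>

definition vpairs :: "sgraph \<Rightarrow> (nat \<times> nat) set" where
  "vpairs G = {(i, j). i \<in> verts G \<and> j \<in> verts G \<and> i < j}"

definition epairs :: "sgraph \<Rightarrow> (nat \<times> nat) set" where
  "epairs G = {(i, j) \<in> vpairs G. {i, j} \<in> edges G}"

definition graphon_density :: "sgraph \<Rightarrow> (real \<Rightarrow> real \<Rightarrow> real) \<Rightarrow> real" where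
  "graphon_density F W = (\<integral>x. (\<Prod>(i, j)\<in>epairs F. W (x i) (x j)) \<partial>cube (verts F))"

definition represents :: "(real \<Rightarrow> real \<Rightarrow> real) \<Rightarrow> graph_limit \<Rightarrow> bool" where
  "represents W \<Gamma> \<longleftrightarrow> graphon W \<and> (\<forall>F. graphon_density F W = limit_density \<Gamma> F)"

definition psi :: "sgraph \<Rightarrow> (real \<Rightarrow> real \<Rightarrow> real) \<Rightarrow> (nat \<Rightarrow> real) \<Rightarrow> real" where
  "psi G W x = (\<Prod>(i, j)\<in>epairs G. W (x i) (x j)) *
     (\<Prod>(i, j)\<in>vpairs G - epairs G. 1 - W (x i) (x j))"

definition t_ind :: "sgraph \<Rightarrow> (real \<Rightarrow> real \<Rightarrow> real) \<Rightarrow> real" where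
  "t_ind G W = (\<integral>x. psi G W x \<partial>cube (verts G))"

definition graph_free :: "sgraph \<Rightarrow> (real \<Rightarrow> real \<Rightarrow> real) \<Rightarrow> bool" where
  "graph_free G W \<longleftrightarrow> t_ind G W = 0"

definition completely_graph_free :: "sgraph \<Rightarrow> (real \<Rightarrow> real \<Rightarrow> real) \<Rightarrow> bool" where
  "completely_graph_free G W \<longleftrightarrow> (\<forall>x \<in> verts G \<rightarrow> {0..1}. psi G W x = 0)"

end

theory Submission
  imports Defs
begin

text \<open>Existence of a representing graphon: in each graph of a convergent sequence, refine vertex
  partitions greedily, always splitting along a pair of sets that maximizes the discrepancy between the
  adjacency matrix and its block averages. The discrepancies are controlled by the increments of a
  bounded energy, so the block averages, in the limit along an ultrafilter, are step graphons that form
  a Cauchy sequence in \<open>L\<^sup>2\<close> and have the right densities in the limit.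

  Graphs in the class from a graphon: random induced subgraphs of fixed large order of a sequence
  converging to the limit have nearly the right densities (first moment of \<open>F\<close> and of two disjoint
  copies of \<open>F\<close>) and, the induced densities of graphs outside the class tending to 0, mostly lie in the
  class.

  Complete freeness: attach to each point \<open>x\<close> an ultrafilter of sets that fill up almost all of small
  cells around \<open>x\<close>, the cells respecting the given partition. The iterated limit of the graphon along
  the ultrafilters of two points, the smaller one outside, agrees with the graphon almost everywhere. If
  it realized a forbidden graph, also with repeated points, one could move the points one after another
  to positions realizing it for the original graphon, in sets too large for Fubini's theorem.\<close>

section \<open>Ultrafilters\<close>

text \<open>Complete freeness speaks of every tuple, including repeated points and hence the
  diagonal, which is a null set that no density can see. So every point needs values dictated by the
  almost sure behaviour of the graphon near it. Limits over shrinking cells are guaranteed only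
  almost everywhere; ultrafilter limits of bounded functions exist at every point. They suffice
  because \<open>psi G W x \<noteq> 0\<close> is a finite conjunction of inequalities 0 < W or W <
  1, an open condition: a configuration seen in the limit is already realized nearby. Two such
  limits need not commute; ordering the points by position makes one order of moving serve all pairs
  and makes the kernel symmetric. That kernel has no evident measurability, but it agrees almost
  everywhere with a Borel one, and Lebesgue measure is complete. On the side of densities everything
  rests on inclusion-exclusion: induced densities are signed sums of homomorphism densities of
  supergraphs, for graphs and graphons alike, so freeness depends only on the graph limit.\<close>

definition ultrafilter :: "'a filter \<Rightarrow> bool" where
  "ultrafilter F \<longleftrightarrow> F \<noteq> bot \<and> (\<forall>P. eventually P F \<or> eventually (\<lambda>x. \<not> P x) F)"

text \<open>Zorn's lemma on the proper filters below \<open>F\<close>. A chain is a base of its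
  infimum, which therefore stays proper; a minimal filter decides every \<open>P\<close>, since
  cutting it down to \<open>P\<close> gives either \<open>bot\<close> or the filter itself.\<close>

lemma ultrafilter_below:
  fixes F :: "'a filter"
  assumes "F \<noteq> bot"
  shows "\<exists>U\<le>F. ultrafilter U"
proof -
  let ?A = "{G. G \<noteq> bot \<and> G \<le> F}"
  have "\<exists>m\<in>?A. \<forall>a\<in>?A. m \<ge> a \<longrightarrow> a = m"
  proof (rule predicate_Zorn)
    show "partial_order_on ?A (relation_of (\<ge>) ?A)"
      by (rule partial_order_on_relation_ofI) auto
    fix C assume "C \<in> Chains (relation_of (\<ge>) ?A)"
    then have C: "\<And>x. x \<in> C \<Longrightarrow> x \<in> ?A" "\<And>x y. x \<in> C \<Longrightarrow> y \<in> C \<Longrightarrow> x \<le> y \<or> y \<le> x"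
      by (auto simp: Chains_def relation_of_def)
    show "\<exists>u\<in>?A. \<forall>a\<in>C. a \<ge> u"
    proof (cases "C = {}")
      case True
      then show ?thesis using assms by auto
    next
      case False
      have "eventually P (Inf C) \<longleftrightarrow> (\<exists>b\<in>C. eventually P b)" for P
      proof (rule eventually_Inf_base[OF False])
        fix F G assume "F \<in> C" "G \<in> C"
        then show "\<exists>x\<in>C. x \<le> inf F G"
          using C(2)[of F G] by (auto simp: inf.absorb1 inf.absorb2)
      qed
      then have "Inf C \<noteq> bot"
        using C(1) by (auto simp: trivial_limit_def)
      moreover have "Inf C \<le> F"
      proof -
        obtain G where "G \<in> C" using False by blast
        then show ?thesis using Inf_lower[of G C] C(1)[of G] by auto
      qed
      ultimately show ?thesis
        by (auto intro: Inf_lower)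
    qed
  qed
  then obtain U where U: "U \<noteq> bot" "U \<le> F" and min: "\<And>G. G \<noteq> bot \<Longrightarrow> G \<le> U \<Longrightarrow> G = U"
    by (auto intro: order_trans)
  have "eventually P U \<or> eventually (\<lambda>x. \<not> P x) U" for P
  proof (cases "inf U (principal {x. P x}) = bot")
    case True
    then have "eventually (\<lambda>x. False) (inf U (principal {x. P x}))" by simp
    then show ?thesis by (simp add: eventually_inf_principal)
  next
    case False
    from min[OF False] have "U \<le> principal {x. P x}" by (metis inf_le1 inf_le2)
    then show ?thesis by (simp add: le_principal)
  qed
  then show ?thesis using U by (auto simp: ultrafilter_def)
qed

text \<open>Compactness of the interval yields a cluster point of \<open>f\<close>, and along an
  ultrafilter a cluster point is a limit. This makes \<open>Lim U\<close> a total limit operator on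
  bounded functions.\<close>

lemma ultrafilter_Lim:
  fixes f :: "'a \<Rightarrow> real"
  assumes U: "ultrafilter U" and f: "eventually (\<lambda>x. f x \<in> {a..b}) U"
  shows "(f \<longlongrightarrow> Lim U f) U" "Lim U f \<in> {a..b}"
proof -
  have ne: "U \<noteq> bot" using U by (simp add: ultrafilter_def)
  let ?G = "filtermap f U"
  have "?G \<noteq> bot" using ne by (simp add: filtermap_bot_iff)
  moreover have "eventually (\<lambda>x. x \<in> {a..b}) ?G" using f by (simp add: eventually_filtermap)
  moreover have "compact {a..b}" by simp
  ultimately obtain L where L: "L \<in> {a..b}" "inf (nhds L) ?G \<noteq> bot"
    unfolding compact_filter by blast
  have "(f \<longlongrightarrow> L) U"
  proof (rule topological_tendstoI)
    fix S assume S: "open S" "L \<in> S"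
    show "eventually (\<lambda>x. f x \<in> S) U"
    proof (rule ccontr)
      assume "\<not> ?thesis"
      then have "eventually (\<lambda>x. f x \<notin> S) U" using U by (auto simp: ultrafilter_def)
      then have "eventually (\<lambda>x. x \<notin> S) ?G" by (simp add: eventually_filtermap)
      moreover have "eventually (\<lambda>x. x \<in> S) (nhds L)" using S by (auto simp: eventually_nhds)
      ultimately have "eventually (\<lambda>x. False) (inf (nhds L) ?G)"
        unfolding eventually_inf by blast
      then show False using L(2) by simp
    qed
  qed
  then have "(f \<longlongrightarrow> L) U" "Lim U f = L" using tendsto_Lim[OF ne] by auto
  then show "(f \<longlongrightarrow> Lim U f) U" "Lim U f \<in> {a..b}" using L by auto
qed

section \<open>Homomorphism and induced densities\<close>

definition mk_sgraph :: "nat set \<Rightarrow> nat set set \<Rightarrow> sgraph" where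
  "mk_sgraph V E = Abs_sgraph (V, E)"

lemma mk_sgraph:
  assumes "finite V" "V \<noteq> {}" "\<And>e. e \<in> E \<Longrightarrow> e \<subseteq> V \<and> card e = 2"
  shows "verts (mk_sgraph V E) = V" "edges (mk_sgraph V E) = E"
  using assms by (auto simp: mk_sgraph_def verts.rep_eq edges.rep_eq Abs_sgraph_inverse)

lemma finite_verts [simp]: "finite (verts G)" and verts_nonempty [simp]: "verts G \<noteq> {}"
  by (transfer; auto)+

lemma edges_wf: "e \<in> edges G \<Longrightarrow> e \<subseteq> verts G" "e \<in> edges G \<Longrightarrow> card e = 2"
  by (transfer; auto)+

lemma card_verts_pos: "card (verts G) > 0"
  by (simp add: card_gt_0_iff)

lemma sgraph_eqI: "verts G = verts H \<Longrightarrow> edges G = edges H \<Longrightarrow> G = H"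
  by transfer (auto simp: prod_eq_iff)

lemma finite_vpairs [simp]: "finite (vpairs G)"
  by (rule finite_subset[of _ "verts G \<times> verts G"]) (auto simp: vpairs_def)

lemma epairs_subset: "epairs G \<subseteq> vpairs G"
  by (auto simp: epairs_def)

lemma finite_epairs [simp]: "finite (epairs G)"
  using finite_subset[OF epairs_subset] by simp

lemma edges_eq_epairs: "edges G = (\<lambda>(i, j). {i, j}) ` epairs G"
proof (intro set_eqI iffI)
  fix e assume e: "e \<in> edges G"
  from edges_wf(2)[OF e] obtain i j where ij: "e = {i, j}" "i \<noteq> j" by (auto simp: card_2_iff)
  have V: "i \<in> verts G" "j \<in> verts G" using edges_wf(1)[OF e] ij by auto
  show "e \<in> (\<lambda>(i, j). {i, j}) ` epairs G"
  proof (cases "i < j")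
    case True
    then show ?thesis using e ij V by (auto simp: epairs_def vpairs_def intro!: image_eqI[of _ _ "(i, j)"])
  next
    case False
    then show ?thesis using e ij V
      by (auto simp: epairs_def vpairs_def insert_commute intro!: image_eqI[of _ _ "(j, i)"])
  qed
next
  fix e assume "e \<in> (\<lambda>(i, j). {i, j}) ` epairs G"
  then show "e \<in> edges G" by (auto simp: epairs_def)
qed

lemma graph_of_pairs:
  assumes "finite V" "V \<noteq> {}" "D \<subseteq> {(i, j). i \<in> V \<and> j \<in> V \<and> i < j}"
  obtains H where "verts H = V" "epairs H = D"
proof -
  define H where "H = mk_sgraph V ((\<lambda>(i, j). {i, j}) ` D)"
  have "e \<subseteq> V \<and> card e = 2" if "e \<in> (\<lambda>(i, j). {i, j}) ` D" for e
  proof -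
    from that obtain i j where "(i, j) \<in> D" "e = {i, j}" by auto
    then show ?thesis using assms(3) by auto
  qed
  then have H: "verts H = V" "edges H = (\<lambda>(i, j). {i, j}) ` D"
    unfolding H_def using mk_sgraph[OF assms(1,2)] by simp_all
  have "epairs H = D"
    using assms(3) by (auto simp: epairs_def vpairs_def H doubleton_eq_iff)
  with H that show thesis by blast
qed

definition adj :: "sgraph \<Rightarrow> nat \<Rightarrow> nat \<Rightarrow> real" where
  "adj G x y = of_bool ({x, y} \<in> edges G)"

lemma adj_sym: "adj G x y = adj G y x"
  by (simp add: adj_def insert_commute)

lemma adj_bounds: "adj G x y \<in> {0..1}" "0 \<le> adj G x y" "adj G x y \<le> 1"
  by (auto simp: adj_def)

text \<open>A kernel in place of a graph, so that the adjacency matrix and its block averages can be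
  compared in one formula.\<close>

definition map_density :: "'v set \<Rightarrow> nat set \<Rightarrow> (nat \<times> nat) set \<Rightarrow> ('v \<Rightarrow> 'v \<Rightarrow> real) \<Rightarrow> real" where
  "map_density V I E A =
     (\<Sum>f\<in>I \<rightarrow>\<^sub>E V. \<Prod>(i, j)\<in>E. A (f i) (f j)) / real (card V) ^ card I"

lemma prod_of_bool:
  assumes "finite E"
  shows "(\<Prod>x\<in>E. of_bool (Q x) :: real) = of_bool (\<forall>x\<in>E. Q x)"
  using assms by (induction E) auto

lemma hom_density_eq: "hom_density F G = map_density (verts G) (verts F) (epairs F) (adj G)"
proof -
  have "finite (verts F \<rightarrow>\<^sub>E verts G)" by (simp add: finite_PiE)
  moreover have "(\<Prod>(i, j)\<in>epairs F. adj G (f i) (f j)) = of_bool (\<forall>e\<in>edges F. f ` e \<in> edges G)" for f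
    using prod_of_bool[of "epairs F" "\<lambda>(i, j). {f i, f j} \<in> edges G"]
    by (simp add: adj_def edges_eq_epairs case_prod_unfold)
  ultimately show ?thesis
    by (simp add: hom_density_def map_density_def of_bool_def sum.If_cases Int_def)
qed

text \<open>All maps count, not only injective ones, which makes the expansion into homomorphism
  densities exact. Since \<open>adj G x x = 0\<close>, a map may identify nonadjacent vertices of
  \<open>F\<close>; such maps are the error term for hereditary classes.\<close>

definition ind_density :: "sgraph \<Rightarrow> sgraph \<Rightarrow> real" where
  "ind_density F G = (\<Sum>f\<in>verts F \<rightarrow>\<^sub>E verts G. (\<Prod>(i, j)\<in>epairs F. adj G (f i) (f j)) *
     (\<Prod>(i, j)\<in>vpairs F - epairs F. 1 - adj G (f i) (f j))) / real (card (verts G)) ^ card (verts F)"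

lemma prod_times_prod_complement:
  fixes a :: "'a \<Rightarrow> real"
  assumes "finite Q" "E \<subseteq> Q"
  shows "(\<Prod>p\<in>E. a p) * (\<Prod>p\<in>Q - E. 1 - a p) =
    (\<Sum>D\<in>Pow (Q - E). (-1) ^ card D * (\<Prod>p\<in>E \<union> D. a p))"
proof -
  have "(\<Prod>p\<in>E. a p) * (\<Prod>p\<in>Q - E. 1 - a p)
      = (\<Sum>D\<in>Pow (Q - E). (\<Prod>p\<in>E. a p) * ((-1) ^ card D * (\<Prod>p\<in>D. a p)))"
    using assms by (simp add: prod_diff_conv_sum sum_distrib_left)
  also have "\<dots> = (\<Sum>D\<in>Pow (Q - E). (-1) ^ card D * (\<Prod>p\<in>E \<union> D. a p))"
  proof (rule sum.cong)
    fix D assume "D \<in> Pow (Q - E)"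
    then have "E \<inter> D = {}" "finite E" "finite D" using assms by (auto intro: finite_subset)
    then show "(\<Prod>p\<in>E. a p) * ((-1) ^ card D * (\<Prod>p\<in>D. a p)) = (-1) ^ card D * (\<Prod>p\<in>E \<union> D. a p)"
      by (simp add: prod.union_disjoint)
  qed simp
  finally show ?thesis .
qed

definition add_pairs :: "sgraph \<Rightarrow> (nat \<times> nat) set \<Rightarrow> sgraph" where
  "add_pairs F D = (SOME H. verts H = verts F \<and> epairs H = epairs F \<union> D)"

lemma add_pairs:
  assumes "D \<subseteq> vpairs F"
  shows "verts (add_pairs F D) = verts F" "epairs (add_pairs F D) = epairs F \<union> D"
proof -
  have "\<exists>H. verts H = verts F \<and> epairs H = epairs F \<union> D"
    using graph_of_pairs[of "verts F" "epairs F \<union> D"] assms epairs_subset[of F]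
    by (force simp: vpairs_def)
  from someI_ex[OF this] show "verts (add_pairs F D) = verts F" "epairs (add_pairs F D) = epairs F \<union> D"
    by (auto simp: add_pairs_def)
qed

text \<open>Multiplying out the factors \<open>1 - adj\<close> is inclusion-exclusion over the
  non-edges to be filled in. Hence induced densities converge whenever homomorphism densities
  do.\<close>

lemma ind_density_eq_sum:
  "ind_density F G = (\<Sum>D\<in>Pow (vpairs F - epairs F). (-1) ^ card D * hom_density (add_pairs F D) G)"
proof -
  let ?S = "Pow (vpairs F - epairs F)"
  have "(\<Prod>(i, j)\<in>epairs F. adj G (f i) (f j)) * (\<Prod>(i, j)\<in>vpairs F - epairs F. 1 - adj G (f i) (f j))
     = (\<Sum>D\<in>?S. (-1) ^ card D * (\<Prod>(i, j)\<in>epairs (add_pairs F D). adj G (f i) (f j)))" for f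
  proof -
    have "(\<Prod>p\<in>epairs F \<union> D. adj G (f (fst p)) (f (snd p))) =
        (\<Prod>p\<in>epairs (add_pairs F D). adj G (f (fst p)) (f (snd p)))" if "D \<in> ?S" for D
    proof -
      have "D \<subseteq> vpairs F" using that by auto
      then show ?thesis by (simp add: add_pairs(2))
    qed
    then show ?thesis
      using prod_times_prod_complement[OF finite_vpairs epairs_subset, where a = "\<lambda>(i, j). adj G (f i) (f j)"]
      by (auto simp: case_prod_unfold intro!: sum.cong)
  qed
  then have "ind_density F G = (\<Sum>f\<in>verts F \<rightarrow>\<^sub>E verts G. \<Sum>D\<in>?S. (-1) ^ card D *
     (\<Prod>(i, j)\<in>epairs (add_pairs F D). adj G (f i) (f j))) / real (card (verts G)) ^ card (verts F)"
    by (simp add: ind_density_def)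
  also have "\<dots> = (\<Sum>D\<in>?S. (-1) ^ card D * hom_density (add_pairs F D) G)"
    by (subst sum.swap) (auto simp: hom_density_eq map_density_def sum_divide_distrib add_pairs(1) subset_iff
        sum_distrib_left intro!: sum.cong)
  finally show ?thesis .
qed

section \<open>Induced densities of graphs outside a hereditary class\<close>

lemma prod_kernel_bounds:
  fixes A :: "'v \<Rightarrow> 'v \<Rightarrow> real"
  assumes "\<And>i j. (i, j) \<in> E \<Longrightarrow> A (f i) (f j) \<in> {0..1}"
  shows "(\<Prod>(i, j)\<in>E. A (f i) (f j)) \<in> {0..1}" "(\<Prod>(i, j)\<in>E. 1 - A (f i) (f j)) \<in> {0..1}"
  using assms by (force simp: case_prod_unfold intro!: prod_nonneg prod_le_1)+

lemma ind_kernel_bounds: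
  "(\<Prod>(i, j)\<in>E. adj G (f i) (f j)) * (\<Prod>(i, j)\<in>E'. 1 - adj G (f i) (f j)) \<in> {0..1}"
proof -
  have "(\<Prod>(i, j)\<in>E. adj G (f i) (f j)) \<in> {0..1}" "(\<Prod>(i, j)\<in>E'. 1 - adj G (f i) (f j)) \<in> {0..1}"
    by (intro prod_kernel_bounds adj_bounds)+
  then show ?thesis by (auto intro: mult_le_one)
qed

lemma ind_density_nonneg: "0 \<le> ind_density F G"
  unfolding ind_density_def using ind_kernel_bounds
  by (intro divide_nonneg_nonneg sum_nonneg) auto

text \<open>Union bound over pairs of distinct arguments: a map that identifies \<open>i\<close> and
  \<open>j\<close> is determined by its restriction to \<open>I - {j}\<close>, so each pair accounts
  for at most a fraction \<open>1 / card V\<close> of all maps.\<close>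

lemma card_noninjective_maps:
  assumes "finite I" "finite V"
  shows "real (card {f \<in> I \<rightarrow>\<^sub>E V. \<not> inj_on f I}) * real (card V) \<le> real (card I ^ 2) * real (card V) ^ card I"
proof -
  let ?T = "\<lambda>(i, j). {f \<in> I \<rightarrow>\<^sub>E V. f i = f j}"
  let ?P = "{(i, j) \<in> I \<times> I. i \<noteq> j}"
  have finP: "finite ?P" by (rule finite_subset[of _ "I \<times> I"]) (auto simp: assms)
  have finT: "finite (?T p)" for p
    by (rule finite_subset[of _ "I \<rightarrow>\<^sub>E V"]) (auto simp: finite_PiE assms split: prod.splits)
  have 1: "card (?T p) * card V \<le> card V ^ card I" if pP: "p \<in> ?P" for p
  proof -
    obtain i j where p: "p = (i, j)" "i \<in> I" "j \<in> I" "i \<noteq> j" using pP by auto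
    have "card (?T p) \<le> card (I - {j} \<rightarrow>\<^sub>E V)"
    proof (rule card_inj_on_le)
      show "inj_on (\<lambda>f. restrict f (I - {j})) (?T p)" unfolding p(1) prod.case
      proof (rule inj_onI, rule ext)
        fix f g x assume fg: "f \<in> {f \<in> I \<rightarrow>\<^sub>E V. f i = f j}" "g \<in> {f \<in> I \<rightarrow>\<^sub>E V. f i = f j}" and eq: "restrict f (I - {j}) = restrict g (I - {j})"
        have *: "f y = g y" if "y \<in> I" "y \<noteq> j" for y using fun_cong[OF eq, of y] that by simp
        show "f x = g x"
        proof (cases "x \<in> I")
          case True
          have "f i = f j" "g i = g j" using fg by simp_all
          then show ?thesis using * True p by metis
        next
          case False
          have "f \<in> I \<rightarrow>\<^sub>E V" "g \<in> I \<rightarrow>\<^sub>E V" using fg by simp_all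
          then show ?thesis using False by (metis PiE_arb)
        qed
      qed
      show "(\<lambda>f. restrict f (I - {j})) ` ?T p \<subseteq> I - {j} \<rightarrow>\<^sub>E V"
        unfolding p(1) prod.case by (intro image_subsetI restrict_PiE_iff[THEN iffD2] ballI) (simp add: PiE_iff)
      show "finite (I - {j} \<rightarrow>\<^sub>E V)" by (simp add: finite_PiE assms)
    qed
    also have "\<dots> = card V ^ (card I - 1)" using p(3) assms by (simp add: card_PiE)
    finally have "card (?T p) * card V \<le> card V ^ (card I - 1) * card V" by simp
    also have "\<dots> = card V ^ card I"
      using p assms by (metis card_gt_0_iff empty_iff mult.commute power_eq_if not_gr0)
    finally show ?thesis .
  qed
  have "card {f \<in> I \<rightarrow>\<^sub>E V. \<not> inj_on f I} \<le> card (\<Union>p\<in>?P. ?T p)"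
    by (rule card_mono) (use finP finT in \<open>auto simp: inj_on_def\<close>)
  also have "\<dots> \<le> (\<Sum>p\<in>?P. card (?T p))" by (rule card_UN_le[OF finP])
  finally have "card {f \<in> I \<rightarrow>\<^sub>E V. \<not> inj_on f I} * card V \<le> (\<Sum>p\<in>?P. card (?T p) * card V)"
    by (simp add: sum_distrib_right[symmetric])
  also have "\<dots> \<le> (\<Sum>p\<in>?P. card V ^ card I)" by (rule sum_mono) (use 1 in blast)
  also have "\<dots> = card ?P * card V ^ card I" by simp
  also have "\<dots> \<le> card I ^ 2 * card V ^ card I"
    using card_mono[of "I \<times> I" ?P] assms by (intro mult_right_mono) (auto simp: card_cartesian_product power2_eq_square)
  finally have "real (card {f \<in> I \<rightarrow>\<^sub>E V. \<not> inj_on f I} * card V) \<le> real (card I ^ 2 * card V ^ card I)"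
    by (simp only: of_nat_le_iff)
  then show ?thesis by simp
qed

text \<open>An injective map of nonzero weight would carry \<open>F\<close> isomorphically onto an
  induced subgraph of \<open>G\<close> and put \<open>F\<close> into \<open>P\<close>. Only
  noninjective maps remain, and they are few.\<close>

lemma ind_density_hereditary:
  assumes P: "hereditary P" and G: "G \<in> P" and F: "F \<notin> P"
  shows "ind_density F G \<le> real (card (verts F) ^ 2) / real (card (verts G))"
proof -
  let ?N = "card (verts G)" and ?m = "card (verts F)"
  let ?B = "{f \<in> verts F \<rightarrow>\<^sub>E verts G. \<not> inj_on f (verts F)}"
  define h where "h f = (\<Prod>(i, j)\<in>epairs F. adj G (f i) (f j)) *
     (\<Prod>(i, j)\<in>vpairs F - epairs F. 1 - adj G (f i) (f j))" for f
  have h1: "h f \<le> 1" "0 \<le> h f" for f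
    using ind_kernel_bounds[of G f "epairs F" "vpairs F - epairs F"] by (auto simp: h_def)
  have h0: "h f = 0" if f: "f \<in> verts F \<rightarrow>\<^sub>E verts G" and inj: "inj_on f (verts F)" for f
  proof (rule ccontr)
    assume "h f \<noteq> 0"
    then have nz: "(\<Prod>(i, j)\<in>epairs F. adj G (f i) (f j)) \<noteq> 0"
        "(\<Prod>(i, j)\<in>vpairs F - epairs F. 1 - adj G (f i) (f j)) \<noteq> 0"
      unfolding h_def by (metis mult_zero_left, metis mult_zero_right)
    have e1: "{f i, f j} \<in> edges G" if "(i, j) \<in> epairs F" for i j
      using nz(1) that prod_zero_iff[OF finite_epairs, of "\<lambda>(i, j). adj G (f i) (f j)" F]
      by (auto simp: adj_def of_bool_eq_0_iff)
    have e2: "{f i, f j} \<notin> edges G" if "(i, j) \<in> vpairs F - epairs F" for i j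
    proof
      assume "{f i, f j} \<in> edges G"
      then have "(case (i, j) of (i, j) \<Rightarrow> 1 - adj G (f i) (f j)) = 0" by (simp add: adj_def)
      then show False using nz(2) that by (metis (no_types, lifting) finite_Diff finite_vpairs prod_zero)
    qed
    define H where "H = mk_sgraph (f ` verts F) {e \<in> edges G. e \<subseteq> f ` verts F}"
    have ne: "finite (f ` verts F)" "f ` verts F \<noteq> {}" by simp_all
    have wf: "e \<subseteq> f ` verts F \<and> card e = 2" if "e \<in> {e \<in> edges G. e \<subseteq> f ` verts F}" for e
      using that edges_wf(2) by blast
    have H: "verts H = f ` verts F" "edges H = {e \<in> edges G. e \<subseteq> f ` verts F}"
      unfolding H_def by (rule mk_sgraph[OF ne], erule wf)+
    have "induced_subgraph H G" using f by (auto simp: induced_subgraph_def H)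
    then have "H \<in> P" using P G unfolding hereditary_def by blast
    have eq: "{f i, f j} \<in> edges G \<longleftrightarrow> {i, j} \<in> edges F" if "i \<in> verts F" "j \<in> verts F" for i j
    proof -
      have "i < j \<Longrightarrow> ?thesis" using that e1[of i j] e2[of i j] by (auto simp: epairs_def vpairs_def)
      moreover have "j < i \<Longrightarrow> ?thesis" using that e1[of j i] e2[of j i]
        by (auto simp: epairs_def vpairs_def insert_commute)
      \<comment> \<open>Both sides are false: an edge has two elements, so neither singleton is
        one.\<close>
      moreover have "i = j \<Longrightarrow> ?thesis" using edges_wf(2)[of "{i}" F] edges_wf(2)[of "{f i}" G] by auto
      ultimately show ?thesis by linarith
    qed
    have "edges H = (\<lambda>e. f ` e) ` edges F"
    proof (intro set_eqI iffI)
      fix e assume "e \<in> edges H"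
      then have e: "e \<in> edges G" "e \<subseteq> f ` verts F" by (auto simp: H)
      from edges_wf(2)[OF e(1)] obtain x y where xy: "e = {x, y}" by (auto simp: card_2_iff)
      then obtain i j where "i \<in> verts F" "j \<in> verts F" "x = f i" "y = f j" using e(2) by auto
      then show "e \<in> (\<lambda>e. f ` e) ` edges F"
        using eq[of i j] e xy by (auto intro!: image_eqI[of _ _ "{i, j}"])
    next
      fix e assume "e \<in> (\<lambda>e. f ` e) ` edges F"
      then obtain i j where ij: "{i, j} \<in> edges F" "e = {f i, f j}"
        by (auto simp: edges_eq_epairs)
      moreover have "i \<in> verts F" "j \<in> verts F" using edges_wf(1)[OF ij(1)] by auto
      ultimately show "e \<in> edges H" using eq by (auto simp: H)
    qed
    then have "isomorphic F H" using inj by (auto simp: isomorphic_def H bij_betw_def)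
    \<comment> \<open>\<open>hereditary\<close> carries membership along the isomorphism, here from
      \<open>H\<close> to \<open>F\<close>, so the one just found has to be inverted.\<close>
    then have "isomorphic H F"
      unfolding isomorphic_def
    proof (elim exE conjE)
      fix g assume g: "bij_betw g (verts F) (verts H)" "edges H = (\<lambda>e. g ` e) ` edges F"
      let ?k = "inv_into (verts F) g"
      have "?k ` g ` e = e" if "e \<in> edges F" for e
        using edges_wf(1)[OF that] g(1) by (auto simp: bij_betw_def inv_into_image_cancel)
      then have "edges F = (\<lambda>e. ?k ` e) ` edges H"
        by (simp add: g(2) image_image)
      with bij_betw_inv_into[OF g(1)]
      show "\<exists>f. bij_betw f (verts H) (verts F) \<and> edges F = (\<lambda>e. f ` e) ` edges H" by blast
    qed
    then show False using P \<open>H \<in> P\<close> F unfolding hereditary_def by blast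
  qed
  have fin: "finite (verts F \<rightarrow>\<^sub>E verts G)" by (simp add: finite_PiE)
  have "(\<Sum>f\<in>verts F \<rightarrow>\<^sub>E verts G. h f) = (\<Sum>f\<in>?B. h f)"
    by (rule sum.mono_neutral_right) (use fin h0 in auto)
  also have "\<dots> \<le> (\<Sum>f\<in>?B. 1)" by (rule sum_mono) (simp add: h1)
  also have "\<dots> = card ?B" by simp
  finally have "ind_density F G \<le> real (card ?B) / real ?N ^ ?m"
    unfolding ind_density_def h_def by (rule divide_right_mono) simp
  also have "real (card ?B) * real ?N \<le> real (?m ^ 2) * real ?N ^ ?m"
    by (rule card_noninjective_maps) simp_all
  then have "real (card ?B) / real ?N ^ ?m \<le> real (?m ^ 2) / real ?N"
    using card_verts_pos[of G] by (simp add: field_simps)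
  finally show ?thesis .
qed

section \<open>Random induced subgraphs\<close>

text \<open>A map \<open>u\<close> on \<open>I\<close> is the trace along \<open>f\<close> of
  exactly \<open>card V ^ (card K - card I)\<close> maps on \<open>K\<close>, one for each choice of
  values outside the image of \<open>f\<close>. In other words, coordinates of a uniform sample
  picked by an injection form a uniform sample.\<close>

lemma sum_maps_comp_inj:
  fixes \<phi> :: "('i \<Rightarrow> 'v) \<Rightarrow> real"
  assumes "finite K" "finite V" "inj_on f I" "f ` I \<subseteq> K"
  shows "(\<Sum>v\<in>K \<rightarrow>\<^sub>E V. \<phi> (\<lambda>i\<in>I. v (f i))) = real (card V) ^ (card K - card I) * (\<Sum>u\<in>I \<rightarrow>\<^sub>E V. \<phi> u)"
proof -
  have finI: "finite I" using assms finite_subset finite_image_iff by metis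
  have fin: "finite (K \<rightarrow>\<^sub>E V)" "finite (I \<rightarrow>\<^sub>E V)" using assms finI by (auto intro: finite_PiE)
  let ?r = "\<lambda>v. \<lambda>i\<in>I. v (f i)"
  have fib: "card {v \<in> K \<rightarrow>\<^sub>E V. ?r v = u} = card V ^ (card K - card I)" if u: "u \<in> I \<rightarrow>\<^sub>E V" for u
  proof -
    \<comment> \<open>Values on the image of \<open>f\<close> are forced by \<open>u\<close>, all
      others are free.\<close>
    let ?B = "\<lambda>k. if k \<in> f ` I then {u (the_inv_into I f k)} else V"
    have "{v \<in> K \<rightarrow>\<^sub>E V. ?r v = u} = Pi\<^sub>E K ?B"
    proof (intro set_eqI iffI)
      fix v assume v: "v \<in> {v \<in> K \<rightarrow>\<^sub>E V. ?r v = u}"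
      have vu: "v (f i) = u i" if "i \<in> I" for i
        using v that by (metis (mono_tags, lifting) mem_Collect_eq restrict_apply')
      show "v \<in> Pi\<^sub>E K ?B"
      proof (rule PiE_I)
        have vK: "v \<in> K \<rightarrow>\<^sub>E V" using v by simp
        fix k
        show "v k = undefined" if "k \<notin> K" using vK that by (rule PiE_arb)
        assume "k \<in> K"
        then have "v k \<in> V" by (rule PiE_mem[OF vK])
        then show "v k \<in> ?B k" using vu the_inv_into_f_f[OF assms(3)] by auto
      qed
    next
      fix v assume v: "v \<in> Pi\<^sub>E K ?B"
      have vf: "v (f i) = u i" if "i \<in> I" for i
      proof -
        have "f i \<in> K" using that assms(4) by blast
        from PiE_mem[OF v this] have "v (f i) \<in> ?B (f i)" .
        then show ?thesis using that assms(3) by (simp add: the_inv_into_f_f)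
      qed
      have "v k \<in> V" if "k \<in> K" for k
      proof (cases "k \<in> f ` I")
        case True
        then obtain i where i: "i \<in> I" "k = f i" by blast
        then show ?thesis using vf[OF i(1)] PiE_mem[OF u i(1)] by simp
      next
        case False
        then show ?thesis using PiE_mem[OF v that] by simp
      qed
      moreover have "?r v = u"
      proof (rule ext)
        fix i show "?r v i = u i"
          using vf[of i] PiE_arb[OF u, of i] by (cases "i \<in> I") simp_all
      qed
      ultimately show "v \<in> {v \<in> K \<rightarrow>\<^sub>E V. ?r v = u}"
        using PiE_arb[OF v] by (simp add: PiE_I)
    qed
    then have "card {v \<in> K \<rightarrow>\<^sub>E V. ?r v = u} = (\<Prod>k\<in>K. card (?B k))"
      using card_PiE[OF assms(1), of ?B] by simp
    also have "\<dots> = (\<Prod>k\<in>K. if k \<in> f ` I then 1 else card V)"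
      by (rule prod.cong) auto
    also have "\<dots> = card V ^ card (K - f ` I)"
      using assms(1) by (simp add: prod.If_cases Diff_eq[symmetric])
    also have "card (K - f ` I) = card K - card I"
      using assms finI by (simp add: card_Diff_subset card_image)
    finally show ?thesis .
  qed
  have "(\<Sum>v\<in>K \<rightarrow>\<^sub>E V. \<phi> (?r v)) = (\<Sum>u\<in>I \<rightarrow>\<^sub>E V. \<Sum>v\<in>{v \<in> K \<rightarrow>\<^sub>E V. ?r v = u}. \<phi> (?r v))"
  proof (rule sum.group[symmetric])
    have "f i \<in> K" if "i \<in> I" for i using that assms(4) by blast
    then show "?r ` (K \<rightarrow>\<^sub>E V) \<subseteq> I \<rightarrow>\<^sub>E V" by (auto simp: PiE_iff)
  qed (use fin in simp_all)
  also have "\<dots> = (\<Sum>u\<in>I \<rightarrow>\<^sub>E V. \<Sum>v\<in>{v \<in> K \<rightarrow>\<^sub>E V. ?r v = u}. \<phi> u)"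
    by (intro sum.cong) auto
  also have "\<dots> = real (card V) ^ (card K - card I) * (\<Sum>u\<in>I \<rightarrow>\<^sub>E V. \<phi> u)"
    by (simp add: fib sum_distrib_left)
  finally show ?thesis .
qed

text \<open>Sampling is with replacement, so the coordinates of \<open>v\<close> are independent.
  Two copies of the same vertex are nonadjacent, because a singleton is not an edge of
  \<open>G\<close>.\<close>

definition sample_graph :: "nat \<Rightarrow> sgraph \<Rightarrow> (nat \<Rightarrow> nat) \<Rightarrow> sgraph" where
  "sample_graph k G v = mk_sgraph {..<k} {{i, j} | i j. i < k \<and> j < k \<and> {v i, v j} \<in> edges G}"

lemma sample_graph:
  assumes "k > 0"
  shows "verts (sample_graph k G v) = {..<k}"
    and "i < k \<Longrightarrow> j < k \<Longrightarrow> adj (sample_graph k G v) i j = adj G (v i) (v j)"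
proof -
  have "e \<subseteq> {..<k} \<and> card e = 2" if "e \<in> {{i, j} | i j. i < k \<and> j < k \<and> {v i, v j} \<in> edges G}" for e
  proof -
    from that obtain i j where ij: "e = {i, j}" "i < k" "j < k" "{v i, v j} \<in> edges G" by blast
    then have "i \<noteq> j" using edges_wf(2)[of "{v i, v j}" G] by auto
    then show ?thesis using ij by auto
  qed
  note wf = this
  have ne: "finite {..<k}" "{..<k} \<noteq> {}" using assms by auto
  have *: "verts (sample_graph k G v) = {..<k}"
    "edges (sample_graph k G v) = {{i, j} | i j. i < k \<and> j < k \<and> {v i, v j} \<in> edges G}"
    unfolding sample_graph_def by (rule mk_sgraph[OF ne], erule wf)+
  then show "verts (sample_graph k G v) = {..<k}" by simp
  show "adj (sample_graph k G v) i j = adj G (v i) (v j)" if "i < k" "j < k"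
    using that by (auto simp: adj_def * doubleton_eq_iff insert_commute)
qed

definition sample_mean :: "nat \<Rightarrow> sgraph \<Rightarrow> (sgraph \<Rightarrow> real) \<Rightarrow> real" where
  "sample_mean k G X = (\<Sum>v\<in>{..<k} \<rightarrow>\<^sub>E verts G. X (sample_graph k G v)) / real (card (verts G)) ^ k"

lemma sample_mean_linear:
  "sample_mean k G (\<lambda>H. X H + Y H) = sample_mean k G X + sample_mean k G Y"
  "sample_mean k G (\<lambda>H. c * X H) = c * sample_mean k G X"
  by (simp_all add: sample_mean_def sum.distrib add_divide_distrib sum_distrib_left)

lemma sample_mean_sum:
  "sample_mean k G (\<lambda>H. \<Sum>s\<in>S. X s H) = (\<Sum>s\<in>S. sample_mean k G (X s))"
  unfolding sample_mean_def by (subst sum.swap) (simp add: sum_divide_distrib)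

lemma sample_mean_const: "sample_mean k G (\<lambda>H. c) = c"
  using card_verts_pos[of G] by (simp add: sample_mean_def card_PiE)

lemma sample_mean_mono:
  assumes "\<And>v. v \<in> {..<k} \<rightarrow>\<^sub>E verts G \<Longrightarrow> X (sample_graph k G v) \<le> Y (sample_graph k G v)"
  shows "sample_mean k G X \<le> sample_mean k G Y"
  unfolding sample_mean_def by (intro divide_right_mono sum_mono assms) auto

text \<open>Exchange the sum over samples \<open>v\<close> with the sum over maps \<open>f\<close>
  of \<open>F\<close> into the sample. For injective \<open>f\<close> the mean over \<open>v\<close>
  is exactly the density in \<open>G\<close>; the noninjective \<open>f\<close> are a small
  fraction, and each of them is off by at most 1.\<close>

lemma sample_mean_hom_density:
  assumes "k > 0"
  shows "\<bar>sample_mean k G (hom_density F) - hom_density F G\<bar> \<le> real (card (verts F) ^ 2) / real k"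
proof -
  let ?I = "verts F" and ?V = "verts G" and ?m = "card (verts F)" and ?N = "real (card (verts G))"
  let ?K = "{..<k}" and ?t = "hom_density F G"
  have N: "?N > 0" using card_verts_pos by simp
  define h where "h u = (\<Prod>(i, j)\<in>epairs F. adj G (u i) (u j))" for u
  have h01: "h u \<in> {0..1}" for u
    unfolding h_def by (intro prod_kernel_bounds adj_bounds)
  define s where "s f = (\<Sum>v\<in>?K \<rightarrow>\<^sub>E ?V. h (\<lambda>i\<in>?I. v (f i))) / ?N ^ k" for f
  have finK: "finite (?K \<rightarrow>\<^sub>E ?V)" "finite (?I \<rightarrow>\<^sub>E ?K)" by (auto intro: finite_PiE)
  have mean: "sample_mean k G (hom_density F) = (\<Sum>f\<in>?I \<rightarrow>\<^sub>E ?K. s f) / real k ^ ?m"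
  proof -
    have "hom_density F (sample_graph k G v) = (\<Sum>f\<in>?I \<rightarrow>\<^sub>E ?K. h (\<lambda>i\<in>?I. v (f i))) / real k ^ ?m" for v
    proof -
      have "(\<Prod>(i, j)\<in>epairs F. adj (sample_graph k G v) (f i) (f j)) = h (\<lambda>i\<in>?I. v (f i))"
        if f: "f \<in> ?I \<rightarrow>\<^sub>E ?K" for f
        unfolding h_def
      proof (rule prod.cong[OF refl])
        fix p assume p: "p \<in> epairs F"
        obtain i j where ij: "p = (i, j)" by (cases p)
        with p have V: "i \<in> ?I" "j \<in> ?I" by (auto simp: epairs_def vpairs_def)
        then have "f i < k" "f j < k" using f by auto
        then show "(case p of (i, j) \<Rightarrow> adj (sample_graph k G v) (f i) (f j)) =
            (case p of (i, j) \<Rightarrow> adj G ((\<lambda>i\<in>?I. v (f i)) i) ((\<lambda>i\<in>?I. v (f i)) j))"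
          using V sample_graph(2)[OF assms] by (simp add: ij)
      qed
      then show ?thesis by (simp add: hom_density_eq map_density_def sample_graph(1)[OF assms])
    qed
    then have "sample_mean k G (hom_density F) =
        (\<Sum>v\<in>?K \<rightarrow>\<^sub>E ?V. \<Sum>f\<in>?I \<rightarrow>\<^sub>E ?K. h (\<lambda>i\<in>?I. v (f i))) / real k ^ ?m / ?N ^ k"
      by (simp add: sample_mean_def sum_divide_distrib)
    also have "\<dots> = (\<Sum>f\<in>?I \<rightarrow>\<^sub>E ?K. s f) / real k ^ ?m"
      by (subst sum.swap) (simp add: s_def sum_divide_distrib divide_divide_eq_left mult.commute)
    finally show ?thesis .
  qed
  have s_inj: "s f = ?t" if f: "f \<in> ?I \<rightarrow>\<^sub>E ?K" "inj_on f ?I" for f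
  proof -
    \<comment> \<open>Makes the truncated subtraction \<open>k - ?m\<close> a genuine one.\<close>
    have "?m \<le> k" using card_inj_on_le[OF f(2), of ?K] f(1) by auto
    have "(\<Sum>v\<in>?K \<rightarrow>\<^sub>E ?V. h (\<lambda>i\<in>?I. v (f i))) = ?N ^ (k - ?m) * (\<Sum>u\<in>?I \<rightarrow>\<^sub>E ?V. h u)"
      using sum_maps_comp_inj[of ?K ?V f ?I h] f by auto
    moreover have "?N ^ k = ?N ^ (k - ?m) * ?N ^ ?m" using \<open>?m \<le> k\<close> by (simp flip: power_add)
    ultimately show ?thesis using N by (simp add: s_def hom_density_eq map_density_def h_def)
  qed
  have s01: "s f \<in> {0..1}" for f
  proof -
    have "(\<Sum>v\<in>?K \<rightarrow>\<^sub>E ?V. h (\<lambda>i\<in>?I. v (f i))) \<le> (\<Sum>v\<in>?K \<rightarrow>\<^sub>E ?V. 1)"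
      by (intro sum_mono) (use h01 in auto)
    also have "\<dots> = ?N ^ k" by (simp add: card_PiE)
    finally show ?thesis
      using N h01 by (auto simp: s_def divide_le_eq intro!: divide_nonneg_nonneg sum_nonneg)
  qed
  have t01: "?t \<in> {0..1}"
  proof -
    have "(\<Sum>f\<in>?I \<rightarrow>\<^sub>E ?V. h f) \<le> (\<Sum>v\<in>?I \<rightarrow>\<^sub>E ?V. 1)"
      by (intro sum_mono) (use h01 in auto)
    also have "\<dots> = ?N ^ ?m" by (simp add: card_PiE)
    finally show ?thesis using N h01
      by (auto simp: hom_density_eq map_density_def h_def[symmetric] divide_le_eq intro!: divide_nonneg_nonneg sum_nonneg)
  qed
  let ?B = "{f \<in> ?I \<rightarrow>\<^sub>E ?K. \<not> inj_on f ?I}"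
  have "\<bar>(\<Sum>f\<in>?I \<rightarrow>\<^sub>E ?K. s f - ?t)\<bar> \<le> (\<Sum>f\<in>?I \<rightarrow>\<^sub>E ?K. \<bar>s f - ?t\<bar>)" by (rule sum_abs)
  also have "\<dots> = (\<Sum>f\<in>?B. \<bar>s f - ?t\<bar>)"
    by (rule sum.mono_neutral_right) (use finK s_inj in auto)
  also have "\<dots> \<le> (\<Sum>f\<in>?B. 1)"
  proof (rule sum_mono)
    fix f show "\<bar>s f - ?t\<bar> \<le> 1" using s01[of f] t01 by (auto simp: abs_le_iff)
  qed
  also have "\<dots> = card ?B" by simp
  finally have 1: "\<bar>(\<Sum>f\<in>?I \<rightarrow>\<^sub>E ?K. s f) - real k ^ ?m * ?t\<bar> \<le> card ?B"
    by (simp add: sum_subtractf card_PiE)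
  have "real (card ?B) * real k \<le> real (?m ^ 2) * real k ^ ?m"
    using card_noninjective_maps[of ?I ?K] by simp
  then have 2: "real (card ?B) / real k ^ ?m \<le> real (?m ^ 2) / real k"
    using assms by (simp add: field_simps)
  have "sample_mean k G (hom_density F) - ?t = ((\<Sum>f\<in>?I \<rightarrow>\<^sub>E ?K. s f) - real k ^ ?m * ?t) / real k ^ ?m"
    using assms by (simp add: mean field_simps)
  then have "\<bar>sample_mean k G (hom_density F) - ?t\<bar> \<le> real (card ?B) / real k ^ ?m"
    using 1 by (simp add: divide_right_mono)
  with 2 show ?thesis by linarith
qed

text \<open>The event is equality of labelled graphs, not isomorphism. As \<open>ind_density\<close>
  counts all maps, the weight of \<open>v\<close> in it is precisely the indicator of this
  event.\<close>

lemma sample_mean_eq_ind_density: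
  assumes "verts H = {..<k}"
  shows "sample_mean k G (\<lambda>H'. of_bool (H' = H)) = ind_density H G"
proof -
  have k: "k > 0" using assms verts_nonempty[of H] by (metis lessThan_0 not_gr_zero)
  have "of_bool (sample_graph k G v = H) = (\<Prod>(i, j)\<in>epairs H. adj G (v i) (v j)) *
     (\<Prod>(i, j)\<in>vpairs H - epairs H. 1 - adj G (v i) (v j))" for v
  proof -
    let ?S = "sample_graph k G v"
    have vp: "vpairs ?S = vpairs H" by (simp add: vpairs_def sample_graph(1)[OF k] assms)
    have ep: "(i, j) \<in> epairs ?S \<longleftrightarrow> {v i, v j} \<in> edges G" if "(i, j) \<in> vpairs H" for i j
    proof -
      have "i < k" "j < k" using that by (auto simp: vpairs_def assms)
      from sample_graph(2)[OF k this, of G v] show ?thesis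
        using that by (auto simp: epairs_def adj_def vp of_bool_def split: if_splits)
    qed
    have "?S = H \<longleftrightarrow> epairs ?S = epairs H"
      by (metis sgraph_eqI edges_eq_epairs sample_graph(1)[OF k] assms)
    also have "\<dots> \<longleftrightarrow> (\<forall>p\<in>vpairs H. p \<in> epairs ?S \<longleftrightarrow> p \<in> epairs H)"
      using epairs_subset[of ?S] epairs_subset[of H] vp by auto
    also have "\<dots> \<longleftrightarrow> (\<forall>(i, j)\<in>epairs H. {v i, v j} \<in> edges G) \<and>
       (\<forall>(i, j)\<in>vpairs H - epairs H. {v i, v j} \<notin> edges G)"
      using ep epairs_subset[of H] by fast
    finally have "of_bool (?S = H) = (of_bool (\<forall>(i, j)\<in>epairs H. {v i, v j} \<in> edges G) *
       of_bool (\<forall>(i, j)\<in>vpairs H - epairs H. {v i, v j} \<notin> edges G) :: real)"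
      by (simp add: of_bool_conj)
    also have "\<dots> = (\<Prod>(i, j)\<in>epairs H. adj G (v i) (v j)) *
     (\<Prod>(i, j)\<in>vpairs H - epairs H. 1 - adj G (v i) (v j))"
      using prod_of_bool[of "epairs H" "\<lambda>(i, j). {v i, v j} \<in> edges G"]
        prod_of_bool[of "vpairs H - epairs H" "\<lambda>(i, j). {v i, v j} \<notin> edges G"]
      by (simp add: adj_def case_prod_unfold of_bool_not_iff)
    finally show ?thesis .
  qed
  then show ?thesis by (simp add: sample_mean_def ind_density_def assms)
qed

text \<open>Homomorphisms from two disjoint copies of \<open>F\<close> are pairs of homomorphisms
  from \<open>F\<close>. The square of a density is thus itself a density, which reduces second
  moments of samples to first moments.\<close>

lemma disjoint_double:
  obtains FF where "\<And>G. hom_density FF G = (hom_density F G)\<^sup>2" "card (verts FF) = 2 * card (verts F)"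
proof -
  let ?V = "verts F" and ?E = "epairs F"
  \<comment> \<open>A shift beyond the largest vertex keeps the two copies disjoint.\<close>
  define c where "c = Suc (Max ?V)"
  have lt: "i < c" if "i \<in> ?V" for i using that by (simp add: c_def less_Suc_eq_le)
  let ?s = "\<lambda>i. i + c" and ?sp = "\<lambda>(i, j). (i + c, j + c)"
  let ?V' = "?s ` ?V" and ?E' = "?sp ` ?E"
  have E: "i \<in> ?V" "j \<in> ?V" "i < j" if "(i, j) \<in> ?E" for i j
    using that by (auto simp: epairs_def vpairs_def)
  have dV: "?V \<inter> ?V' = {}" using lt by fastforce
  have dE: "?E \<inter> ?E' = {}" using E lt by fastforce
  obtain FF where FF: "verts FF = ?V \<union> ?V'" "epairs FF = ?E \<union> ?E'"
  proof (rule graph_of_pairs[of "?V \<union> ?V'" "?E \<union> ?E'"])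
    show "?E \<union> ?E' \<subseteq> {(i, j). i \<in> ?V \<union> ?V' \<and> j \<in> ?V \<union> ?V' \<and> i < j}"
      using E by auto
  qed auto
  have cV': "card ?V' = card ?V" by (rule card_image) (simp add: inj_on_def)
  then have card: "card (verts FF) = 2 * card ?V"
    using dV by (simp add: FF card_Un_disjoint)
  have "hom_density FF G = (hom_density F G)\<^sup>2" for G
  proof -
    let ?W = "verts G"
    let ?h = "\<lambda>f. \<Prod>(i, j)\<in>?E. adj G (f i) (f j)"
    have "(\<Sum>f\<in>?V \<union> ?V' \<rightarrow>\<^sub>E ?W. \<Prod>(i, j)\<in>?E \<union> ?E'. adj G (f i) (f j))
      = (\<Sum>(f, g)\<in>(?V \<rightarrow>\<^sub>E ?W) \<times> (?V \<rightarrow>\<^sub>E ?W). ?h f * ?h g)"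
    proof (rule sum.reindex_bij_witness[where
          i = "\<lambda>(f, g). \<lambda>x\<in>?V \<union> ?V'. if x \<in> ?V then f x else g (x - c)" and
          j = "\<lambda>h. (restrict h ?V, \<lambda>x\<in>?V. h (x + c))"])
      fix f assume f: "f \<in> ?V \<union> ?V' \<rightarrow>\<^sub>E ?W"
      show "(case (restrict f ?V, \<lambda>x\<in>?V. f (x + c)) of (f, g) \<Rightarrow>
          \<lambda>x\<in>?V \<union> ?V'. if x \<in> ?V then f x else g (x - c)) = f"
      proof (rule ext)
        fix x
        consider "x \<in> ?V" | y where "y \<in> ?V" "x = y + c" "x \<notin> ?V" | "x \<notin> ?V \<union> ?V'"
          by blast
        then show "(case (restrict f ?V, \<lambda>x\<in>?V. f (x + c)) of (f, g) \<Rightarrow>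
          \<lambda>x\<in>?V \<union> ?V'. if x \<in> ?V then f x else g (x - c)) x = f x"
          by cases (simp_all add: PiE_arb[OF f])
      qed
      show "(restrict f ?V, \<lambda>x\<in>?V. f (x + c)) \<in> (?V \<rightarrow>\<^sub>E ?W) \<times> (?V \<rightarrow>\<^sub>E ?W)"
        using PiE_mem[OF f] by (simp add: PiE_iff)
      have "(\<Prod>(i, j)\<in>?E. adj G (restrict f ?V i) (restrict f ?V j)) = ?h f"
        by (rule prod.cong) (use E in auto)
      moreover have "(\<Prod>(i, j)\<in>?E. adj G ((\<lambda>x\<in>?V. f (x + c)) i) ((\<lambda>x\<in>?V. f (x + c)) j)) =
          (\<Prod>(i, j)\<in>?E'. adj G (f i) (f j))"
        by (subst prod.reindex) (use E in \<open>auto simp: inj_on_def intro!: prod.cong\<close>)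
      ultimately show "(case (restrict f ?V, \<lambda>x\<in>?V. f (x + c)) of (f, g) \<Rightarrow> ?h f * ?h g) =
          (\<Prod>(i, j)\<in>?E \<union> ?E'. adj G (f i) (f j))"
        using dE by (simp add: prod.union_disjoint)
    next
      fix fg assume fg: "fg \<in> (?V \<rightarrow>\<^sub>E ?W) \<times> (?V \<rightarrow>\<^sub>E ?W)"
      obtain f g where [simp]: "fg = (f, g)" by (cases fg)
      show "(\<lambda>h. (restrict h ?V, \<lambda>x\<in>?V. h (x + c)))
          (case fg of (f, g) \<Rightarrow> \<lambda>x\<in>?V \<union> ?V'. if x \<in> ?V then f x else g (x - c)) = fg"
      proof -
        have f: "f \<in> ?V \<rightarrow>\<^sub>E ?W" and g: "g \<in> ?V \<rightarrow>\<^sub>E ?W" using fg by simp_all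
        let ?F = "\<lambda>x\<in>?V \<union> ?V'. if x \<in> ?V then f x else g (x - c)"
        have "restrict ?F ?V = f" by (rule ext) (simp add: PiE_arb[OF f] restrict_def)
        moreover have "(\<lambda>x\<in>?V. ?F (x + c)) = g"
        proof (rule ext)
          fix x show "(\<lambda>x\<in>?V. ?F (x + c)) x = g x"
            using dV by (cases "x \<in> ?V") (auto simp: PiE_arb[OF g])
        qed
        ultimately show ?thesis by simp
      qed
      show "(case fg of (f, g) \<Rightarrow> \<lambda>x\<in>?V \<union> ?V'. if x \<in> ?V then f x else g (x - c)) \<in> ?V \<union> ?V' \<rightarrow>\<^sub>E ?W"
      proof -
        have "f x \<in> ?W" "g x \<in> ?W" if "x \<in> ?V" for x using fg that by (auto simp: PiE_iff)
        then show ?thesis by (auto simp: PiE_iff)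
      qed
    qed
    also have "\<dots> = (\<Sum>f\<in>?V \<rightarrow>\<^sub>E ?W. ?h f)\<^sup>2"
      by (simp add: power2_eq_square sum_product sum.cartesian_product)
    finally show ?thesis
      by (simp add: hom_density_eq map_density_def FF card[unfolded FF] power_divide power_mult[symmetric]
          mult.commute)
  qed
  with card that show thesis by blast
qed

text \<open>Expand the square and write e for |V(F)|^2 / k. The mean of
  \<open>hom_density FF\<close> is off by at most 4e, because \<open>FF\<close> has twice as many
  vertices, and the cross term by at most 2e, because densities are at most 1.\<close>

lemma sample_variance:
  assumes "k > 0"
  shows "sample_mean k G (\<lambda>H. (hom_density F H - hom_density F G)\<^sup>2) \<le> 6 * real (card (verts F) ^ 2) / real k"
proof -
  let ?t = "hom_density F G" and ?e = "real (card (verts F) ^ 2) / real k"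
  obtain FF where FF: "\<And>G. hom_density FF G = (hom_density F G)\<^sup>2" "card (verts FF) = 2 * card (verts F)"
    using disjoint_double[of F] by blast
  have "?t \<ge> 0" "?t \<le> 1"
  proof -
    show "?t \<ge> 0" by (simp add: hom_density_def)
    have "card {f \<in> verts F \<rightarrow>\<^sub>E verts G. \<forall>e\<in>edges F. f ` e \<in> edges G} \<le> card (verts F \<rightarrow>\<^sub>E verts G)"
      by (rule card_mono) (auto intro: finite_PiE)
    then have "real (card {f \<in> verts F \<rightarrow>\<^sub>E verts G. \<forall>e\<in>edges F. f ` e \<in> edges G}) \<le> real (card (verts G)) ^ card (verts F)"
      by (simp add: card_PiE flip: of_nat_power)
    then show "?t \<le> 1" using card_verts_pos[of G] by (simp add: hom_density_def divide_le_eq)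
  qed
  have "(\<lambda>H. (hom_density F H - ?t)\<^sup>2) = (\<lambda>H. (hom_density FF H + (- 2 * ?t) * hom_density F H) + ?t\<^sup>2)"
    by (auto simp: fun_eq_iff FF power2_diff)
  then have "sample_mean k G (\<lambda>H. (hom_density F H - ?t)\<^sup>2) =
      sample_mean k G (hom_density FF) + (- 2 * ?t) * sample_mean k G (hom_density F) + ?t\<^sup>2"
    by (simp only: sample_mean_linear sample_mean_const)
  also have "\<dots> \<le> (?t\<^sup>2 + 4 * ?e) + ((- 2 * ?t) * ?t + 2 * ?e) + ?t\<^sup>2"
  proof (intro add_mono order_refl)
    show "sample_mean k G (hom_density FF) \<le> ?t\<^sup>2 + 4 * ?e"
      using sample_mean_hom_density[OF assms, of G FF] by (simp add: FF power2_eq_square abs_le_iff)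
    have "?t * (?t - sample_mean k G (hom_density F)) \<le> ?t * ?e"
      using sample_mean_hom_density[OF assms, of G F] \<open>?t \<ge> 0\<close> by (intro mult_left_mono) (auto simp: abs_le_iff)
    also have "\<dots> \<le> ?e" using \<open>?t \<le> 1\<close> by (intro mult_left_le_one_le) (auto simp: \<open>?t \<ge> 0\<close>)
    finally show "(- 2 * ?t) * sample_mean k G (hom_density F) \<le> (- 2 * ?t) * ?t + 2 * ?e"
      by (simp add: algebra_simps)
  qed
  also have "\<dots> = 6 * real (card (verts F) ^ 2) / real k" by (simp add: power2_eq_square)
  finally show ?thesis .
qed

section \<open>A sequence in the class with the given limit\<close>

lemma finite_sgraphs_within: "finite {H. verts H \<subseteq> {..<k}}"
proof (rule inj_on_finite[where f = "\<lambda>H. (verts H, edges H)"])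
  show "inj_on (\<lambda>H. (verts H, edges H)) {H. verts H \<subseteq> {..<k}}"
    by (auto intro: inj_onI sgraph_eqI)
  show "(\<lambda>H. (verts H, edges H)) ` {H. verts H \<subseteq> {..<k}} \<subseteq> Pow {..<k} \<times> Pow (Pow {..<k})"
    using edges_wf(1) by fastforce
qed simp

lemma countable_sgraphs: "countable (UNIV :: sgraph set)"
proof -
  have "countable (\<Union>k. {H. verts H \<subseteq> {..<k}})"
    by (rule countable_UN) (simp_all add: countable_finite finite_sgraphs_within)
  moreover have "(UNIV :: sgraph set) \<subseteq> (\<Union>k. {H. verts H \<subseteq> {..<k}})"
  proof
    fix H
    obtain k where "verts H \<subseteq> {..<k}" using finite_nat_bounded[OF finite_verts] by (rule exE)
    then show "H \<in> (\<Union>k. {H. verts H \<subseteq> {..<k}})" by (intro UN_I[of k]) simp_all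
  qed
  ultimately show ?thesis by (rule countable_subset[rotated])
qed

text \<open>Otherwise every sample of order \<open>k\<close> lies outside \<open>P\<close> or has
  some density off by \<open>\<epsilon>\<close>. For large \<open>n\<close> the first event has
  probability below 1/2, and by Chebyshev's inequality the second has probability below 1/4.\<close>

lemma sample_in_class:
  assumes G: "densities_converge G \<gamma>" and ind: "\<And>H. H \<notin> P \<Longrightarrow> (\<lambda>n. ind_density H (G n)) \<longlonglongrightarrow> 0"
    and \<F>: "finite \<F>" and \<epsilon>: "\<epsilon> > 0"
  shows "\<exists>H\<in>P. K \<le> card (verts H) \<and> (\<forall>F\<in>\<F>. \<bar>hom_density F H - \<gamma> F\<bar> < \<epsilon>)"
proof (rule ccontr)
  assume contr: "\<not> ?thesis"
  \<comment> \<open>\<open>S / real k\<close> bounds the sum of the mean squared deviations over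
    \<open>\<F>\<close>. Below \<open>\<epsilon>\<^sup>2 / 16\<close> it becomes 1/4 after
    multiplication by the Chebyshev factor \<open>4 / \<epsilon>\<^sup>2\<close>.\<close>
  define S where "S = (\<Sum>F\<in>\<F>. 6 * real (card (verts F) ^ 2))"
  obtain k where k: "k > 0" "K \<le> k" "S / real k < \<epsilon>\<^sup>2 / 16"
  proof -
    obtain k0 where k0: "real k0 > S / (\<epsilon>\<^sup>2 / 16)" using reals_Archimedean2 by blast
    have S0: "S \<ge> 0" unfolding S_def by (intro sum_nonneg) simp
    let ?k = "max (Suc K) k0"
    have "S / (\<epsilon>\<^sup>2 / 16) < real ?k" using k0 by linarith
    then have "S < real ?k * (\<epsilon>\<^sup>2 / 16)" using \<epsilon> by (simp add: pos_divide_less_eq)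
    moreover have "real ?k > 0" by simp
    ultimately have "S / real ?k < \<epsilon>\<^sup>2 / 16"
      by (metis mult.commute pos_divide_less_eq)
    then show thesis using that[of ?k] by simp
  qed
  \<comment> \<open>The order \<open>k\<close> is fixed before \<open>n\<close>, so only finitely
    many labelled graphs have to be avoided, and the sum of their vanishing densities
    vanishes.\<close>
  define B where "B = {H. verts H = {..<k} \<and> H \<notin> P}"
  have finB: "finite B"
    by (rule finite_subset[OF _ finite_sgraphs_within[of k]]) (auto simp: B_def)
  have "(\<lambda>n. \<Sum>H\<in>B. ind_density H (G n)) \<longlonglongrightarrow> (\<Sum>H\<in>B. 0)"
    by (intro tendsto_sum ind) (simp add: B_def)
  then have ev1: "eventually (\<lambda>n. (\<Sum>H\<in>B. ind_density H (G n)) < 1/2) sequentially"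
    by (intro order_tendstoD(2)[where y = 0]) auto
  have "eventually (\<lambda>n. \<bar>hom_density F (G n) - \<gamma> F\<bar> < \<epsilon> / 2) sequentially" for F
  proof -
    have "(\<lambda>n. hom_density F (G n)) \<longlonglongrightarrow> \<gamma> F" using G by (simp add: densities_converge_def)
    from tendstoD[OF this, of "\<epsilon> / 2"] \<epsilon> show ?thesis by (simp add: dist_real_def)
  qed
  then have "eventually (\<lambda>n. \<forall>F\<in>\<F>. \<bar>hom_density F (G n) - \<gamma> F\<bar> < \<epsilon> / 2) sequentially"
    using \<F> by (simp add: eventually_ball_finite)
  with ev1 obtain n where n: "(\<Sum>H\<in>B. ind_density H (G n)) < 1/2"
      "\<And>F. F \<in> \<F> \<Longrightarrow> \<bar>hom_density F (G n) - \<gamma> F\<bar> < \<epsilon> / 2"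
    using eventually_happens'[OF sequentially_bot eventually_conj[OF ev1]] by force
  let ?X = "\<lambda>F H. (hom_density F H - hom_density F (G n))\<^sup>2"
  \<comment> \<open>Dominates 1 on every sample. One outside \<open>P\<close> is counted by the
    first sum; for the others some density is off by \<open>\<epsilon>\<close> from the limit, hence
    by \<open>\<epsilon> / 2\<close> from \<open>G n\<close>, and the second sum is at least
    1.\<close>
  let ?Y = "\<lambda>H. (\<Sum>H'\<in>B. of_bool (H = H')) + 4 / \<epsilon>\<^sup>2 * (\<Sum>F\<in>\<F>. ?X F H)"
  have "sample_mean k (G n) (\<lambda>H. 1) \<le> sample_mean k (G n) ?Y"
  proof (rule sample_mean_mono)
    fix v
    let ?H = "sample_graph k (G n) v"
    have X0: "0 \<le> 4 / \<epsilon>\<^sup>2 * (\<Sum>F\<in>\<F>. ?X F ?H)" by (intro mult_nonneg_nonneg sum_nonneg) simp_all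
    have B0: "0 \<le> (\<Sum>H'\<in>B. of_bool (?H = H') :: real)" by (intro sum_nonneg) simp
    show "1 \<le> ?Y ?H"
    proof (cases "?H \<in> P")
      case True
      then obtain F where F: "F \<in> \<F>" "\<bar>hom_density F ?H - \<gamma> F\<bar> \<ge> \<epsilon>"
        using contr k(2) sample_graph(1)[OF k(1), of "G n" v] by (metis card_lessThan linorder_not_less)
      then have "\<bar>hom_density F ?H - hom_density F (G n)\<bar> \<ge> \<epsilon> / 2" using n(2)[of F] by linarith
      then have "(\<epsilon> / 2)\<^sup>2 \<le> ?X F ?H" using \<epsilon> by (simp add: abs_le_square_iff[symmetric])
      also have "\<dots> \<le> (\<Sum>F\<in>\<F>. ?X F ?H)" using F(1) \<F> by (intro member_le_sum) auto
      finally have "1 \<le> 4 / \<epsilon>\<^sup>2 * (\<Sum>F\<in>\<F>. ?X F ?H)"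
        using \<epsilon> by (simp add: field_simps)
      with B0 show ?thesis by linarith
    next
      case False
      then have "?H \<in> B" using sample_graph(1)[OF k(1)] by (simp add: B_def)
      then have "(\<Sum>H'\<in>B. of_bool (?H = H') :: real) = 1"
        using finB by (simp add: of_bool_def)
      then show ?thesis using X0 by linarith
    qed
  qed
  also have "\<dots> = (\<Sum>H\<in>B. ind_density H (G n)) + 4 / \<epsilon>\<^sup>2 * (\<Sum>F\<in>\<F>. sample_mean k (G n) (?X F))"
  proof -
    have "(\<Sum>H'\<in>B. sample_mean k (G n) (\<lambda>H. of_bool (H = H'))) = (\<Sum>H\<in>B. ind_density H (G n))"
      by (rule sum.cong) (auto simp: B_def sample_mean_eq_ind_density)
    then show ?thesis by (simp only: sample_mean_linear sample_mean_sum)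
  qed
  finally have 1: "1 \<le> (\<Sum>H\<in>B. ind_density H (G n)) + 4 / \<epsilon>\<^sup>2 * (\<Sum>F\<in>\<F>. sample_mean k (G n) (?X F))"
    by (simp only: sample_mean_const)
  have "(\<Sum>F\<in>\<F>. sample_mean k (G n) (?X F)) \<le> (\<Sum>F\<in>\<F>. 6 * real (card (verts F) ^ 2) / real k)"
    by (intro sum_mono sample_variance k)
  also have "\<dots> = S / real k" by (simp add: S_def sum_divide_distrib)
  also note k(3)
  finally have "4 / \<epsilon>\<^sup>2 * (\<Sum>F\<in>\<F>. sample_mean k (G n) (?X F)) < 4 / \<epsilon>\<^sup>2 * (\<epsilon>\<^sup>2 / 16)"
    using \<epsilon> by (intro mult_strict_left_mono) simp_all
  also have "\<dots> = 1 / 4" using \<epsilon> by simp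
  finally show False using 1 n(1) by linarith
qed

text \<open>Diagonal choice along an enumeration of the countably many graphs: the n-th graph has
  order at least n and is accurate up to 1/(n+1) for the first n+1 graphs enumerated.\<close>

lemma class_limit_of_ind_density:
  assumes G: "densities_converge G \<gamma>" and ind: "\<And>H. H \<notin> P \<Longrightarrow> (\<lambda>n. ind_density H (G n)) \<longlonglongrightarrow> 0"
  shows "\<exists>G'. (\<forall>n. G' n \<in> P) \<and> densities_converge G' \<gamma>"
proof -
  define e where "e = from_nat_into (UNIV :: sgraph set)"
  have e: "surj e" using range_from_nat_into[OF _ countable_sgraphs] by (simp add: e_def)
  have "\<forall>n. \<exists>H. H \<in> P \<and> n \<le> card (verts H) \<and> (\<forall>F\<in>e ` {..n}. \<bar>hom_density F H - \<gamma> F\<bar> < 1 / real (Suc n))"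
  proof
    fix n
    show "\<exists>H. H \<in> P \<and> n \<le> card (verts H) \<and> (\<forall>F\<in>e ` {..n}. \<bar>hom_density F H - \<gamma> F\<bar> < 1 / real (Suc n))"
      using sample_in_class[OF G ind, of P "e ` {..n}" "1 / real (Suc n)" n] by (simp add: Bex_def)
  qed
  then obtain G' where G': "\<And>n. G' n \<in> P" "\<And>n. n \<le> card (verts (G' n))"
    "\<And>n F. F \<in> e ` {..n} \<Longrightarrow> \<bar>hom_density F (G' n) - \<gamma> F\<bar> < 1 / real (Suc n)"
    by metis
  have "filterlim (\<lambda>n. card (verts (G' n))) at_top sequentially"
    by (rule filterlim_at_top_mono[OF filterlim_ident]) (simp add: G'(2))
  moreover have "(\<lambda>n. hom_density F (G' n)) \<longlonglongrightarrow> \<gamma> F" for F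
  proof -
    obtain i where i: "F = e i" using e by blast
    have "(\<lambda>n. hom_density F (G' n) - \<gamma> F) \<longlonglongrightarrow> 0"
    proof (rule Lim_null_comparison[OF _ LIMSEQ_inverse_real_of_nat])
      show "eventually (\<lambda>n. norm (hom_density F (G' n) - \<gamma> F) \<le> inverse (real (Suc n))) sequentially"
        using eventually_ge_at_top[of i]
      proof eventually_elim
        case (elim n)
        then show ?case using G'(3)[of F n] i by (force simp: inverse_eq_divide)
      qed
    qed
    then show ?thesis using Lim_null by blast
  qed
  ultimately show ?thesis using G'(1) by (auto simp: densities_converge_def)
qed

section \<open>Borel versions of graphons\<close>

text \<open>Deliberately not completed: Fubini's theorem and product measurability are used with
  Borel sets. \<open>cube V\<close> is the completion of a power of this measure, and Lebesgue
  measurable kernels are first replaced by Borel ones.\<close>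

definition I01 :: "real measure" where
  "I01 = restrict_space lborel {0..1}"

lemma space_I01: "space I01 = {0..1}"
  by (simp add: I01_def space_restrict_space)

lemma emeasure_I01_space: "emeasure I01 (space I01) = 1"
  by (simp add: I01_def space_restrict_space emeasure_restrict_space)

interpretation I01: finite_measure I01
  by standard (simp add: emeasure_I01_space)

lemma I01_borel [measurable (raw)]: "f \<in> borel_measurable borel \<Longrightarrow> f \<in> borel_measurable I01"
  by (simp add: I01_def measurable_restrict_space1)

lemma sets_I01_sub: "A \<in> sets borel \<Longrightarrow> A \<subseteq> {0..1} \<Longrightarrow> A \<in> sets I01"
  by (auto simp: I01_def sets_restrict_space intro!: image_eqI[of _ _ A])

lemma AE_I01: "(AE x in I01. P x) \<longleftrightarrow> (AE x in lborel. x \<in> {0..1} \<longrightarrow> P x)"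
  unfolding I01_def by (rule AE_restrict_space_iff) simp

lemma unit_square_borel [measurable]: "{0..1} \<times> {0..1} \<in> sets (borel :: (real \<times> real) measure)"
  by (intro borel_closed closed_Times) simp_all

lemma I01_id [measurable]: "(\<lambda>x. x) \<in> borel_measurable I01"
  by (rule I01_borel) simp

abbreviation "I01_sq \<equiv> I01 \<Otimes>\<^sub>M I01"

abbreviation "I01_pow V \<equiv> PiM V (\<lambda>_. I01)"

lemma I01_fst_snd: "(\<lambda>z. fst z) \<in> borel_measurable I01_sq" "(\<lambda>z. snd z) \<in> borel_measurable I01_sq"
  by (rule measurable_compose[OF measurable_fst I01_id], rule measurable_compose[OF measurable_snd I01_id])

text \<open>Graphons are measurable for planar Lebesgue measure, while Fubini's theorem speaks of a
  product of intervals. This identification moves almost-everywhere statements between the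
  two.\<close>

lemma pair_I01: "I01_sq = restrict_space lborel ({0..1} \<times> {0..1})"
proof (rule pair_measure_eqI)
  let ?R = "restrict_space lborel ({0..1} \<times> {0..1}) :: (real \<times> real) measure"
  show "sets I01_sq = sets ?R"
  proof
    show "sets I01_sq \<subseteq> sets ?R"
    proof (rule sets_pair_in_sets)
      fix A B assume "A \<in> sets I01" "B \<in> sets I01"
      then have "A \<in> sets borel" "A \<subseteq> {0..1}" "B \<in> sets borel" "B \<subseteq> {0..1}"
        by (auto simp: I01_def sets_restrict_space)
      then have "A \<times> B \<in> sets borel" "A \<times> B \<subseteq> {0..1} \<times> {0..1}"
        by (auto simp: borel_prod[symmetric])
      then show "A \<times> B \<in> sets ?R"
        by (auto simp: sets_restrict_space intro!: image_eqI[of _ _ "A \<times> B"])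
    qed
    show "sets ?R \<subseteq> sets I01_sq"
    proof
      fix C assume "C \<in> sets ?R"
      then obtain D where D: "D \<in> sets borel" "C = ({0..1} \<times> {0..1}) \<inter> D"
        by (auto simp: sets_restrict_space)
      have "(\<lambda>z. (fst z, snd z)) \<in> measurable I01_sq borel"
        unfolding borel_prod[symmetric] by (intro measurable_Pair I01_fst_snd)
      from measurable_sets[OF this D(1)] show "C \<in> sets I01_sq"
        by (simp add: D(2) space_pair_measure space_I01 Int_commute)
    qed
  qed
  fix A B assume AB: "A \<in> sets I01" "B \<in> sets I01"
  have A: "A \<in> sets borel" "A \<subseteq> {0..1}" and B: "B \<in> sets borel" "B \<subseteq> {0..1}"
    using AB by (auto simp: I01_def sets_restrict_space)
  have "emeasure (restrict_space lborel ({0..1} \<times> {0..1})) (A \<times> B) = emeasure lborel (A \<times> B)"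
    by (rule emeasure_restrict_space) (use A B in \<open>auto simp: unit_square_borel\<close>)
  also have "\<dots> = emeasure (lborel \<Otimes>\<^sub>M lborel) (A \<times> B)" by (simp add: lborel_prod)
  also have "\<dots> = emeasure lborel A * emeasure lborel B"
    by (rule lborel.emeasure_pair_measure_Times) (use A B in simp_all)
  also have "\<dots> = emeasure I01 A * emeasure I01 B"
    using A B by (simp add: I01_def emeasure_restrict_space)
  finally show "emeasure I01 A * emeasure I01 B = emeasure (restrict_space lborel ({0..1} \<times> {0..1})) (A \<times> B)" by simp
qed (rule I01.sigma_finite_measure_axioms)+

interpretation I01_pair: pair_sigma_finite I01 I01 ..

lemma emeasure_I01_sq_space: "emeasure I01_sq (space I01_sq) = 1"
  by (simp add: space_pair_measure I01.emeasure_pair_measure_Times emeasure_I01_space)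

interpretation I01_sq: finite_measure I01_sq
  by (rule finite_measureI) (simp add: emeasure_I01_sq_space)

lemma AE_pair_I01: "(AE z in I01_sq. P z) \<longleftrightarrow> (AE z in lborel. z \<in> {0..1} \<times> {0..1} \<longrightarrow> P z)"
  unfolding pair_I01 by (rule AE_restrict_space_iff) (simp add: unit_square_borel)

lemma borel_pair_I01 [measurable (raw)]:
  fixes f :: "real \<times> real \<Rightarrow> 'b::topological_space"
  assumes "f \<in> borel_measurable borel" shows "f \<in> borel_measurable I01_sq"
  unfolding pair_I01 using assms by (simp add: measurable_restrict_space1)

interpretation I01_prod: product_sigma_finite "\<lambda>_. I01" ..

text \<open>\<open>P\<close> is an arbitrary predicate; what gets swapped is a measurable null set
  that covers its failures.\<close>

lemma AE_swap_pair:
  assumes "AE z in I01_sq. P (fst z) (snd z)"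
  shows "AE z in I01_sq. P (snd z) (fst z)"
proof -
  obtain N where N: "N \<in> null_sets I01_sq" "{z \<in> space I01_sq. \<not> P (fst z) (snd z)} \<subseteq> N"
    using assms by (auto simp: eventually_ae_filter)
  have "AE z in distr I01_sq I01_sq (\<lambda>(x, y). (y, x)). z \<notin> N"
    unfolding I01_pair.distr_pair_swap[symmetric] by (rule AE_not_in[OF N(1)])
  then have "AE z in I01_sq. (snd z, fst z) \<notin> N"
    using N(1) by (subst (asm) AE_distr_iff) (auto simp: case_prod_unfold)
  then show ?thesis using AE_space
  proof eventually_elim
    case (elim z)
    then have "(snd z, fst z) \<in> space I01_sq" by (auto simp: space_pair_measure)
    then show ?case using N(2) elim(1) by auto
  qed
qed

lemma AE_snd_pair:
  assumes "AE y in I01. P y"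
  shows "AE z in I01_sq. P (snd z)" "AE z in I01_sq. P (fst z)"
proof -
  obtain N where N: "N \<in> null_sets I01" "{z \<in> space I01. \<not> P z} \<subseteq> N"
    using assms by (auto simp: eventually_ae_filter)
  have [measurable]: "N \<in> sets I01" using N(1) by auto
  have "AE x in I01. AE y in I01. snd (x, y) \<notin> N" using AE_not_in[OF N(1)] by simp
  then have "AE z in I01_sq. snd z \<notin> N"
    by (intro I01_pair.AE_pair_measure) simp_all
  then show 1: "AE z in I01_sq. P (snd z)" using AE_space
  proof eventually_elim
    case (elim z)
    then have "snd z \<in> space I01" by (auto simp: space_pair_measure)
    then show ?case using N(2) elim(1) by auto
  qed
  show "AE z in I01_sq. P (fst z)" using AE_swap_pair[of "\<lambda>x y. P y"] 1 by simp
qed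

text \<open>Symmetry and bounds are imposed on all reals, which spares side conditions about the
  unit square.\<close>

definition borel_graphon :: "(real \<Rightarrow> real \<Rightarrow> real) \<Rightarrow> bool" where
  "borel_graphon W \<longleftrightarrow> (\<lambda>z. W (fst z) (snd z)) \<in> borel_measurable borel \<and>
     (\<forall>x y. W x y = W y x \<and> W x y \<in> {0..1})"

lemma borel_graphonD:
  assumes "borel_graphon W"
  shows "(\<lambda>z. W (fst z) (snd z)) \<in> borel_measurable borel" "W x y = W y x" "W x y \<in> {0..1}"
  using assms unfolding borel_graphon_def by blast+

definition AE_eq_graphon :: "(real \<Rightarrow> real \<Rightarrow> real) \<Rightarrow> (real \<Rightarrow> real \<Rightarrow> real) \<Rightarrow> bool" where
  "AE_eq_graphon W W' \<longleftrightarrow> (AE z in I01_sq. W (fst z) (snd z) = W' (fst z) (snd z))"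

text \<open>A Borel function equal to \<open>W\<close> almost everywhere may be asymmetric or leave
  [0,1]. Clamping it and averaging it with its transpose repairs this and changes nothing almost
  everywhere, since \<open>W\<close> has both properties.\<close>

lemma graphon_borel_version:
  assumes "graphon W"
  obtains W0 where "borel_graphon W0" "AE_eq_graphon W W0"
proof -
  let ?S = "{0..1} \<times> {0..1} :: (real \<times> real) set"
  note S = unit_square_borel
  have W: "(\<lambda>z. W (fst z) (snd z)) \<in> borel_measurable (lebesgue_on ?S)"
     "\<And>x y. x \<in> {0..1} \<Longrightarrow> y \<in> {0..1} \<Longrightarrow> W x y = W y x \<and> 0 \<le> W x y \<and> W x y \<le> 1"
    using assms by (auto simp: graphon_def)
  have "?S \<inter> space lebesgue \<in> sets lebesgue" using S by simp
  from borel_measurable_restrict_space_iff[OF this, THEN iffD1, OF W(1)]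
  have "(\<lambda>z. if z \<in> ?S then W (fst z) (snd z) else 0) \<in> borel_measurable lebesgue"
    by (simp add: indicator_def of_bool_def if_distrib[where f = "\<lambda>x. x * _"] cong: if_cong)
  from completion_ex_borel_measurable_real[OF this] obtain g where
    g: "g \<in> borel_measurable lborel" "AE z in lborel. (if z \<in> ?S then W (fst z) (snd z) else 0) = g z"
    by blast
  have gm [measurable]: "g \<in> borel_measurable borel" using g(1) by simp
  define h where "h x y = max 0 (min 1 (g (x, y)))" for x y
  define W0 where "W0 x y = (h x y + h y x) / 2" for x y
  have "borel_graphon W0"
    unfolding borel_graphon_def W0_def h_def
  proof (intro conjI allI)
    have "(\<lambda>z. g (fst z, snd z)) \<in> borel_measurable borel" by simp
    moreover have "(\<lambda>z. g (snd z, fst z)) \<in> borel_measurable borel"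
      by (rule measurable_compose[OF _ gm]) (simp add: borel_prod[symmetric])
    ultimately show "(\<lambda>z. (max 0 (min 1 (g (fst z, snd z))) + max 0 (min 1 (g (snd z, fst z)))) / 2) \<in> borel_measurable borel"
      by measurable
  qed (auto simp: add.commute)
  moreover have "AE_eq_graphon W W0"
  proof -
    have 1: "AE z in I01_sq. W (fst z) (snd z) = g (fst z, snd z)"
      unfolding AE_pair_I01 using g(2) by (rule AE_mp) auto
    have 2: "AE z in I01_sq. W (snd z) (fst z) = g (snd z, fst z)"
      using AE_swap_pair[of "\<lambda>x y. W x y = g (x, y)"] 1 by simp
    show ?thesis unfolding AE_eq_graphon_def
      using 1 2 AE_space
    proof eventually_elim
      case (elim z)
      have "fst z \<in> {0..1}" "snd z \<in> {0..1}" using elim(3) by (auto simp: space_pair_measure space_I01)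
      from W(2)[OF this] show ?case unfolding W0_def h_def elim(1,2)[symmetric] by simp
    qed
  qed
  ultimately show thesis using that by blast
qed

text \<open>Measurability comes from completeness of Lebesgue measure alone. This is how a kernel
  defined by ultrafilter limits is recognized as a graphon.\<close>

lemma graphon_of_AE_eq:
  assumes W0: "borel_graphon W0" and eq: "AE_eq_graphon W W0"
    and W: "\<And>x y. x \<in> {0..1} \<Longrightarrow> y \<in> {0..1} \<Longrightarrow> W x y = W y x \<and> 0 \<le> W x y \<and> W x y \<le> 1"
  shows "graphon W"
proof -
  let ?S = "{0..1} \<times> {0..1} :: (real \<times> real) set"
  note S = unit_square_borel
  have "(\<lambda>z. W0 (fst z) (snd z)) \<in> borel_measurable borel" by (rule borel_graphonD[OF W0])
  then have "(\<lambda>z. if z \<in> ?S then W0 (fst z) (snd z) else 0) \<in> borel_measurable borel"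
    using S by (intro measurable_If_set) auto
  then have 1: "(\<lambda>z. if z \<in> ?S then W0 (fst z) (snd z) else 0) \<in> borel_measurable lebesgue"
    by (simp add: measurable_completion)
  have "AE z in lborel. z \<in> ?S \<longrightarrow> W (fst z) (snd z) = W0 (fst z) (snd z)"
    using eq by (simp add: AE_eq_graphon_def AE_pair_I01)
  then have "AE z in lborel. (if z \<in> ?S then W0 (fst z) (snd z) else 0) = (if z \<in> ?S then W (fst z) (snd z) else 0)"
    by (rule AE_mp) auto
  from borel_measurable_AE[OF 1 AE_completion[OF this]]
  have 2: "(\<lambda>z. indicator ?S z *\<^sub>R W (fst z) (snd z)) \<in> borel_measurable lebesgue"
    by (simp add: indicator_def of_bool_def if_distrib[where f = "\<lambda>x. x * _"] cong: if_cong)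
  have "?S \<inter> space lebesgue \<in> sets lebesgue" using S by simp
  from borel_measurable_restrict_space_iff[OF this, THEN iffD2, OF 2]
  have "(\<lambda>z. W (fst z) (snd z)) \<in> borel_measurable (lebesgue_on ?S)" .
  then show ?thesis using W by (simp add: graphon_def)
qed

section \<open>Densities as integrals over powers of the interval\<close>

lemma emeasure_PiM_I01_space: "finite V \<Longrightarrow> emeasure (I01_pow V) (space (I01_pow V)) = 1"
  by (simp add: space_PiM I01_prod.emeasure_PiM emeasure_I01_space)

lemma finite_measure_PiM_I01: "finite V \<Longrightarrow> finite_measure (I01_pow V)"
  by (rule finite_measureI) (simp add: emeasure_PiM_I01_space)

text \<open>After integrating out the other coordinates, two distinct coordinates are distributed
  like a point of the unit square. With \<open>i = j\<close> only the diagonal would be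
  seen.\<close>

lemma AE_PiM_pair:
  assumes V: "finite V" "i \<in> V" "j \<in> V" "i \<noteq> j" and P: "AE z in I01_sq. P (fst z) (snd z)"
  shows "AE x in I01_pow V. P (x i) (x j)"
proof -
  let ?U = "\<lambda>V. I01_pow V"
  obtain N where N: "N \<in> null_sets I01_sq" "{z \<in> space I01_sq. \<not> P (fst z) (snd z)} \<subseteq> N"
    using P by (auto simp: eventually_ae_filter)
  have [measurable]: "N \<in> sets I01_sq" using N(1) by auto
  define V' where "V' = V - {i, j}"
  have V': "V = insert i (insert j V')" "finite V'" "i \<notin> insert j V'" "j \<notin> V'"
    using V by (auto simp: V'_def)
  have ij[measurable]: "(\<lambda>x. x i) \<in> measurable (?U V) I01" "(\<lambda>x. x j) \<in> measurable (?U V) I01"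
    using V by auto
  have "(\<integral>\<^sup>+x. indicator N (x i, x j) \<partial>?U V) = 0"
  proof -
    have m[measurable]: "(\<lambda>x. indicator N (x i, x j) :: ennreal) \<in> borel_measurable (?U V)" by measurable
    have m2[measurable]: "(\<lambda>y. indicator N y :: ennreal) \<in> borel_measurable I01_sq" by measurable
    have "(\<integral>\<^sup>+x. indicator N (x i, x j) \<partial>?U V) =
       (\<integral>\<^sup>+u. \<integral>\<^sup>+x. indicator N (u, x j) \<partial>?U (insert j V') \<partial>I01)"
      unfolding V'(1) by (subst I01_prod.product_nn_integral_insert_rev) (use V' m[unfolded V'(1)] V in auto)
    also have "\<dots> = (\<integral>\<^sup>+u. \<integral>\<^sup>+v. indicator N (u, v) \<partial>I01 \<partial>I01)"
    proof (rule nn_integral_cong)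
      fix u assume [measurable]: "u \<in> space I01"
      have "(\<integral>\<^sup>+x. indicator N (u, x j) \<partial>?U (insert j V')) = (\<integral>\<^sup>+v. \<integral>\<^sup>+x. indicator N (u, v) \<partial>?U V' \<partial>I01)"
        by (subst I01_prod.product_nn_integral_insert_rev) (use V' in auto)
      also have "\<dots> = (\<integral>\<^sup>+v. indicator N (u, v) \<partial>I01)"
        using V' by (simp add: emeasure_PiM_I01_space)
      finally show "(\<integral>\<^sup>+x. indicator N (u, x j) \<partial>?U (insert j V')) = (\<integral>\<^sup>+v. indicator N (u, v) \<partial>I01)" .
    qed
    also have "\<dots> = emeasure I01_sq N"
      by (simp add: I01.emeasure_pair_measure)
    also have "\<dots> = 0" using N(1) by auto
    finally show ?thesis .
  qed
  then have "AE x in ?U V. indicator N (x i, x j) = (0::ennreal)"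
    by (subst (asm) nn_integral_0_iff_AE) measurable
  then show ?thesis using AE_space
  proof eventually_elim
    case (elim x)
    then have "(x i, x j) \<in> space I01_sq" "(x i, x j) \<notin> N"
      using V by (auto simp: space_PiM space_pair_measure PiE_iff)
    then show ?case using N(2) by auto
  qed
qed

lemma (in complete_measure) measurable_AE_eq:
  assumes "f \<in> measurable M N" "AE x in M. f x = g x" "\<And>x. x \<in> space M \<Longrightarrow> g x \<in> space N"
  shows "g \<in> measurable M N"
proof (rule measurableI)
  fix A assume "A \<in> sets N"
  then have "f -` A \<inter> space M \<in> sets M" using assms(1) by (rule measurable_sets[rotated])
  then show "g -` A \<inter> space M \<in> sets M"
  proof (rule in_sets_AE[rotated])
    show "AE x in M. x \<in> f -` A \<inter> space M \<longleftrightarrow> x \<in> g -` A \<inter> space M"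
      using assms(2) by eventually_elim simp
  qed simp
qed (use assms in auto)

lemma vpairsD: "(i, j) \<in> vpairs F \<Longrightarrow> i \<in> verts F \<and> j \<in> verts F \<and> i \<noteq> j"
  by (auto simp: vpairs_def)

lemma epairsD: "(i, j) \<in> epairs F \<Longrightarrow> i \<in> verts F \<and> j \<in> verts F \<and> i \<noteq> j"
  using epairs_subset vpairsD by blast

text \<open>\<open>g\<close> may fail to be measurable for the product sigma-algebra, but it agrees
  almost everywhere with the measurable \<open>f\<close> and so is measurable for the completion.
  Integrals over \<open>cube V\<close> thereby reduce to integrals over a power of
  \<open>I01\<close>.\<close>

lemma cube_integral_cong:
  fixes f g :: "(nat \<Rightarrow> real) \<Rightarrow> real"
  assumes f: "f \<in> borel_measurable (I01_pow V)" and eq: "AE x in I01_pow V. f x = g x"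
  shows "integral\<^sup>L (cube V) g = integral\<^sup>L (I01_pow V) f"
proof -
  have c: "cube V = completion (I01_pow V)" by (simp add: cube_def I01_def)
  have f': "f \<in> borel_measurable (cube V)" using f by (simp add: c measurable_completion)
  have eq': "AE x in cube V. f x = g x" unfolding c by (rule AE_completion[OF eq])
  have "g \<in> borel_measurable (cube V)"
    unfolding c by (rule completion.measurable_AE_eq[OF f'[unfolded c] eq'[unfolded c]]) simp
  from integral_cong_AE[OF f' this eq']
  have "integral\<^sup>L (cube V) g = integral\<^sup>L (cube V) f" by simp
  also have "\<dots> = integral\<^sup>L (I01_pow V) f" unfolding c using f by (rule integral_completion)
  finally show ?thesis .
qed

lemma borel_graphon_measurable [measurable (raw)]:
  assumes "borel_graphon W" and [measurable]: "f \<in> borel_measurable M" "g \<in> borel_measurable M"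
  shows "(\<lambda>x. W (f x) (g x)) \<in> borel_measurable M"
proof -
  have "(\<lambda>x. (f x, g x)) \<in> measurable M borel" by measurable
  from measurable_compose[OF this, of "\<lambda>z. W (fst z) (snd z)" borel, OF borel_graphonD(1)[OF assms(1)]] show ?thesis
    by simp
qed

lemma PiM_I01_component: "i \<in> V \<Longrightarrow> (\<lambda>x. x i) \<in> borel_measurable (I01_pow V)"
  using measurable_compose[OF measurable_component_singleton[of i V "\<lambda>_. I01"] I01_borel[of "\<lambda>x. x"]] by simp

lemma prod_borel_graphon_measurable:
  assumes W: "borel_graphon W" and E: "E \<subseteq> vpairs F"
  shows "(\<lambda>x. \<Prod>(i, j)\<in>E. W (x i) (x j)) \<in> borel_measurable (I01_pow (verts F))"
    "(\<lambda>x. \<Prod>(i, j)\<in>E. 1 - W (x i) (x j)) \<in> borel_measurable (I01_pow (verts F))"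
proof -
  have "(\<lambda>x. W (x i) (x j)) \<in> borel_measurable (I01_pow (verts F))" if "(i, j) \<in> E" for i j
    using that E vpairsD by (intro borel_graphon_measurable[OF W] PiM_I01_component) blast+
  then show "(\<lambda>x. \<Prod>(i, j)\<in>E. W (x i) (x j)) \<in> borel_measurable (I01_pow (verts F))"
    "(\<lambda>x. \<Prod>(i, j)\<in>E. 1 - W (x i) (x j)) \<in> borel_measurable (I01_pow (verts F))"
    by (auto simp: case_prod_unfold intro!: borel_measurable_prod borel_measurable_diff)
qed

lemma AE_cube_eq:
  assumes "AE_eq_graphon W W0"
  shows "AE x in I01_pow (verts F). \<forall>p\<in>vpairs F. W (x (fst p)) (x (snd p)) = W0 (x (fst p)) (x (snd p))"
proof -
  have "AE x in I01_pow (verts F). \<forall>p\<in>vpairs F. W (x (fst p)) (x (snd p)) = W0 (x (fst p)) (x (snd p))"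
  proof (rule AE_ball_countable[THEN iffD2])
    show "countable (vpairs F)" by (simp add: countable_finite)
    show "\<forall>p\<in>vpairs F. AE x in I01_pow (verts F). W (x (fst p)) (x (snd p)) = W0 (x (fst p)) (x (snd p))"
    proof
      fix p assume "p \<in> vpairs F"
      then have "fst p \<in> verts F" "snd p \<in> verts F" "fst p \<noteq> snd p"
        using vpairsD[of "fst p" "snd p" F] by simp_all
      then show "AE x in I01_pow (verts F). W (x (fst p)) (x (snd p)) = W0 (x (fst p)) (x (snd p))"
        using assms unfolding AE_eq_graphon_def by (intro AE_PiM_pair) simp_all
    qed
  qed
  then show ?thesis .
qed

lemma graphon_density_borel:
  assumes W0: "borel_graphon W0" and eq: "AE_eq_graphon W W0"
  shows "graphon_density F W = (\<integral>x. (\<Prod>(i, j)\<in>epairs F. W0 (x i) (x j)) \<partial>I01_pow (verts F))"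
  unfolding graphon_density_def
proof (rule cube_integral_cong)
  show "AE x in I01_pow (verts F). (\<Prod>(i, j)\<in>epairs F. W0 (x i) (x j)) = (\<Prod>(i, j)\<in>epairs F. W (x i) (x j))"
    using AE_cube_eq[OF eq, of F]
  proof eventually_elim
    case (elim x)
    have *: "W (x i) (x j) = W0 (x i) (x j)" if "(i, j) \<in> vpairs F" for i j
      using elim that by force
    show ?case
      by (rule prod.cong) (use * epairs_subset[of F] in auto)
  qed
qed (rule prod_borel_graphon_measurable[OF W0 epairs_subset])

lemma psi_borel_measurable:
  assumes "borel_graphon W0"
  shows "psi F W0 \<in> borel_measurable (I01_pow (verts F))"
  unfolding psi_def using prod_borel_graphon_measurable[OF assms, of _ F] epairs_subset[of F]
  by (intro borel_measurable_times) auto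

lemma t_ind_borel:
  assumes W0: "borel_graphon W0" and eq: "AE_eq_graphon W W0"
  shows "t_ind F W = (\<integral>x. psi F W0 x \<partial>I01_pow (verts F))"
  unfolding t_ind_def
proof (rule cube_integral_cong)
  show "AE x in I01_pow (verts F). psi F W0 x = psi F W x"
    using AE_cube_eq[OF eq]
  proof eventually_elim
    case (elim x)
    have *: "W (x i) (x j) = W0 (x i) (x j)" if "(i, j) \<in> vpairs F" for i j
      using elim that by force
    have "(\<Prod>(i, j)\<in>epairs F. W0 (x i) (x j)) = (\<Prod>(i, j)\<in>epairs F. W (x i) (x j))"
      by (rule prod.cong) (use * epairs_subset[of F] in auto)
    moreover have "(\<Prod>(i, j)\<in>vpairs F - epairs F. 1 - W0 (x i) (x j)) = (\<Prod>(i, j)\<in>vpairs F - epairs F. 1 - W (x i) (x j))"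
      by (rule prod.cong) (use * in \<open>auto simp: case_prod_unfold\<close>)
    ultimately show ?case by (simp add: psi_def)
  qed
qed (rule psi_borel_measurable[OF W0])

lemma integrable_PiM_I01_bounded:
  fixes f :: "(nat \<Rightarrow> real) \<Rightarrow> real"
  assumes "finite V" "f \<in> borel_measurable (I01_pow V)" "\<And>x. \<bar>f x\<bar> \<le> B"
  shows "integrable (I01_pow V) f"
  by (rule finite_measure.integrable_const_bound[OF finite_measure_PiM_I01, of _ _ B]) (use assms in auto)

text \<open>The same expansion as for graphs. The right-hand side involves \<open>W\<close> only
  through homomorphism densities, so all graphons representing one limit have the same induced
  densities.\<close>

lemma t_ind_eq_sum:
  assumes "graphon W"
  shows "t_ind F W = (\<Sum>D\<in>Pow (vpairs F - epairs F). (-1) ^ card D * graphon_density (add_pairs F D) W)"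
proof -
  obtain W0 where W0: "borel_graphon W0" and eq: "AE_eq_graphon W W0"
    by (rule graphon_borel_version[OF assms])
  let ?S = "Pow (vpairs F - epairs F)" and ?M = "I01_pow (verts F)"
  have b: "W0 x y \<in> {0..1}" for x y by (rule borel_graphonD[OF W0])
  have sub: "D \<subseteq> vpairs F" if "D \<in> ?S" for D using that by auto
  have "psi F W0 x = (\<Sum>D\<in>?S. (-1) ^ card D * (\<Prod>(i, j)\<in>epairs F \<union> D. W0 (x i) (x j)))" for x
    unfolding psi_def
    using prod_times_prod_complement[OF finite_vpairs epairs_subset, where a = "\<lambda>(i, j). W0 (x i) (x j)"]
    by (simp add: case_prod_unfold)
  moreover have "integrable ?M (\<lambda>x. \<Prod>(i, j)\<in>epairs F \<union> D. W0 (x i) (x j))" if "D \<in> ?S" for D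
  proof (rule integrable_PiM_I01_bounded[where B = 1])
    show "(\<lambda>x. \<Prod>(i, j)\<in>epairs F \<union> D. W0 (x i) (x j)) \<in> borel_measurable ?M"
      using that epairs_subset by (intro prod_borel_graphon_measurable W0) auto
    show "\<bar>\<Prod>(i, j)\<in>epairs F \<union> D. W0 (x i) (x j)\<bar> \<le> 1" for x
      using prod_kernel_bounds(1)[of "epairs F \<union> D" W0 x] b by auto
  qed simp
  ultimately have "t_ind F W = (\<Sum>D\<in>?S. (-1) ^ card D * (\<integral>x. (\<Prod>(i, j)\<in>epairs F \<union> D. W0 (x i) (x j)) \<partial>?M))"
    by (simp add: t_ind_borel[OF W0 eq] Bochner_Integration.integral_sum)
  also have "\<dots> = (\<Sum>D\<in>?S. (-1) ^ card D * graphon_density (add_pairs F D) W)"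
    by (rule sum.cong) (auto simp: graphon_density_borel[OF W0 eq] add_pairs sub)
  finally show ?thesis .
qed

section \<open>Class limits and freeness\<close>

lemma ind_density_tendsto:
  assumes W: "represents W \<Gamma>" and G: "densities_converge G (limit_density \<Gamma>)"
  shows "(\<lambda>n. ind_density F (G n)) \<longlonglongrightarrow> t_ind F W"
proof -
  have "t_ind F W = (\<Sum>D\<in>Pow (vpairs F - epairs F). (-1) ^ card D * limit_density \<Gamma> (add_pairs F D))"
    using W by (simp add: represents_def t_ind_eq_sum)
  then show ?thesis
    using G unfolding ind_density_eq_sum densities_converge_def by (simp, intro tendsto_intros) blast
qed

text \<open>From (i) to (ii): the induced density of \<open>F\<close> in \<open>G n\<close> is at
  most |V(F)|^2 / |V(G n)|, and convergence to a graph limit includes that the orders tend to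
  infinity.\<close>

lemma class_limit_imp_graph_free:
  assumes P: "hereditary P" and \<Gamma>: "\<Gamma> \<in> class_limits P" and W: "represents W \<Gamma>" and F: "F \<notin> P"
  shows "graph_free F W"
proof -
  obtain G where G: "\<And>n. G n \<in> P" "densities_converge G (limit_density \<Gamma>)"
    using \<Gamma> by (auto simp: class_limits_def graphs_tendsto_def)
  have "filterlim (\<lambda>n. real (card (verts (G n)))) at_top sequentially"
    using G(2) filterlim_compose[OF filterlim_real_sequentially] by (auto simp: densities_converge_def)
  then have "(\<lambda>n. real (card (verts F) ^ 2) / real (card (verts (G n)))) \<longlonglongrightarrow> 0"
    by (intro tendsto_divide_0[OF tendsto_const] filterlim_at_top_imp_at_infinity)
  then have "(\<lambda>n. ind_density F (G n)) \<longlonglongrightarrow> 0"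
  proof (rule Lim_null_comparison[rotated])
    show "eventually (\<lambda>n. norm (ind_density F (G n)) \<le> real (card (verts F) ^ 2) / real (card (verts (G n)))) sequentially"
      using ind_density_nonneg[of F] ind_density_hereditary[OF P G(1) F] by (simp add: always_eventually)
  qed
  with ind_density_tendsto[OF W G(2)] show ?thesis
    unfolding graph_free_def by (rule LIMSEQ_unique)
qed

text \<open>From (iii) to (i): start from any sequence converging to \<open>\<Gamma>\<close>, which
  exists by the definition of \<open>graph_limit\<close>, and let sampling replace it by one inside
  \<open>P\<close>.\<close>

lemma graph_free_imp_class_limit:
  assumes W: "represents W \<Gamma>" and free: "\<And>F. F \<notin> P \<Longrightarrow> graph_free F W"
  shows "\<Gamma> \<in> class_limits P"
proof -
  obtain G where G: "densities_converge G (limit_density \<Gamma>)"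
    using limit_density[of \<Gamma>] by auto
  have "(\<lambda>n. ind_density F (G n)) \<longlonglongrightarrow> 0" if "F \<notin> P" for F
    using ind_density_tendsto[OF W G, of F] free[OF that] by (simp add: graph_free_def)
  from class_limit_of_ind_density[OF G this]
  show ?thesis by (auto simp: class_limits_def graphs_tendsto_def)
qed

section \<open>Averages over cells\<close>

text \<open>Over a null cell the average is \<open>0 / 0 = 0\<close>.\<close>

definition cell_avg :: "(real \<Rightarrow> 'c) \<Rightarrow> real \<Rightarrow> (real \<Rightarrow> ennreal) \<Rightarrow> ennreal" where
  "cell_avg q x f = (\<integral>\<^sup>+u. of_bool (q u = q x) * f u \<partial>I01) / (\<integral>\<^sup>+u. of_bool (q u = q x) \<partial>I01)"

text \<open>Labels come from an arbitrary type without a sigma-algebra. Integration over cells only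
  asks that lying in a common cell be a measurable relation.\<close>

definition measurable_cells :: "(real \<Rightarrow> 'c) \<Rightarrow> bool" where
  "measurable_cells q \<longleftrightarrow> Measurable.pred I01_sq (\<lambda>z. q (fst z) = q (snd z))"

lemma measurable_cellsD:
  assumes "measurable_cells q" and [measurable]: "f \<in> measurable M I01" "g \<in> measurable M I01"
  shows "Measurable.pred M (\<lambda>x. q (f x) = q (g x))"
proof -
  have "(\<lambda>x. (f x, g x)) \<in> measurable M I01_sq" by measurable
  from measurable_compose[OF this assms(1)[unfolded measurable_cells_def]] show ?thesis by simp
qed

lemma measurable_cells_const:
  assumes "measurable_cells q" "x \<in> space I01"
  shows "Measurable.pred I01 (\<lambda>u. q u = q x)"
  using assms by (intro measurable_cellsD) simp_all

lemma of_bool_ennreal_measurable [measurable (raw)]: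
  assumes [measurable]: "Measurable.pred M P"
  shows "(\<lambda>x. of_bool (P x) :: ennreal) \<in> borel_measurable M"
  unfolding of_bool_def by measurable

lemma cell_mass_le_1: "(\<integral>\<^sup>+u. of_bool (q u = q x) \<partial>I01) \<le> 1"
proof -
  have "(\<integral>\<^sup>+u. of_bool (q u = q x) \<partial>I01) \<le> (\<integral>\<^sup>+u. 1 \<partial>I01)" by (rule nn_integral_mono) simp
  then show ?thesis by (simp add: emeasure_I01_space)
qed

lemma cell_avg_measurable:
  assumes q: "measurable_cells q" and f [measurable]: "(\<lambda>(z, u). f z u) \<in> borel_measurable (M \<Otimes>\<^sub>M I01)"
    and g [measurable]: "g \<in> measurable M I01"
  shows "(\<lambda>z. cell_avg q (g z) (f z)) \<in> borel_measurable M"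
proof -
  have [measurable]: "Measurable.pred (M \<Otimes>\<^sub>M I01) (\<lambda>p. q (snd p) = q (g (fst p)))"
    by (rule measurable_cellsD[OF q]) measurable
  show ?thesis unfolding cell_avg_def by measurable
qed

lemma cell_avg_mono:
  assumes "\<And>u. u \<in> space I01 \<Longrightarrow> q u = q x \<Longrightarrow> f u \<le> g u"
  shows "cell_avg q x f \<le> cell_avg q x g"
  unfolding cell_avg_def
  by (intro divide_right_mono_ennreal nn_integral_mono) (auto simp: of_bool_def assms)

lemma cell_avg_add:
  assumes "measurable_cells q" "x \<in> space I01"
    and [measurable]: "f \<in> borel_measurable I01" "g \<in> borel_measurable I01"
  shows "cell_avg q x (\<lambda>u. f u + g u) = cell_avg q x f + cell_avg q x g"
proof -
  have [measurable]: "Measurable.pred I01 (\<lambda>u. q u = q x)" by (rule measurable_cells_const) fact+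
  show ?thesis
    by (simp add: cell_avg_def distrib_left nn_integral_add add_divide_distrib_ennreal)
qed

lemma cell_avg_cmult:
  assumes "measurable_cells q" "x \<in> space I01" and [measurable]: "f \<in> borel_measurable I01"
  shows "cell_avg q x (\<lambda>u. c * f u) = c * cell_avg q x f"
proof -
  have [measurable]: "Measurable.pred I01 (\<lambda>u. q u = q x)" by (rule measurable_cells_const) fact+
  have "(\<integral>\<^sup>+u. of_bool (q u = q x) * (c * f u) \<partial>I01) = c * (\<integral>\<^sup>+u. of_bool (q u = q x) * f u \<partial>I01)"
    by (subst nn_integral_cmult[symmetric]) (auto simp: ac_simps)
  then show ?thesis by (simp add: cell_avg_def ennreal_times_divide)
qed

text \<open>On a null cell the average is 0 by convention, which is why the general bound is only an
  inequality.\<close>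

lemma cell_avg_const:
  assumes q: "measurable_cells q" and x: "x \<in> space I01"
  shows "cell_avg q x (\<lambda>u. c) \<le> c"
    and "(\<integral>\<^sup>+u. of_bool (q u = q x) \<partial>I01) \<noteq> 0 \<Longrightarrow> cell_avg q x (\<lambda>u. c) = c"
proof -
  have [measurable]: "Measurable.pred I01 (\<lambda>u. q u = q x)" by (rule measurable_cells_const) fact+
  let ?m = "\<integral>\<^sup>+u. of_bool (q u = q x) \<partial>I01"
  have fin: "?m < top" using cell_mass_le_1[of q x] by (simp add: le_less_trans)
  have eq: "cell_avg q x (\<lambda>u. c) = c * (?m / ?m)"
    using cell_avg_cmult[OF q x, of "\<lambda>u. 1" c] by (simp add: cell_avg_def)
  show "cell_avg q x (\<lambda>u. c) = c" if "?m \<noteq> 0"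
    using that fin by (simp add: eq ennreal_divide_self)
  then show "cell_avg q x (\<lambda>u. c) \<le> c"
    by (cases "?m = 0") (simp_all add: eq)
qed

lemma tendsto_0_if_eventually_le:
  fixes f :: "'a \<Rightarrow> ennreal"
  assumes "\<And>e::real. e > 0 \<Longrightarrow> eventually (\<lambda>x. f x \<le> ennreal e) F"
  shows "(f \<longlongrightarrow> 0) F"
proof (rule order_tendstoI)
  fix a :: ennreal assume "0 < a"
  then obtain b where b: "0 < b" "b < a" using dense by blast
  then have "b \<noteq> top" by auto
  define e where "e = enn2real b"
  have e: "e > 0" "ennreal e < a"
    using b \<open>b \<noteq> top\<close> by (simp_all add: e_def enn2real_positive_iff less_top)
  show "eventually (\<lambda>x. f x < a) F"
    using assms[OF e(1)] by eventually_elim (use e(2) in auto)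
qed simp

text \<open>The average of \<open>f\<close> over the cell of \<open>x\<close>, integrated over \<open>x\<close>, weighs each point \<open>u\<close> by the
  mass of the cell of \<open>u\<close> relative to itself, which is at most 1.\<close>

lemma cell_avg_contraction:
  assumes q: "measurable_cells q" and f [measurable]: "f \<in> borel_measurable I01_sq"
  shows "(\<integral>\<^sup>+z. cell_avg q (fst z) (\<lambda>u. f (u, snd z)) \<partial>I01_sq) \<le> (\<integral>\<^sup>+z. f z \<partial>I01_sq)"
proof -
  define m where "m x = (\<integral>\<^sup>+u. of_bool (q u = q x) \<partial>I01)" for x
  have [measurable]: "Measurable.pred I01_sq (\<lambda>p. q (snd p) = q (fst p))"
    by (rule measurable_cellsD[OF q]) measurable
  have m[measurable]: "m \<in> borel_measurable I01" unfolding m_def by measurable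
  have m_cong: "m x = m u" if "q u = q x" for x u using that by (simp add: m_def)
  have [measurable]: "(\<lambda>z. cell_avg q (fst z) (\<lambda>u. f (u, snd z))) \<in> borel_measurable I01_sq"
    by (rule cell_avg_measurable[OF q]) measurable
  have fy[measurable]: "(\<lambda>u. f (u, y)) \<in> borel_measurable I01" if "y \<in> space I01" for y
    using that by measurable
  have "(\<integral>\<^sup>+z. cell_avg q (fst z) (\<lambda>u. f (u, snd z)) \<partial>I01_sq) =
     (\<integral>\<^sup>+y. \<integral>\<^sup>+x. cell_avg q x (\<lambda>u. f (u, y)) \<partial>I01 \<partial>I01)"
    by (subst I01_pair.nn_integral_snd[symmetric]) simp_all
  also have "\<dots> \<le> (\<integral>\<^sup>+y. \<integral>\<^sup>+u. f (u, y) \<partial>I01 \<partial>I01)"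
  proof (rule nn_integral_mono)
    fix y assume y: "y \<in> space I01"
    note [measurable] = fy[OF y]
    have "(\<integral>\<^sup>+x. cell_avg q x (\<lambda>u. f (u, y)) \<partial>I01) =
       (\<integral>\<^sup>+x. \<integral>\<^sup>+u. of_bool (q u = q x) * f (u, y) / m x \<partial>I01 \<partial>I01)"
    proof (rule nn_integral_cong)
      fix x assume x: "x \<in> space I01"
      have [measurable]: "Measurable.pred I01 (\<lambda>u. q u = q x)" by (rule measurable_cells_const[OF q x])
      show "cell_avg q x (\<lambda>u. f (u, y)) = (\<integral>\<^sup>+u. of_bool (q u = q x) * f (u, y) / m x \<partial>I01)"
        by (simp add: cell_avg_def m_def[symmetric] nn_integral_divide)
    qed
    also have "\<dots> = (\<integral>\<^sup>+u. \<integral>\<^sup>+x. of_bool (q u = q x) * f (u, y) / m x \<partial>I01 \<partial>I01)"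
    proof (rule I01_pair.Fubini')
      have [measurable]: "Measurable.pred I01_sq (\<lambda>p. q (fst p) = q (snd p))"
        by (rule measurable_cellsD[OF q]) measurable
      have [measurable]: "(\<lambda>p. f (fst p, y)) \<in> borel_measurable I01_sq"
        by (rule measurable_compose[OF measurable_fst fy[OF y]])
      have [measurable]: "(\<lambda>p. m (snd p)) \<in> borel_measurable I01_sq"
        by (rule measurable_compose[OF measurable_snd m])
      show "(\<lambda>(u, x). of_bool (q u = q x) * f (u, y) / m x) \<in> borel_measurable I01_sq"
        unfolding case_prod_unfold by measurable
    qed
    also have "\<dots> \<le> (\<integral>\<^sup>+u. f (u, y) \<partial>I01)"
    proof (rule nn_integral_mono)
      fix u assume u: "u \<in> space I01"
      have "(\<integral>\<^sup>+x. of_bool (q u = q x) * f (u, y) / m x \<partial>I01) = (\<integral>\<^sup>+x. of_bool (q x = q u) * f (u, y) / m u \<partial>I01)"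
      proof (rule nn_integral_cong)
        fix x
        show "of_bool (q u = q x) * f (u, y) / m x = of_bool (q x = q u) * f (u, y) / m u"
          using m_cong[of u x] by (cases "q u = q x") simp_all
      qed
      also have "\<dots> = cell_avg q u (\<lambda>x. f (u, y))"
      proof -
        have [measurable]: "Measurable.pred I01 (\<lambda>x. q x = q u)" by (rule measurable_cells_const[OF q u])
        show ?thesis by (simp add: cell_avg_def m_def[symmetric] nn_integral_divide)
      qed
      also have "\<dots> \<le> f (u, y)" by (rule cell_avg_const(1)[OF q u])
      finally show "(\<integral>\<^sup>+x. of_bool (q u = q x) * f (u, y) / m x \<partial>I01) \<le> f (u, y)" .
    qed
    finally show "(\<integral>\<^sup>+x. cell_avg q x (\<lambda>u. f (u, y)) \<partial>I01) \<le> (\<integral>\<^sup>+u. f (u, y) \<partial>I01)" .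
  qed
  also have "\<dots> = (\<integral>\<^sup>+z. f z \<partial>I01_sq)"
    by (subst I01_pair.nn_integral_snd) simp_all
  finally show ?thesis .
qed

section \<open>Mean oscillation over fine cells\<close>

lemma borel_graphon_continuous_approx:
  assumes W: "borel_graphon W" and \<epsilon>: "\<epsilon> > 0"
  obtains g :: "real \<times> real \<Rightarrow> real" where "continuous_on UNIV g" "\<And>z. g z \<in> {0..1}"
    "(\<integral>\<^sup>+z. ennreal \<bar>W (fst z) (snd z) - g z\<bar> \<partial>I01_sq) < ennreal \<epsilon>"
proof -
  let ?M = "I01_sq" and ?w = "\<lambda>z. W (fst z) (snd z)"
  have w[measurable]: "?w \<in> borel_measurable borel" by (rule borel_graphonD[OF W])
  have w01: "?w z \<in> {0..1}" for z by (rule borel_graphonD[OF W])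
  have "?w measurable_on UNIV"
    by (rule lebesgue_measurable_imp_measurable_on) (simp_all add: measurable_completion)
  then obtain N g where N: "negligible N" and g: "\<And>n. continuous_on UNIV (g n)"
    and lim: "\<And>z. z \<notin> N \<Longrightarrow> (\<lambda>n. g n z) \<longlonglongrightarrow> ?w z"
    unfolding measurable_on_def if_P[OF UNIV_I] by blast
  \<comment> \<open>Truncation keeps continuity and the limit, and bounds the differences by 1 for
    dominated convergence.\<close>
  define h where "h n z = max 0 (min 1 (g n z))" for n z
  have hc: "continuous_on UNIV (h n)" for n
    unfolding h_def by (intro continuous_intros g)
  have [measurable]: "h n \<in> borel_measurable borel" for n
    using hc by (rule borel_measurable_continuous_onI)
  have h01: "h n z \<in> {0..1}" for n z by (simp add: h_def)
  have hlim: "(\<lambda>n. h n z) \<longlonglongrightarrow> ?w z" if "z \<notin> N" for z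
  proof -
    have "(\<lambda>n. h n z) \<longlonglongrightarrow> max 0 (min 1 (?w z))"
      unfolding h_def by (intro tendsto_intros lim that)
    then show ?thesis using w01[of z] by simp
  qed
  have "AE z in lebesgue. z \<notin> N" using N by (simp add: negligible_iff_null_sets AE_not_in)
  then have "AE z in lborel. z \<notin> N" by (simp add: AE_completion_iff)
  then have aeN: "AE z in ?M. z \<notin> N" unfolding AE_pair_I01 by (rule AE_mp) simp
  have fin: "emeasure ?M (space ?M) < top"
    by (simp add: emeasure_I01_sq_space)
  have "(\<lambda>n. \<integral>\<^sup>+z. ennreal \<bar>?w z - h n z\<bar> \<partial>?M) \<longlonglongrightarrow> (\<integral>\<^sup>+z. 0 \<partial>?M)"
  proof (rule nn_integral_dominated_convergence[where w = "\<lambda>_. 1"])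
    show "AE z in ?M. ennreal \<bar>?w z - h n z\<bar> \<le> 1" for n
    proof (rule AE_I2)
      fix z
      have "\<bar>?w z - h n z\<bar> \<le> 1" using w01[of z] h01[of n z] by auto
      then show "ennreal \<bar>?w z - h n z\<bar> \<le> 1" by simp
    qed
    show "AE z in ?M. (\<lambda>n. ennreal \<bar>?w z - h n z\<bar>) \<longlonglongrightarrow> 0"
      using aeN
    proof eventually_elim
      case (elim z)
      have "(\<lambda>n. \<bar>?w z - h n z\<bar>) \<longlonglongrightarrow> \<bar>?w z - ?w z\<bar>" by (intro tendsto_intros hlim elim)
      then have "(\<lambda>n. ennreal \<bar>?w z - h n z\<bar>) \<longlonglongrightarrow> ennreal 0" by (intro tendsto_ennrealI) simp
      then show ?case by simp
    qed
  qed (use fin in simp_all)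
  then have "eventually (\<lambda>n. (\<integral>\<^sup>+z. ennreal \<bar>?w z - h n z\<bar> \<partial>?M) < ennreal \<epsilon>) sequentially"
    by (rule order_tendstoD) (use \<epsilon> in simp)
  then obtain n where "(\<integral>\<^sup>+z. ennreal \<bar>?w z - h n z\<bar> \<partial>?M) < ennreal \<epsilon>"
    by (auto simp: eventually_sequentially)
  with hc[of n] h01[of n] that show thesis by blast
qed

text \<open>An L1 substitute for the Lebesgue density theorem. Replace \<open>W\<close> by a
  continuous \<open>g\<close> up to \<open>\<epsilon> / 3\<close> in L1. On fine cells
  \<open>g\<close> varies by less than \<open>\<epsilon> / 3\<close>, the error at \<open>z\<close>
  itself integrates to at most \<open>\<epsilon> / 3\<close>, and so does the averaged error, by
  \<open>cell_avg_contraction\<close>.\<close>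

lemma cell_oscillation_tendsto:
  fixes q :: "nat \<Rightarrow> real \<Rightarrow> 'c"
  assumes W: "borel_graphon W" and q: "\<And>n. measurable_cells (q n)"
    and fine: "\<And>n x u. n > 0 \<Longrightarrow> x \<in> space I01 \<Longrightarrow> u \<in> space I01 \<Longrightarrow> q n u = q n x \<Longrightarrow> \<bar>u - x\<bar> \<le> 1 / real n"
  defines "osc n z \<equiv> cell_avg (q n) (fst z) (\<lambda>u. ennreal \<bar>W u (snd z) - W (fst z) (snd z)\<bar>)"
  shows "(\<lambda>n. \<integral>\<^sup>+z. osc n z \<partial>I01_sq) \<longlonglongrightarrow> 0"
proof (rule tendsto_0_if_eventually_le)
  fix \<epsilon> :: real assume \<epsilon>: "\<epsilon> > 0"
  let ?M = "I01_sq"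
  obtain g :: "real \<times> real \<Rightarrow> real" where g: "continuous_on UNIV g" "\<And>z. g z \<in> {0..1}"
    "(\<integral>\<^sup>+z. ennreal \<bar>W (fst z) (snd z) - g z\<bar> \<partial>?M) < ennreal (\<epsilon> / 3)"
    by (rule borel_graphon_continuous_approx[OF W, of "\<epsilon> / 3"]) (use \<epsilon> in auto)
  have gm [measurable]: "g \<in> borel_measurable borel"
    using g(1) by (rule borel_measurable_continuous_onI)
  define D where "D z = ennreal \<bar>W (fst z) (snd z) - g z\<bar>" for z
  have [measurable]: "(\<lambda>z. W (fst z) (snd z)) \<in> borel_measurable borel" by (rule borel_graphonD[OF W])
  have D[measurable]: "D \<in> borel_measurable ?M"
    unfolding D_def by (rule borel_pair_I01) measurable
  have "uniformly_continuous_on ({0..1} \<times> {0..1}) g"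
    by (intro compact_uniformly_continuous continuous_on_subset[OF g(1)] compact_Times) auto
  then obtain d where d: "d > 0"
    "\<And>z z'. z \<in> {0..1} \<times> {0..1} \<Longrightarrow> z' \<in> {0..1} \<times> {0..1} \<Longrightarrow> dist z' z < d \<Longrightarrow> dist (g z') (g z) < \<epsilon> / 3"
    using \<epsilon> unfolding uniformly_continuous_on_def by (metis zero_less_divide_iff zero_less_numeral)
  have "eventually (\<lambda>n. n > 0 \<and> 1 / real n < d) sequentially"
    using eventually_gt_at_top[of "0::nat"] order_tendstoD(2)[OF lim_1_over_n d(1)]
    by eventually_elim simp
  then show "eventually (\<lambda>n. (\<integral>\<^sup>+z. osc n z \<partial>?M) \<le> ennreal \<epsilon>) sequentially"
  proof eventually_elim
    case (elim n)
    have le: "osc n z \<le> cell_avg (q n) (fst z) (\<lambda>u. D (u, snd z)) + (ennreal (\<epsilon> / 3) + D z)"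
      if z: "z \<in> space ?M" for z
    proof -
      obtain x y where xy: "z = (x, y)" "x \<in> {0..1}" "y \<in> {0..1}"
        using z by (auto simp: space_pair_measure space_I01)
      have [measurable]: "(\<lambda>u. D (u, y)) \<in> borel_measurable I01"
        using xy(3) D by (simp add: space_I01)
      have "osc n z \<le> cell_avg (q n) x (\<lambda>u. D (u, y) + (ennreal (\<epsilon> / 3) + D (x, y)))"
        unfolding osc_def xy fst_conv snd_conv
      proof (rule cell_avg_mono)
        fix u assume u: "u \<in> space I01" "q n u = q n x"
        then have "\<bar>u - x\<bar> < d" using fine[of n x u] elim xy by (simp add: space_I01)
        then have "dist (u, y) (x, y) < d" by (simp add: dist_Pair_Pair dist_real_def)
        then have "\<bar>g (u, y) - g (x, y)\<bar> < \<epsilon> / 3"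
          using d(2)[of "(x, y)" "(u, y)"] u xy by (simp add: dist_real_def space_I01)
        then have "\<bar>W u y - W x y\<bar> \<le> \<bar>W u y - g (u, y)\<bar> + (\<epsilon> / 3 + \<bar>W x y - g (x, y)\<bar>)" by linarith
        then show "ennreal \<bar>W u y - W x y\<bar> \<le> D (u, y) + (ennreal (\<epsilon> / 3) + D (x, y))"
          using \<epsilon> by (simp add: D_def flip: ennreal_plus)
      qed
      also have "\<dots> = cell_avg (q n) x (\<lambda>u. D (u, y)) + cell_avg (q n) x (\<lambda>u. ennreal (\<epsilon> / 3) + D (x, y))"
        using xy by (intro cell_avg_add q) (simp_all add: space_I01)
      also have "\<dots> \<le> cell_avg (q n) x (\<lambda>u. D (u, y)) + (ennreal (\<epsilon> / 3) + D (x, y))"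
        using xy by (intro add_left_mono cell_avg_const(1) q) (simp add: space_I01)
      finally show ?thesis by (simp add: xy)
    qed
    have [measurable]: "(\<lambda>z. cell_avg (q n) (fst z) (\<lambda>u. D (u, snd z))) \<in> borel_measurable ?M"
      by (rule cell_avg_measurable[OF q]) measurable
    have "(\<integral>\<^sup>+z. osc n z \<partial>?M) \<le> (\<integral>\<^sup>+z. cell_avg (q n) (fst z) (\<lambda>u. D (u, snd z)) + (ennreal (\<epsilon> / 3) + D z) \<partial>?M)"
      by (rule nn_integral_mono) (rule le)
    also have "\<dots> = (\<integral>\<^sup>+z. cell_avg (q n) (fst z) (\<lambda>u. D (u, snd z)) \<partial>?M) + (ennreal (\<epsilon> / 3) + (\<integral>\<^sup>+z. D z \<partial>?M))"
      by (simp add: nn_integral_add emeasure_I01_sq_space)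
    also have "\<dots> \<le> ennreal (\<epsilon> / 3) + (ennreal (\<epsilon> / 3) + ennreal (\<epsilon> / 3))"
      using g(3) cell_avg_contraction[OF q D, of n] by (intro add_mono) (auto simp: D_def)
    also have "\<dots> = ennreal \<epsilon>" using \<epsilon> by (simp flip: ennreal_plus)
    finally show ?case .
  qed
qed

text \<open>Cells of different levels may overlap without being nested, so martingale convergence is
  not at hand; a subsequence turns the L1 convergence into convergence almost everywhere.\<close>

lemma cell_oscillation_AE_subseq:
  fixes q :: "nat \<Rightarrow> real \<Rightarrow> 'c"
  assumes W: "borel_graphon W" and q: "\<And>n. measurable_cells (q n)"
    and fine: "\<And>n x u. n > 0 \<Longrightarrow> x \<in> space I01 \<Longrightarrow> u \<in> space I01 \<Longrightarrow> q n u = q n x \<Longrightarrow> \<bar>u - x\<bar> \<le> 1 / real n"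
  obtains r :: "nat \<Rightarrow> nat" where
    "AE z in I01_sq. (\<lambda>n. cell_avg (q (r n)) (fst z) (\<lambda>u. ennreal \<bar>W u (snd z) - W (fst z) (snd z)\<bar>)) \<longlonglongrightarrow> 0"
proof -
  let ?M = "I01_sq"
  define osc where "osc n z = cell_avg (q n) (fst z) (\<lambda>u. ennreal \<bar>W u (snd z) - W (fst z) (snd z)\<bar>)" for n z
  have lim: "(\<lambda>n. \<integral>\<^sup>+z. osc n z \<partial>?M) \<longlonglongrightarrow> 0"
    unfolding osc_def by (rule cell_oscillation_tendsto[OF W q fine])
  have osc1: "osc n z \<le> 1" if "z \<in> space ?M" for n z
  proof -
    have "osc n z \<le> cell_avg (q n) (fst z) (\<lambda>u. 1)"
      unfolding osc_def
    proof (rule cell_avg_mono)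
      fix u
      have "\<bar>W u (snd z) - W (fst z) (snd z)\<bar> \<le> 1"
        using borel_graphonD(3)[OF W, of u "snd z"] borel_graphonD(3)[OF W, of "fst z" "snd z"] by auto
      then show "ennreal \<bar>W u (snd z) - W (fst z) (snd z)\<bar> \<le> 1" by simp
    qed
    also have "\<dots> \<le> 1" using that by (intro cell_avg_const(1) q) (auto simp: space_pair_measure)
    finally show ?thesis .
  qed
  have [measurable]: "osc n \<in> borel_measurable ?M" for n
    unfolding osc_def
  proof (rule cell_avg_measurable[OF q])
    note b = measurable_compose[OF _ I01_id]
    show "(\<lambda>(z, u). ennreal \<bar>W u (snd z) - W (fst z) (snd z)\<bar>) \<in> borel_measurable (?M \<Otimes>\<^sub>M I01)"
      unfolding case_prod_unfold
      by (intro measurable_compose[OF _ measurable_ennreal] borel_measurable_abs borel_measurable_diff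
          borel_graphon_measurable[OF W] b; measurable)
  qed measurable
  define u where "u n z = enn2real (osc n z)" for n z
  have u_int: "integrable ?M (u n)" for n
  proof (rule I01_sq.integrable_const_bound[where B = 1])
    show "AE z in ?M. norm (u n z) \<le> 1"
    proof (rule AE_I2)
      fix z assume "z \<in> space ?M"
      from enn2real_mono[OF osc1[OF this, of n]] show "norm (u n z) \<le> 1" by (simp add: u_def)
    qed
    show "u n \<in> borel_measurable ?M" unfolding u_def by measurable
  qed
  have u_osc: "ennreal (u n z) = osc n z" if "z \<in> space ?M" for n z
  proof -
    have "osc n z < top" using osc1[OF that, of n] by (rule le_less_trans) simp
    then show ?thesis by (simp add: u_def)
  qed
  have "(\<integral>z. norm (u n z) \<partial>?M) = enn2real (\<integral>\<^sup>+z. osc n z \<partial>?M)" for n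
  proof -
    have "(\<integral>z. norm (u n z) \<partial>?M) = enn2real (\<integral>\<^sup>+z. ennreal (norm (u n z)) \<partial>?M)"
      using u_int[of n] by (intro integral_eq_nn_integral) auto
    also have "(\<integral>\<^sup>+z. ennreal (norm (u n z)) \<partial>?M) = (\<integral>\<^sup>+z. osc n z \<partial>?M)"
    proof (rule nn_integral_cong)
      fix z assume "z \<in> space ?M"
      moreover have "norm (u n z) = u n z" by (simp add: u_def)
      ultimately show "ennreal (norm (u n z)) = osc n z" using u_osc by simp
    qed
    finally show ?thesis .
  qed
  moreover have "(\<lambda>n. enn2real (\<integral>\<^sup>+z. osc n z \<partial>?M)) \<longlonglongrightarrow> 0"
    by (rule tendsto_enn2real) (use lim in simp_all)
  ultimately have "(\<lambda>n. \<integral>z. norm (u n z) \<partial>?M) \<longlonglongrightarrow> 0" by simp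
  from tendsto_L1_AE_subseq[OF u_int this] obtain r :: "nat \<Rightarrow> nat" where
    r: "AE z in ?M. (\<lambda>n. u (r n) z) \<longlonglongrightarrow> 0" by blast
  have "AE z in ?M. (\<lambda>n. osc (r n) z) \<longlonglongrightarrow> 0"
    using r AE_space
  proof eventually_elim
    case (elim z)
    from tendsto_ennrealI[OF elim(1)] show ?case using elim(2) by (simp add: u_osc)
  qed
  then show thesis using that unfolding osc_def by blast
qed

section \<open>Ultrafilters attached to points\<close>

lemma ennreal_tendsto_0_le:
  fixes f g :: "'a \<Rightarrow> ennreal"
  assumes "\<And>n. f n \<le> g n" "(g \<longlongrightarrow> 0) F"
  shows "(f \<longlongrightarrow> 0) F"
  by (rule tendsto_sandwich[where f = "\<lambda>_. 0" and h = g]) (use assms in simp_all)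

text \<open>The filter dual to the ideal of sets whose share of the cells around \<open>x\<close>
  tends to 0; the cover \<open>N\<close> admits nonmeasurable predicates. It is improper if the
  cells of \<open>x\<close> are null.\<close>

definition density_filter :: "(nat \<Rightarrow> real \<Rightarrow> 'c) \<Rightarrow> real \<Rightarrow> real filter" where
  "density_filter q x = Abs_filter (\<lambda>P. \<exists>N\<in>sets I01. {u \<in> space I01. \<not> P u} \<subseteq> N \<and>
     (\<lambda>n. cell_avg (q n) x (indicator N)) \<longlonglongrightarrow> 0)"

lemma eventually_density_filter:
  assumes q: "\<And>n. measurable_cells (q n)" and x: "x \<in> space I01"
  shows "eventually P (density_filter q x) \<longleftrightarrow>
    (\<exists>N\<in>sets I01. {u \<in> space I01. \<not> P u} \<subseteq> N \<and> (\<lambda>n. cell_avg (q n) x (indicator N)) \<longlonglongrightarrow> 0)"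
  unfolding density_filter_def
proof (rule eventually_Abs_filter, rule is_filter.intro)
  show "\<exists>N\<in>sets I01. {u \<in> space I01. \<not> True} \<subseteq> N \<and> (\<lambda>n. cell_avg (q n) x (indicator N)) \<longlonglongrightarrow> 0"
    by (rule bexI[of _ "{}"]) (simp_all add: cell_avg_def)
next
  fix P Q
  assume "\<exists>N\<in>sets I01. {u \<in> space I01. \<not> P u} \<subseteq> N \<and> (\<lambda>n. cell_avg (q n) x (indicator N)) \<longlonglongrightarrow> 0"
    and "\<exists>N\<in>sets I01. {u \<in> space I01. \<not> Q u} \<subseteq> N \<and> (\<lambda>n. cell_avg (q n) x (indicator N)) \<longlonglongrightarrow> 0"
  then obtain N N' where [measurable]: "N \<in> sets I01" "N' \<in> sets I01"
    and N: "{u \<in> space I01. \<not> P u} \<subseteq> N" "(\<lambda>n. cell_avg (q n) x (indicator N)) \<longlonglongrightarrow> 0"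
      "{u \<in> space I01. \<not> Q u} \<subseteq> N'" "(\<lambda>n. cell_avg (q n) x (indicator N')) \<longlonglongrightarrow> 0"
    by blast
  have "cell_avg (q n) x (indicator (N \<union> N')) \<le> cell_avg (q n) x (indicator N) + cell_avg (q n) x (indicator N')" for n
  proof -
    have "cell_avg (q n) x (indicator (N \<union> N')) \<le> cell_avg (q n) x (\<lambda>u. indicator N u + indicator N' u)"
      by (rule cell_avg_mono) (auto simp: indicator_def)
    also have "\<dots> = cell_avg (q n) x (indicator N) + cell_avg (q n) x (indicator N')"
      by (rule cell_avg_add[OF q x]) measurable
    finally show ?thesis .
  qed
  moreover have "(\<lambda>n. cell_avg (q n) x (indicator N) + cell_avg (q n) x (indicator N')) \<longlonglongrightarrow> 0"
    using tendsto_add[OF N(2,4)] by simp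
  ultimately have "(\<lambda>n. cell_avg (q n) x (indicator (N \<union> N'))) \<longlonglongrightarrow> 0"
    by (rule ennreal_tendsto_0_le)
  then show "\<exists>N\<in>sets I01. {u \<in> space I01. \<not> (P u \<and> Q u)} \<subseteq> N \<and> (\<lambda>n. cell_avg (q n) x (indicator N)) \<longlonglongrightarrow> 0"
    using N by (intro bexI[of _ "N \<union> N'"] conjI) auto
next
  fix P Q assume PQ: "\<forall>x. P x \<longrightarrow> Q x"
    and "\<exists>N\<in>sets I01. {u \<in> space I01. \<not> P u} \<subseteq> N \<and> (\<lambda>n. cell_avg (q n) x (indicator N)) \<longlonglongrightarrow> 0"
  then show "\<exists>N\<in>sets I01. {u \<in> space I01. \<not> Q u} \<subseteq> N \<and> (\<lambda>n. cell_avg (q n) x (indicator N)) \<longlonglongrightarrow> 0"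
    by blast
qed

text \<open>The cells must be Borel, so each part of the partition is exchanged for a Borel subset
  that misses only a null set of it.\<close>

lemma Borel_core:
  assumes "A \<in> sets lebesgue" "A \<subseteq> {0..1}"
  obtains B where "B \<in> sets borel" "B \<subseteq> A" "AE x in I01. x \<in> A \<longrightarrow> x \<in> B"
proof -
  obtain S N N' where "A = S \<union> N" "N \<subseteq> N'" "N' \<in> null_sets lborel" "S \<in> sets lborel"
    using assms(1) by (auto elim: sets_completionE)
  then have "S \<in> sets borel" "S \<subseteq> A" "AE x in I01. x \<in> A \<longrightarrow> x \<in> S"
    unfolding AE_I01 using AE_not_in[of N' lborel] by auto
  then show thesis using that by blast
qed

lemma exists_point_ultrafilters:
  fixes A :: "nat \<Rightarrow> real set"
  assumes W: "borel_graphon W"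
    and cover: "(\<Union>k\<in>{1..r}. A k) = {0..1}" and disj: "disjoint_family_on A {1..r}"
    and A_meas: "\<forall>k\<in>{1..r}. A k \<in> sets lebesgue \<and> measure lebesgue (A k) > 0"
  shows "\<exists>U. (\<forall>x\<in>{0..1}. ultrafilter (U x) \<and> U x \<le> ae_filter I01) \<and>
    (\<forall>k\<in>{1..r}. \<forall>x\<in>A k. eventually (\<lambda>u. u \<in> A k) (U x)) \<and>
    (AE z in I01_sq. ((\<lambda>u. W u (snd z)) \<longlongrightarrow> W (fst z) (snd z)) (U (fst z)))"
proof -
  note A = A_meas[rule_format]
  have sub: "A k \<subseteq> {0..1}" if "k \<in> {1..r}" for k using cover that by blast
  have "\<exists>B. B \<in> sets borel \<and> B \<subseteq> A k \<and> (AE x in I01. x \<in> A k \<longrightarrow> x \<in> B)" if "k \<in> {1..r}" for k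
    by (rule Borel_core[OF conjunct1[OF A[OF that]] sub[OF that]]) blast
  then have "\<forall>k\<in>{1..r}. \<exists>B. B \<in> sets borel \<and> B \<subseteq> A k \<and> (AE x in I01. x \<in> A k \<longrightarrow> x \<in> B)" ..
  from bchoice[OF this] obtain B where
    B0: "\<forall>k\<in>{1..r}. B k \<in> sets borel \<and> B k \<subseteq> A k \<and> (AE x in I01. x \<in> A k \<longrightarrow> x \<in> B k)" ..
  have B: "B k \<in> sets borel" "B k \<subseteq> A k" "AE x in I01. x \<in> A k \<longrightarrow> x \<in> B k" if "k \<in> {1..r}" for k
    using bspec[OF B0 that] by simp_all
  \<comment> \<open>The first component makes cells of diameter at most \<open>1 / n\<close>; the
    second makes them respect the Borel cores of the parts.\<close>
  define q where "q n x = (\<lfloor>real n * x\<rfloor>, {k \<in> {1..r}. x \<in> B k})" for n x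
  have q: "measurable_cells (q n)" for n
  proof -
    have 1: "Measurable.pred I01_sq (\<lambda>z. \<lfloor>real n * fst z\<rfloor> = \<lfloor>real n * snd z\<rfloor>)"
    proof -
      have [measurable]: "(\<lambda>z. \<lfloor>real n * fst z\<rfloor>) \<in> measurable I01_sq (count_space UNIV)"
        "(\<lambda>z. \<lfloor>real n * snd z\<rfloor>) \<in> measurable I01_sq (count_space UNIV)"
        by (rule measurable_compose[OF _ measurable_real_floor],
            intro borel_measurable_times borel_measurable_const I01_fst_snd)+
      show ?thesis by measurable
    qed
    have 2: "Measurable.pred I01_sq (\<lambda>z. fst z \<in> B k \<longleftrightarrow> snd z \<in> B k)" if "k \<in> {1..r}" for k
    proof -
      note [measurable] = B(1)[OF that] I01_fst_snd
      show ?thesis by measurable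
    qed
    have "Measurable.pred I01_sq (\<lambda>z. \<forall>k\<in>{1..r}. fst z \<in> B k \<longleftrightarrow> snd z \<in> B k)"
      by (intro pred_intros_finite) (use 2 in auto)
    with 1 have "Measurable.pred I01_sq (\<lambda>z. \<lfloor>real n * fst z\<rfloor> = \<lfloor>real n * snd z\<rfloor> \<and>
        (\<forall>k\<in>{1..r}. fst z \<in> B k \<longleftrightarrow> snd z \<in> B k))"
      by measurable
    moreover have "q n x = q n u \<longleftrightarrow> \<lfloor>real n * x\<rfloor> = \<lfloor>real n * u\<rfloor> \<and> (\<forall>k\<in>{1..r}. x \<in> B k \<longleftrightarrow> u \<in> B k)" for x u
      unfolding q_def prod.inject by blast
    ultimately show ?thesis by (simp only: measurable_cells_def)
  qed
  have fine: "\<bar>u - x\<bar> \<le> 1 / real n" if "n > 0" "q n u = q n x" for n x u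
  proof -
    have "\<lfloor>real n * u\<rfloor> = \<lfloor>real n * x\<rfloor>" using that(2) by (simp add: q_def)
    then have "\<bar>real n * u - real n * x\<bar> < 1" by linarith
    moreover have "real n * u - real n * x = real n * (u - x)" by (rule right_diff_distrib[symmetric])
    ultimately have "\<bar>u - x\<bar> * real n < 1" by (simp only: abs_mult abs_of_nat mult.commute)
    then have "\<bar>u - x\<bar> < 1 / real n" using that(1) by (simp only: pos_less_divide_eq of_nat_0_less_iff)
    then show ?thesis by simp
  qed
  obtain s :: "nat \<Rightarrow> nat" where s:
    "AE z in I01_sq. (\<lambda>n. cell_avg (q (s n)) (fst z) (\<lambda>u. ennreal \<bar>W u (snd z) - W (fst z) (snd z)\<bar>)) \<longlonglongrightarrow> 0"
    by (rule cell_oscillation_AE_subseq[OF W q fine])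
  define Q where "Q n = q (s n)" for n
  have Q: "measurable_cells (Q n)" for n by (simp add: Q_def q)
  \<comment> \<open>At the other points, a null set, the density filter may be improper or ignore
    the partition.\<close>
  define good where "good x \<longleftrightarrow> x \<in> (\<Union>k\<in>{1..r}. B k) \<and> (\<forall>n. (\<integral>\<^sup>+u. of_bool (Q n u = Q n x) \<partial>I01) \<noteq> 0)" for x
  have "AE x in I01. good x"
  proof -
    have "AE x in I01. \<forall>k\<in>{1..r}. x \<in> A k \<longrightarrow> x \<in> B k"
      by (rule AE_ball_countable[THEN iffD2]) (use B(3) in auto)
    then have 1: "AE x in I01. x \<in> (\<Union>k\<in>{1..r}. B k)"
      using AE_space
    proof eventually_elim
      case (elim x)
      then have "x \<in> (\<Union>k\<in>{1..r}. A k)" unfolding cover by (simp add: space_I01)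
      then show ?case using elim(1) by blast
    qed
    have "AE x in I01. \<forall>n. (\<integral>\<^sup>+u. of_bool (Q n u = Q n x) \<partial>I01) \<noteq> 0"
      unfolding AE_all_countable
    proof
      fix n
      \<comment> \<open>Only countably many labels exist, so the null cells together form a null
        set.\<close>
      let ?C = "UNIV \<times> Pow {1..r} :: (int \<times> nat set) set"
      have cnt: "countable ?C" by (rule countable_SIGMA[OF countableI_type]) (rule countable_finite, simp)
      have "AE x in I01. \<forall>c\<in>?C. Q n x = c \<longrightarrow> (\<integral>\<^sup>+u. of_bool (Q n u = c) \<partial>I01) \<noteq> 0"
      proof (rule AE_ball_countable[THEN iffD2, OF cnt], rule ballI)
        fix c
        show "AE x in I01. Q n x = c \<longrightarrow> (\<integral>\<^sup>+u. of_bool (Q n u = c) \<partial>I01) \<noteq> 0"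
        proof (cases "\<exists>x0\<in>space I01. Q n x0 = c")
          case True
          then obtain x0 where x0: "x0 \<in> space I01" "Q n x0 = c" by blast
          have [measurable]: "Measurable.pred I01 (\<lambda>u. Q n u = c)"
            using measurable_cells_const[OF Q x0(1), of n] x0(2) by simp
          show ?thesis
          proof (cases "(\<integral>\<^sup>+u. of_bool (Q n u = c) \<partial>I01) = 0")
            case True
            then have "AE u in I01. of_bool (Q n u = c) = (0::ennreal)"
              by (subst (asm) nn_integral_0_iff_AE) measurable
            then show ?thesis by eventually_elim auto
          qed simp
        next
          case False
          then show ?thesis by (auto intro!: AE_I2)
        qed
      qed
      then show "AE x in I01. (\<integral>\<^sup>+u. of_bool (Q n u = Q n x) \<partial>I01) \<noteq> 0"
      proof eventually_elim
        case (elim x)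
        have "Q n x \<in> ?C" by (auto simp: Q_def q_def)
        from bspec[OF elim this] show ?case by simp
      qed
    qed
    with 1 show ?thesis unfolding good_def by eventually_elim blast
  qed
  \<comment> \<open>At a bad point it is enough to refine the almost-everywhere filter and to
    concentrate on the part containing the point. This is proper because the part has positive
    measure.\<close>
  define F where "F x = (if good x then density_filter Q x else
      inf (ae_filter I01) (principal {u. \<forall>k\<in>{1..r}. x \<in> A k \<longrightarrow> u \<in> A k}))" for x
  have F_ae: "eventually P (F x)" if x: "x \<in> {0..1}" and P: "AE u in I01. P u" for x P
  proof (cases "good x")
    case True
    obtain N where N: "N \<in> null_sets I01" "{u \<in> space I01. \<not> P u} \<subseteq> N"
      using P by (auto simp: eventually_ae_filter)
    have "cell_avg (Q n) x (indicator N) = 0" for n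
    proof -
      have "(\<integral>\<^sup>+u. of_bool (Q n u = Q n x) * indicator N u \<partial>I01) = (\<integral>\<^sup>+u. 0 \<partial>I01)"
      proof (rule nn_integral_cong_AE)
        show "AE u in I01. of_bool (Q n u = Q n x) * indicator N u = (0::ennreal)"
          using AE_not_in[OF N(1)] by eventually_elim simp
      qed
      then show ?thesis by (simp add: cell_avg_def)
    qed
    then have "eventually P (density_filter Q x)"
      using N x by (subst eventually_density_filter[OF Q]) (auto simp: space_I01 intro!: bexI[of _ N])
    then show ?thesis using True by (simp add: F_def)
  next
    case False
    have "eventually P (inf (ae_filter I01) (principal {u. \<forall>k\<in>{1..r}. x \<in> A k \<longrightarrow> u \<in> A k}))"
      unfolding eventually_inf_principal using P by eventually_elim simp
    then show ?thesis using False by (simp add: F_def)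
  qed
  have F_A: "eventually (\<lambda>u. u \<in> A k) (F x)" if k: "k \<in> {1..r}" and x: "x \<in> A k" for x k
  proof (cases "good x")
    case True
    have x01: "x \<in> space I01" using sub[OF k] x by (auto simp: space_I01)
    from True obtain l where l: "l \<in> {1..r}" "x \<in> B l" by (auto simp: good_def)
    have "l = k"
    proof (rule ccontr)
      assume "l \<noteq> k"
      then have "A l \<inter> A k = {}" using disjoint_family_onD[OF disj l(1) k] by simp
      then show False using B(2)[OF l(1)] l(2) x by blast
    qed
    with l have xB: "x \<in> B k" by simp
    have BS: "B k \<in> sets I01" using B(1,2)[OF k] sub[OF k] by (intro sets_I01_sub) auto
    have "cell_avg (Q n) x (indicator (space I01 - B k)) = 0" for n
    proof -
      have "u \<in> B k" if "Q n u = Q n x" for u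
        using that xB k by (auto simp: Q_def q_def)
      then have "(\<integral>\<^sup>+u. of_bool (Q n u = Q n x) * indicator (space I01 - B k) u \<partial>I01) = (\<integral>\<^sup>+u. 0 \<partial>I01)"
        by (intro nn_integral_cong) (auto simp: indicator_def)
      then show ?thesis by (simp add: cell_avg_def)
    qed
    then have "eventually (\<lambda>u. u \<in> A k) (density_filter Q x)"
      using B(2)[OF k] BS
      by (subst eventually_density_filter[OF Q x01]) (auto intro!: bexI[of _ "space I01 - B k"])
    then show ?thesis using True by (simp add: F_def)
  next
    case False
    then show ?thesis using k x by (simp add: F_def eventually_inf_principal)
  qed
  have F_bot: "F x \<noteq> bot" if x: "x \<in> {0..1}" for x
  proof
    assume "F x = bot"
    then have ev: "eventually (\<lambda>u. False) (F x)" by simp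
    show False
    proof (cases "good x")
      case True
      have x01: "x \<in> space I01" using x by (simp add: space_I01)
      from ev True have "eventually (\<lambda>u. False) (density_filter Q x)" by (simp add: F_def)
      then obtain N where N: "N \<in> sets I01" "space I01 \<subseteq> N" "(\<lambda>n. cell_avg (Q n) x (indicator N)) \<longlonglongrightarrow> 0"
        by (auto simp: eventually_density_filter[OF Q x01])
      have "1 \<le> cell_avg (Q n) x (indicator N)" for n
      proof -
        have "1 = cell_avg (Q n) x (\<lambda>u. 1)"
          using True by (intro cell_avg_const(2)[symmetric] Q x01) (simp add: good_def)
        also have "\<dots> \<le> cell_avg (Q n) x (indicator N)"
          by (rule cell_avg_mono) (use N(2) in auto)
        finally show ?thesis .
      qed
      with N(3) have "(1::ennreal) \<le> 0" by (intro LIMSEQ_le_const) auto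
      then show False by simp
    next
      case False
      obtain k where k: "k \<in> {1..r}" "x \<in> A k" using cover x by blast
      from ev False have "AE u in I01. \<not> (\<forall>k\<in>{1..r}. x \<in> A k \<longrightarrow> u \<in> A k)"
        by (simp add: F_def eventually_inf_principal)
      then have "AE u in I01. u \<notin> A k"
      proof eventually_elim
        case (elim u)
        then obtain l where "l \<in> {1..r}" "x \<in> A l" "u \<notin> A l" by blast
        moreover have "l = k"
          using disjoint_family_onD[OF disj \<open>l \<in> {1..r}\<close> k(1)] k(2) \<open>x \<in> A l\<close> by blast
        ultimately show ?case by simp
      qed
      then have "AE u in lborel. u \<notin> A k"
        unfolding AE_I01
      proof eventually_elim
        case (elim u)
        then show ?case using sub[OF k(1)] by blast
      qed
      then have "AE u in lebesgue. u \<notin> A k" by (rule AE_completion)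
      then have "A k \<in> null_sets lebesgue"
        using A[OF k(1)] by (subst (asm) AE_iff_null_sets[symmetric]) auto
      then have "measure lebesgue (A k) = 0" by (simp add: measure_eq_0_null_sets)
      then show False using A[OF k(1)] by simp
    qed
  qed
  have F_lim: "AE z in I01_sq. ((\<lambda>u. W u (snd z)) \<longlongrightarrow> W (fst z) (snd z)) (F (fst z))"
    using s AE_snd_pair(2)[OF \<open>AE x in I01. good x\<close>] AE_space
  proof eventually_elim
    case (elim z)
    obtain x y where z: "z = (x, y)" by (cases z)
    have x: "x \<in> space I01" and gx: "good x" using elim z by (auto simp: space_pair_measure)
    have osc: "(\<lambda>n. cell_avg (Q n) x (\<lambda>u. ennreal \<bar>W u y - W x y\<bar>)) \<longlonglongrightarrow> 0"
      using elim(1) by (simp add: z Q_def)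
    have [measurable]: "(\<lambda>u. W u y) \<in> borel_measurable I01"
      by (intro borel_graphon_measurable[OF W] I01_id borel_measurable_const)
    show ?case unfolding z fst_conv snd_conv
    proof (rule tendstoI)
      fix e :: real assume e: "e > 0"
      \<comment> \<open>Markov's inequality: the share of \<open>N\<close> in a cell is at most
        \<open>1 / e\<close> times the oscillation, which tends to 0.\<close>
      define N where "N = {u \<in> space I01. e \<le> \<bar>W u y - W x y\<bar>}"
      have N: "N \<in> sets I01" unfolding N_def by measurable
      have "cell_avg (Q n) x (indicator N) \<le> ennreal (1 / e) * cell_avg (Q n) x (\<lambda>u. ennreal \<bar>W u y - W x y\<bar>)" for n
      proof -
        have "cell_avg (Q n) x (indicator N) \<le> cell_avg (Q n) x (\<lambda>u. ennreal (1 / e) * ennreal \<bar>W u y - W x y\<bar>)"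
        proof (rule cell_avg_mono)
          fix u assume "u \<in> space I01"
          show "indicator N u \<le> ennreal (1 / e) * ennreal \<bar>W u y - W x y\<bar>"
          proof (cases "u \<in> N")
            case True
            then have "1 \<le> 1 / e * \<bar>W u y - W x y\<bar>" using e by (simp add: N_def field_simps)
            then have "ennreal 1 \<le> ennreal (1 / e * \<bar>W u y - W x y\<bar>)" by (rule ennreal_leI)
            then show ?thesis using True e by (simp add: ennreal_mult[symmetric])
          qed simp
        qed
        also have "\<dots> = ennreal (1 / e) * cell_avg (Q n) x (\<lambda>u. ennreal \<bar>W u y - W x y\<bar>)"
          by (rule cell_avg_cmult[OF Q x]) measurable
        finally show ?thesis .
      qed
      note le = this
      have "(\<lambda>n. ennreal (1 / e) * cell_avg (Q n) x (\<lambda>u. ennreal \<bar>W u y - W x y\<bar>)) \<longlonglongrightarrow> ennreal (1 / e) * 0"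
        by (rule ennreal_tendsto_cmult[OF _ osc]) simp
      then have "(\<lambda>n. ennreal (1 / e) * cell_avg (Q n) x (\<lambda>u. ennreal \<bar>W u y - W x y\<bar>)) \<longlonglongrightarrow> 0"
        by (simp only: mult_zero_right)
      with le have "(\<lambda>n. cell_avg (Q n) x (indicator N)) \<longlonglongrightarrow> 0"
        by (rule ennreal_tendsto_0_le)
      then have "eventually (\<lambda>u. dist (W u y) (W x y) < e) (density_filter Q x)"
        using N by (subst eventually_density_filter[OF Q x])
          (auto simp: N_def dist_real_def intro!: bexI[of _ N])
      then show "eventually (\<lambda>u. dist (W u y) (W x y) < e) (F x)" using gx by (simp add: F_def)
    qed
  qed
  have "\<forall>x\<in>{0..1}. \<exists>U\<le>F x. ultrafilter U"
    using ultrafilter_below[OF F_bot] ..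
  from bchoice[OF this[unfolded Bex_def]] obtain U where "\<forall>x\<in>{0..1}. U x \<le> F x \<and> ultrafilter (U x)" ..
  then have U: "U x \<le> F x" "ultrafilter (U x)" if "x \<in> {0..1}" for x
    using that by simp_all
  have F_le: "F x \<le> ae_filter I01" if "x \<in> {0..1}" for x
    using F_ae[OF that] by (rule filter_leI)
  have "U x \<le> ae_filter I01" if "x \<in> {0..1}" for x
    using U(1)[OF that] F_le[OF that] by (rule order_trans)
  moreover have "AE z in I01_sq. ((\<lambda>u. W u (snd z)) \<longlongrightarrow> W (fst z) (snd z)) (U (fst z))"
    using F_lim AE_space
  proof eventually_elim
    case (elim z)
    then have "fst z \<in> {0..1}" by (auto simp: space_pair_measure space_I01)
    then show ?case using tendsto_mono[OF U(1) elim(1)] by blast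
  qed
  moreover have "eventually (\<lambda>u. u \<in> A k) (U x)" if "k \<in> {1..r}" "x \<in> A k" for x k
  proof (rule filter_leD[OF U(1) F_A[OF that]])
    show "x \<in> {0..1}" using sub that by blast
  qed
  ultimately show ?thesis using U(2) by (intro exI[of _ U] conjI ballI) simp_all
qed

section \<open>Iterated limits\<close>

text \<open>Nested quantifiers "for most", the head of the list outermost; \<open>x\<close>
  accumulates the values chosen so far. It plays the part of a product of filters for which there is
  no product measure.\<close>

fun iter_eventually :: "('i \<Rightarrow> 'a filter) \<Rightarrow> 'i list \<Rightarrow> (('i \<Rightarrow> 'a) \<Rightarrow> bool) \<Rightarrow> ('i \<Rightarrow> 'a) \<Rightarrow> bool" where
  "iter_eventually F [] Q x \<longleftrightarrow> Q x"
| "iter_eventually F (i # is) Q x \<longleftrightarrow> eventually (\<lambda>u. iter_eventually F is Q (x(i := u))) (F i)"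

lemma iter_eventually_mono:
  assumes "iter_eventually F is Q x" "\<And>i. i \<in> set is \<Longrightarrow> G i \<le> F i" "\<And>x. Q x \<Longrightarrow> R x"
  shows "iter_eventually G is R x"
  using assms(1,2)
proof (induction "is" arbitrary: x)
  case Nil
  then show ?case using assms(3) by simp
next
  case (Cons i "is")
  have "eventually (\<lambda>u. iter_eventually F is Q (x(i := u))) (G i)"
    using Cons.prems by (intro filter_leD[of "G i" "F i"]) simp_all
  then have "eventually (\<lambda>u. iter_eventually G is R (x(i := u))) (G i)"
  proof (rule eventually_mono)
    fix u assume "iter_eventually F is Q (x(i := u))"
    then show "iter_eventually G is R (x(i := u))" by (rule Cons.IH) (simp add: Cons.prems(2))
  qed
  then show ?case by simp
qed

lemma iter_eventually_contradiction:
  assumes "iter_eventually F is Q x" "iter_eventually F is (\<lambda>x. \<not> Q x) x" "\<And>i. i \<in> set is \<Longrightarrow> F i \<noteq> bot"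
  shows False
  using assms
proof (induction "is" arbitrary: x)
  case (Cons i "is")
  have "eventually (\<lambda>u. iter_eventually F is Q (x(i := u)) \<and> iter_eventually F is (\<lambda>x. \<not> Q x) (x(i := u))) (F i)"
    using Cons.prems by (simp add: eventually_conj)
  then have "eventually (\<lambda>u. False) (F i)"
    by (rule eventually_mono) (use Cons.IH Cons.prems(3) in auto)
  then show ?case using Cons.prems(3)[of i] by simp
qed simp

lemma iter_eventually_upd:
  "i \<notin> set is \<Longrightarrow> iter_eventually F is (\<lambda>x. Q (x(i := u))) x \<longleftrightarrow> iter_eventually F is Q (x(i := u))"
  by (induction "is" arbitrary: x) (simp_all add: fun_upd_twist)

text \<open>Fubini's theorem one coordinate at a time: almost every value of the first coordinate
  has a null section in the remaining product. The conclusion is free of measures, so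
  \<open>iter_eventually_mono\<close> can refine its filters to ultrafilters.\<close>

lemma AE_PiM_iter_eventually:
  fixes Q :: "('i \<Rightarrow> real) \<Rightarrow> bool"
  assumes "distinct is" "AE x in I01_pow (set is). Q x"
  shows "iter_eventually (\<lambda>_. ae_filter I01) is Q (\<lambda>_. undefined)"
  using assms
proof (induction "is" arbitrary: Q)
  case Nil
  \<comment> \<open>The empty product has this single point, which is why the iteration starts
    there.\<close>
  have "Q (\<lambda>_. undefined)"
    using Nil.prems(2) unfolding list.set PiM_empty AE_count_space by blast
  then show ?case by simp
next
  case (Cons i "is")
  let ?I = "set is" and ?M = "\<lambda>I. I01_pow I"
  have i: "i \<notin> ?I" and d: "distinct is" using Cons.prems by auto
  obtain N where N: "N \<in> null_sets (?M (insert i ?I))" "{x \<in> space (?M (insert i ?I)). \<not> Q x} \<subseteq> N"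
    using Cons.prems(2) by (auto simp: eventually_ae_filter)
  have NS[measurable]: "N \<in> sets (?M (insert i ?I))" using N(1) by auto
  have [measurable]: "(\<lambda>(x, u). x(i := u)) \<in> measurable (?M ?I \<Otimes>\<^sub>M I01) (?M (insert i ?I))"
    by (rule measurable_add_dim)
  have up[measurable]: "(\<lambda>p. (snd p)(i := fst p)) \<in> measurable (I01 \<Otimes>\<^sub>M ?M ?I) (?M (insert i ?I))"
    by measurable
  have sf: "sigma_finite_measure (?M ?I)"
    by (rule I01_prod.sigma_finite) simp
  have mN: "(\<lambda>u. \<integral>\<^sup>+x. indicator N (x(i := u)) \<partial>?M ?I) \<in> borel_measurable I01"
  proof (rule sigma_finite_measure.borel_measurable_nn_integral[OF sf])
    show "(\<lambda>(u, x). indicator N (x(i := u)) :: ennreal) \<in> borel_measurable (I01 \<Otimes>\<^sub>M ?M ?I)"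
      unfolding case_prod_unfold using measurable_compose[OF up borel_measurable_indicator[OF NS]] by simp
  qed
  have "(\<integral>\<^sup>+u. \<integral>\<^sup>+x. indicator N (x(i := u)) \<partial>?M ?I \<partial>I01) = (\<integral>\<^sup>+x. indicator N x \<partial>?M (insert i ?I))"
    using i by (intro I01_prod.product_nn_integral_insert_rev[symmetric]) auto
  also have "\<dots> = 0" using N(1) by auto
  finally have "AE u in I01. (\<integral>\<^sup>+x. indicator N (x(i := u)) \<partial>?M ?I) = 0"
    using nn_integral_0_iff_AE[OF mN] by simp
  then have "AE u in I01. iter_eventually (\<lambda>_. ae_filter I01) is Q ((\<lambda>_. undefined)(i := u))"
    using AE_space
  proof eventually_elim
    case (elim u)
    have "(\<lambda>x. x(i := u)) \<in> measurable (?M ?I) (?M (insert i ?I))"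
      using measurable_compose[OF measurable_Pair1'[OF elim(2)] up] by simp
    from measurable_compose[OF this borel_measurable_indicator[OF NS]]
    have "(\<lambda>x. indicator N (x(i := u)) :: ennreal) \<in> borel_measurable (?M ?I)" .
    from nn_integral_0_iff_AE[OF this] elim(1)
    have "AE x in ?M ?I. indicator N (x(i := u)) = (0 :: ennreal)" by simp
    then have "AE x in ?M ?I. Q (x(i := u))"
      using AE_space
    proof eventually_elim
      case (elim x)
      then have "x(i := u) \<in> space (?M (insert i ?I))"
        using \<open>u \<in> space I01\<close> by (auto simp: space_PiM PiE_iff extensional_def)
      moreover have "x(i := u) \<notin> N" using elim(1) by (auto simp: indicator_def split: if_splits)
      ultimately show ?case using N(2) by auto
    qed
    show ?case
      by (rule iter_eventually_upd[OF i, THEN iffD1, OF Cons.IH[OF d \<open>AE x in ?M ?I. Q (x(i := u))\<close>]])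
  qed
  then show ?case by simp
qed

text \<open>The points are moved one at a time, in the order of \<open>is\<close>. Once \<open>x a\<close> has been moved,
  its pairs with the points \<open>z b\<close> that still stand are controlled through the inner limit \<open>L\<close>.\<close>

lemma iterated_limit_realizes:
  fixes W :: "'a \<Rightarrow> 'a \<Rightarrow> real" and L W1 :: "'a \<Rightarrow> 'a \<Rightarrow> real"
  assumes L: "\<And>b u. b \<in> set is \<Longrightarrow> ((\<lambda>v. W u v) \<longlongrightarrow> L (z b) u) (U (z b))"
    and W1: "\<And>a b. a \<in> set is \<Longrightarrow> b \<in> set is \<Longrightarrow> ((\<lambda>u. L (z b) u) \<longlongrightarrow> W1 (z a) (z b)) (U (z a))"
    and sym: "\<And>u v. W u v = W v u"
    and R: "\<And>a b. open (R a b)" "\<And>a b. R a b = R b a"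
    and S: "finite S" "S \<inter> set is = {}" "distinct is"
    and 1: "\<And>a b. a \<in> S \<Longrightarrow> b \<in> S \<Longrightarrow> a \<noteq> b \<Longrightarrow> W (x a) (x b) \<in> R a b"
    and 2: "\<And>a b. a \<in> S \<Longrightarrow> b \<in> set is \<Longrightarrow> L (z b) (x a) \<in> R a b"
    and 3: "sorted_wrt (\<lambda>a b. W1 (z a) (z b) \<in> R a b) is"
  shows "iter_eventually (\<lambda>i. U (z i)) is (\<lambda>x. \<forall>a\<in>S \<union> set is. \<forall>b\<in>S \<union> set is. a \<noteq> b \<longrightarrow> W (x a) (x b) \<in> R a b) x"
  using L W1 S 1 2 3
proof (induction "is" arbitrary: S x)
  case Nil
  then show ?case by simp
next
  case (Cons i "is")
  have iS: "i \<notin> S" and iis: "i \<notin> set is" using Cons.prems(4,5) by auto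
  \<comment> \<open>The new position \<open>u\<close> has to fit the points already moved:
    \<open>W (x a) u\<close> tends to \<open>L (z i) (x a)\<close>, which lies in the open set
    \<open>R a i\<close>.\<close>
  have ev1: "eventually (\<lambda>u. W (x a) u \<in> R a i) (U (z i))" if a: "a \<in> S" for a
  proof -
    have lim: "((\<lambda>v. W (x a) v) \<longlongrightarrow> L (z i) (x a)) (U (z i))" by (rule Cons.prems(1)) simp
    have "L (z i) (x a) \<in> R a i" by (rule Cons.prems(7)[OF a]) simp
    from topological_tendstoD[OF lim R(1) this] show ?thesis .
  qed
  \<comment> \<open>It also has to fit the points still to come: \<open>L (z b) u\<close> tends to
    \<open>W1 (z i) (z b)\<close>. The resulting membership is what the next steps assume about
    moved points.\<close>
  have ev2: "eventually (\<lambda>u. L (z b) u \<in> R i b) (U (z i))" if b: "b \<in> set is" for b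
  proof -
    have lim: "((\<lambda>u. L (z b) u) \<longlongrightarrow> W1 (z i) (z b)) (U (z i))" by (rule Cons.prems(2)) (use b in simp_all)
    have "W1 (z i) (z b) \<in> R i b" using Cons.prems(8) b by simp
    from topological_tendstoD[OF lim R(1) this] show ?thesis .
  qed
  have "eventually (\<lambda>u. \<forall>a\<in>S. W (x a) u \<in> R a i) (U (z i))"
    using ev1 Cons.prems(3) by (simp add: eventually_ball_finite)
  moreover have "eventually (\<lambda>u. \<forall>b\<in>set is. L (z b) u \<in> R i b) (U (z i))"
    using ev2 by (simp add: eventually_ball_finite)
  ultimately have "eventually (\<lambda>u. iter_eventually (\<lambda>i. U (z i)) is
     (\<lambda>x. \<forall>a\<in>insert i S \<union> set is. \<forall>b\<in>insert i S \<union> set is. a \<noteq> b \<longrightarrow> W (x a) (x b) \<in> R a b) (x(i := u))) (U (z i))"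
  proof eventually_elim
    case (elim u)
    show ?case
    proof (rule Cons.IH)
      fix a b assume ab: "a \<in> insert i S" "b \<in> insert i S" "a \<noteq> b"
      have W: "W (x c) u \<in> R c i" if "c \<in> S" for c using elim(1) that by blast
      consider "a = i" "b \<in> S" | "b = i" "a \<in> S" "a \<noteq> i" | "a \<in> S" "b \<in> S" "a \<noteq> i" "b \<noteq> i"
        using ab iS by blast
      then show "W ((x(i := u)) a) ((x(i := u)) b) \<in> R a b"
      proof cases
        case 1
        then show ?thesis using W[of b] sym[of u "x b"] R(2)[of i b] ab(3) by simp
      next
        case 2
        then show ?thesis using W[of a] by simp
      next
        case 3
        then show ?thesis using Cons.prems(6)[of a b] ab(3) by simp
      qed
    next
      fix a b assume ab: "a \<in> insert i S" "b \<in> set is"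
      show "L (z b) ((x(i := u)) a) \<in> R a b"
      proof (cases "a = i")
        case True
        then show ?thesis using elim(2) ab(2) by simp
      next
        case False
        then show ?thesis using Cons.prems(7)[of a b] ab by simp
      qed
    next
      show "\<And>b u. b \<in> set is \<Longrightarrow> ((\<lambda>v. W u v) \<longlongrightarrow> L (z b) u) (U (z b))"
        by (rule Cons.prems(1)) simp
      show "\<And>a b. a \<in> set is \<Longrightarrow> b \<in> set is \<Longrightarrow> ((\<lambda>u. L (z b) u) \<longlongrightarrow> W1 (z a) (z b)) (U (z a))"
        by (rule Cons.prems(2)) simp_all
    qed (use Cons.prems iis in simp_all)
  qed
  then show ?case by simp
qed

section \<open>Complete freeness of the iterated limit\<close>

lemma psi_nonzero:
  assumes "\<And>a b. a \<in> verts G \<Longrightarrow> b \<in> verts G \<Longrightarrow> a \<noteq> b \<Longrightarrow>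
    W (x a) (x b) \<in> (if {a, b} \<in> edges G then {0<..} else {..<1})"
  shows "psi G W x \<noteq> 0"
proof -
  have "W (x i) (x j) > 0" if "(i, j) \<in> epairs G" for i j
    using assms[of i j] epairsD[OF that] that by (auto simp: epairs_def)
  moreover have "W (x i) (x j) < 1" if "(i, j) \<in> vpairs G - epairs G" for i j
    using assms[of i j] vpairsD[of i j G] that by (auto simp: epairs_def)
  ultimately show ?thesis
    by (fastforce simp: psi_def)
qed

text \<open>Converse of \<open>psi_nonzero\<close>. Together they express that \<open>psi\<close>
  does not vanish by strict inequalities on pairs of vertices, the open conditions needed for
  \<open>iterated_limit_realizes\<close>.\<close>

lemma psi_nonzeroD:
  assumes "psi G W x \<noteq> 0" and W: "\<And>a b. a \<in> verts G \<Longrightarrow> b \<in> verts G \<Longrightarrow> W (x a) (x b) = W (x b) (x a) \<and> W (x a) (x b) \<in> {0..1}"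
    and ab: "a \<in> verts G" "b \<in> verts G" "a \<noteq> b"
  shows "W (x a) (x b) \<in> (if {a, b} \<in> edges G then {0<..} else {..<1})"
proof -
  have nz: "(\<Prod>(i, j)\<in>epairs G. W (x i) (x j)) \<noteq> 0" "(\<Prod>(i, j)\<in>vpairs G - epairs G. 1 - W (x i) (x j)) \<noteq> 0"
    using assms(1) unfolding psi_def by (metis mult_zero_left, metis mult_zero_right)
  have *: "W (x i) (x j) \<in> (if {i, j} \<in> edges G then {0<..} else {..<1})" if ij: "i \<in> verts G" "j \<in> verts G" "i < j" for i j
  proof (cases "{i, j} \<in> edges G")
    case True
    then have "(i, j) \<in> epairs G" using ij by (simp add: epairs_def vpairs_def)
    then have "W (x i) (x j) \<noteq> 0" using nz(1) by (force simp: prod_zero_iff)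
    then show ?thesis using True W[OF ij(1,2)] by simp
  next
    case False
    then have "(i, j) \<in> vpairs G - epairs G" using ij by (simp add: epairs_def vpairs_def)
    then have "1 - W (x i) (x j) \<noteq> 0" using nz(2) by (force simp: prod_zero_iff)
    then show ?thesis using False W[OF ij(1,2)] by simp
  qed
  show ?thesis
  proof (cases "a < b")
    case True
    then show ?thesis using *[OF ab(1,2)] by simp
  next
    case False
    then have "b < a" using ab(3) by simp
    from *[OF ab(2,1) this] show ?thesis using W[OF ab(1,2)] by (simp add: insert_commute)
  qed
qed

lemma completely_free_version:
  fixes A :: "nat \<Rightarrow> real set"
  assumes W: "graphon W" and free: "\<forall>G\<in>\<G>. graph_free G W"
    and cover: "(\<Union>k\<in>{1..r}. A k) = {0..1}" and disj: "disjoint_family_on A {1..r}"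
    and A: "\<forall>k\<in>{1..r}. A k \<in> sets lebesgue \<and> measure lebesgue (A k) > 0"
  shows "\<exists>W'. graphon W' \<and> (\<forall>F. graphon_density F W' = graphon_density F W) \<and>
    (\<forall>G\<in>\<G>. completely_graph_free G W') \<and>
    (\<forall>k\<in>{1..r}. \<forall>l\<in>{1..r}. \<forall>c. (\<forall>x\<in>A k. \<forall>y\<in>A l. W x y = c) \<longrightarrow> (\<forall>x\<in>A k. \<forall>y\<in>A l. W' x y = c))"
proof -
  obtain W0 where W0: "borel_graphon W0" and eq: "AE_eq_graphon W W0"
    by (rule graphon_borel_version[OF W])
  have W0b: "W0 x y \<in> {0..1}" for x y by (rule borel_graphonD[OF W0])
  have W0s: "W0 x y = W0 y x" for x y by (rule borel_graphonD[OF W0])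
  obtain U where U: "\<And>x. x \<in> {0..1} \<Longrightarrow> ultrafilter (U x)"
    "\<And>x P. x \<in> {0..1} \<Longrightarrow> AE u in I01. P u \<Longrightarrow> eventually P (U x)"
    "\<And>x k. k \<in> {1..r} \<Longrightarrow> x \<in> A k \<Longrightarrow> eventually (\<lambda>u. u \<in> A k) (U x)"
    "AE z in I01_sq. ((\<lambda>u. W0 u (snd z)) \<longlongrightarrow> W0 (fst z) (snd z)) (U (fst z))"
  proof -
    obtain U where "\<forall>x\<in>{0..1}. ultrafilter (U x) \<and> U x \<le> ae_filter I01"
      "\<forall>k\<in>{1..r}. \<forall>x\<in>A k. eventually (\<lambda>u. u \<in> A k) (U x)"
      "AE z in I01_sq. ((\<lambda>u. W0 u (snd z)) \<longlongrightarrow> W0 (fst z) (snd z)) (U (fst z))"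
      using exists_point_ultrafilters[OF W0 cover disj A] by (elim exE conjE)
    then show thesis using that[of U] by (simp add: le_filter_def)
  qed
  have Ubot: "U x \<noteq> bot" if "x \<in> {0..1}" for x using U(1)[OF that] by (simp add: ultrafilter_def)
  \<comment> \<open>\<open>L y u\<close> stands for the value at \<open>(u, y)\<close> with only the
    second argument moved; \<open>W1\<close> then moves the first one as well.\<close>
  define L where "L y u = Lim (U y) (\<lambda>v. W0 u v)" for y u
  define W1 where "W1 x y = Lim (U x) (\<lambda>u. L y u)" for x y
  \<comment> \<open>The two limits need not commute, so \<open>W1\<close> need not be symmetric.
    With the smaller point always outside, \<open>W'\<close> is symmetric by construction.\<close>
  define W' where "W' x y = (if x \<le> y then W1 x y else W1 y x)" for x y
  have L: "((\<lambda>v. W0 u v) \<longlongrightarrow> L y u) (U y)" "L y u \<in> {0..1}" if "y \<in> {0..1}" for y u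
  proof -
    have ev: "eventually (\<lambda>v. W0 u v \<in> {0..1}) (U y)" by (rule always_eventually) (use W0b in blast)
    show "((\<lambda>v. W0 u v) \<longlongrightarrow> L y u) (U y)" "L y u \<in> {0..1}"
      unfolding L_def by (rule ultrafilter_Lim[OF U(1)[OF that] ev])+
  qed
  have W1: "((\<lambda>u. L y u) \<longlongrightarrow> W1 x y) (U x)" "W1 x y \<in> {0..1}" if "x \<in> {0..1}" "y \<in> {0..1}" for x y
  proof -
    have ev: "eventually (\<lambda>u. L y u \<in> {0..1}) (U x)" by (rule always_eventually) (use L(2)[OF that(2)] in blast)
    show "((\<lambda>u. L y u) \<longlongrightarrow> W1 x y) (U x)" "W1 x y \<in> {0..1}"
      unfolding W1_def by (rule ultrafilter_Lim[OF U(1)[OF that(1)] ev])+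
  qed
  have W'sym: "W' x y = W' y x" for x y by (simp add: W'_def)
  have W'b: "W' x y \<in> {0..1}" if "x \<in> {0..1}" "y \<in> {0..1}" for x y
    using W1(2)[OF that] W1(2)[OF that(2,1)] by (simp add: W'_def)
  \<comment> \<open>One variable at a time: for almost every \<open>y\<close>,
    \<open>L y u = W0 u y\<close> for almost every \<open>u\<close>. This suffices along
    \<open>U x\<close>, which refines the almost-everywhere filter, and the limit over
    \<open>u\<close> then recovers \<open>W0 x y\<close>.\<close>
  have ae1: "AE z in I01_sq. W1 (fst z) (snd z) = W0 (fst z) (snd z)"
  proof -
    have "AE y in I01. AE u in I01. ((\<lambda>v. W0 v u) \<longlongrightarrow> W0 y u) (U y)"
      using I01_pair.AE_pair[OF U(4)] by simp
    then have "AE y in I01. AE u in I01. L y u = W0 u y"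
      using AE_space
    proof eventually_elim
      case (elim y)
      then have y: "y \<in> {0..1}" by (simp add: space_I01)
      show ?case using elim(1)
      proof eventually_elim
        case (elim u)
        have "W0 u = (\<lambda>v. W0 v u)" by (rule ext) (rule W0s)
        with elim have "((\<lambda>v. W0 u v) \<longlongrightarrow> W0 u y) (U y)" by simp
        then show ?case unfolding L_def by (rule tendsto_Lim[OF Ubot[OF y]])
      qed
    qed
    from U(4) AE_snd_pair(1)[OF this] AE_space show ?thesis
    proof eventually_elim
      case (elim z)
      then have z: "fst z \<in> {0..1}" by (auto simp: space_pair_measure space_I01)
      have "eventually (\<lambda>u. W0 u (snd z) = L (snd z) u) (U (fst z))"
        using U(2)[OF z elim(2)] by eventually_elim simp
      then have "((\<lambda>u. L (snd z) u) \<longlongrightarrow> W0 (fst z) (snd z)) (U (fst z))"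
        by (rule Lim_transform_eventually[OF elim(1)])
      then show ?case unfolding W1_def by (rule tendsto_Lim[OF Ubot[OF z]])
    qed
  qed
  have eq': "AE_eq_graphon W' W0"
    unfolding AE_eq_graphon_def using ae1 AE_swap_pair[of "\<lambda>x y. W1 x y = W0 x y", OF ae1]
  proof eventually_elim
    case (elim z)
    then show ?case using W0s[of "snd z" "fst z"] by (simp add: W'_def)
  qed
  have gW': "graphon W'"
    by (rule graphon_of_AE_eq[OF W0 eq']) (use W'sym W'b in auto)
  have dens: "graphon_density F W' = graphon_density F W" for F
    by (simp only: graphon_density_borel[OF W0 eq] graphon_density_borel[OF W0 eq'])
  have compl: "completely_graph_free G W'" if G: "G \<in> \<G>" for G
    unfolding completely_graph_free_def
  proof (rule ballI, rule ccontr)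
    fix z assume z: "z \<in> verts G \<rightarrow> {0..1}" and nz: "psi G W' z \<noteq> 0"
    have z01: "z a \<in> {0..1}" if "a \<in> verts G" for a using z that by blast
    \<comment> \<open>Sorted by position, the earlier vertex of each pair is the outer one in the
      definition of \<open>W'\<close>, so this single order of moving serves all pairs. Vertices at
      the same position may come in either order.\<close>
    define vs where "vs = sort_key z (sorted_list_of_set (verts G))"
    have vs: "set vs = verts G" "distinct vs" "sorted (map z vs)" by (simp_all add: vs_def)
    define R where "R a b = (if {a, b} \<in> edges G then {0<..} else {..<1::real})" for a b
    have "iter_eventually (\<lambda>i. U (z i)) vs (\<lambda>x. \<forall>a\<in>{} \<union> set vs. \<forall>b\<in>{} \<union> set vs. a \<noteq> b \<longrightarrow> W0 (x a) (x b) \<in> R a b) (\<lambda>_. undefined)"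
    proof (rule iterated_limit_realizes[where L = L and ?W1.0 = W1])
      show "((\<lambda>v. W0 u v) \<longlongrightarrow> L (z b) u) (U (z b))" if "b \<in> set vs" for b u
        using that vs z01 by (intro L) auto
      show "((\<lambda>u. L (z b) u) \<longlongrightarrow> W1 (z a) (z b)) (U (z a))" if "a \<in> set vs" "b \<in> set vs" for a b
        using that vs z01 by (intro W1) auto
      show "open (R a b)" "R a b = R b a" for a b by (simp_all add: R_def insert_commute)
      have "W' (z a) (z b) \<in> R a b" if "a \<in> verts G" "b \<in> verts G" "a \<noteq> b" for a b
        unfolding R_def by (rule psi_nonzeroD[OF nz _ that]) (use W'sym W'b z01 in blast)
      then have "W1 (z a) (z b) \<in> R a b" if "a \<in> verts G" "b \<in> verts G" "a \<noteq> b" "z a \<le> z b" for a b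
        using that unfolding W'_def by fastforce
      then show "sorted_wrt (\<lambda>a b. W1 (z a) (z b) \<in> R a b) vs"
        using vs(3) vs(2) unfolding sorted_map vs(1)[symmetric]
        by (auto simp: sorted_wrt_iff_nth_less distinct_conv_nth)
    qed (use W0s vs in auto)
    then have 1: "iter_eventually (\<lambda>i. U (z i)) vs (\<lambda>x. \<not> psi G W0 x = 0) (\<lambda>_. undefined)"
    proof (rule iter_eventually_mono)
      fix x assume "\<forall>a\<in>{} \<union> set vs. \<forall>b\<in>{} \<union> set vs. a \<noteq> b \<longrightarrow> W0 (x a) (x b) \<in> R a b"
      then show "\<not> psi G W0 x = 0" using psi_nonzero[of G W0 x] vs(1) by (simp add: R_def)
    qed simp
    have "AE x in I01_pow (verts G). psi G W0 x = 0"
    proof -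
      have p01: "psi G W0 x \<in> {0..1}" for x
      proof -
        have "(\<Prod>(i, j)\<in>epairs G. W0 (x i) (x j)) \<in> {0..1}" "(\<Prod>(i, j)\<in>vpairs G - epairs G. 1 - W0 (x i) (x j)) \<in> {0..1}"
          by (intro prod_kernel_bounds W0b)+
        then show ?thesis unfolding psi_def by (auto intro: mult_le_one)
      qed
      have "(\<integral>x. psi G W0 x \<partial>I01_pow (verts G)) = 0"
        using bspec[OF free G] by (simp add: graph_free_def t_ind_borel[OF W0 eq])
      moreover have "integrable (I01_pow (verts G)) (psi G W0)"
        by (rule integrable_PiM_I01_bounded[where B = 1]) (use psi_borel_measurable[OF W0] p01 in \<open>auto simp: abs_le_iff intro: order_trans[of _ 0]\<close>)
      moreover have "AE x in I01_pow (verts G). 0 \<le> psi G W0 x" using p01 by simp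
      ultimately show ?thesis using integral_nonneg_eq_0_iff_AE by blast
    qed
    then have "iter_eventually (\<lambda>_. ae_filter I01) vs (\<lambda>x. psi G W0 x = 0) (\<lambda>_. undefined)"
      by (rule AE_PiM_iter_eventually[OF vs(2), unfolded vs(1)])
    then have 2: "iter_eventually (\<lambda>i. U (z i)) vs (\<lambda>x. psi G W0 x = 0) (\<lambda>_. undefined)"
    proof (rule iter_eventually_mono)
      fix i assume "i \<in> set vs"
      then have "z i \<in> {0..1}" using vs z01 by simp
      from U(2)[OF this] show "U (z i) \<le> ae_filter I01" by (intro filter_leI) 
    qed
    \<comment> \<open>Along the same nested filters \<open>psi\<close> would both vanish and not
      vanish.\<close>
    show False
      by (rule iter_eventually_contradiction[OF 2 1]) (use vs z01 Ubot in auto)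
  qed
  have AEW: "AE u in I01. AE v in I01. W u v = W0 u v"
    using I01_pair.AE_pair[OF eq[unfolded AE_eq_graphon_def]] by simp
  \<comment> \<open>The constant belongs to \<open>W\<close>, the limits to \<open>W0\<close>. The
    ultrafilters \<open>U x\<close> and \<open>U y\<close> stay inside \<open>A k\<close> and
    \<open>A l\<close> and ignore null sets, so both limits see the constant.\<close>
  have W1c: "W1 x y = c" if kl: "k \<in> {1..r}" "l \<in> {1..r}" and c: "\<And>x y. x \<in> A k \<Longrightarrow> y \<in> A l \<Longrightarrow> W x y = c"
      and xy: "x \<in> A k" "y \<in> A l" for k l c x y
  proof -
    have x: "x \<in> {0..1}" and y: "y \<in> {0..1}" using cover kl xy by blast+
    have "eventually (\<lambda>u. L y u = c) (U x)"
      using U(3)[OF kl(1) xy(1)] U(2)[OF x AEW]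
    proof eventually_elim
      case (elim u)
      have "eventually (\<lambda>v. W0 u v = c) (U y)"
        using U(3)[OF kl(2) xy(2)] U(2)[OF y elim(2)]
      proof eventually_elim
        case (elim v)
        then show ?case using c[OF \<open>u \<in> A k\<close>, of v] by simp
      qed
      then have "((\<lambda>v. W0 u v) \<longlongrightarrow> c) (U y)" by (rule tendsto_eventually)
      then show ?case unfolding L_def by (rule tendsto_Lim[OF Ubot[OF y]])
    qed
    then have "((\<lambda>u. L y u) \<longlongrightarrow> c) (U x)" by (rule tendsto_eventually)
    then show ?thesis unfolding W1_def by (rule tendsto_Lim[OF Ubot[OF x]])
  qed
  have const: "W' x y = c" if kl: "k \<in> {1..r}" "l \<in> {1..r}" and c: "\<forall>x\<in>A k. \<forall>y\<in>A l. W x y = c"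
      and xy: "x \<in> A k" "y \<in> A l" for k l c x y
  proof -
    have c': "W u v = c" if "u \<in> A k" "v \<in> A l" for u v using c that by simp
    \<comment> \<open>If \<open>y < x\<close> then \<open>W'\<close> uses \<open>W1 y x\<close>, so
      the transposed block must be constant too.\<close>
    have "W v u = c" if uv: "v \<in> A l" "u \<in> A k" for u v
    proof -
      have "u \<in> {0..1}" "v \<in> {0..1}" using cover kl uv by blast+
      then have "W u v = W v u" using W by (simp add: graphon_def)
      then show ?thesis using c'[OF uv(2,1)] by simp
    qed
    from W1c[OF kl(2,1) this xy(2,1)] W1c[OF kl c' xy] show ?thesis by (simp add: W'_def)
  qed
  show ?thesis
    by (intro exI[of _ W'] conjI allI ballI impI gW' dens compl) (assumption, rule const)
qed

section \<open>Weak regularity\<close>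

definition part_avg :: "'v set \<Rightarrow> ('v \<Rightarrow> 'v \<Rightarrow> real) \<Rightarrow> ('v \<Rightarrow> nat) \<Rightarrow> nat \<Rightarrow> nat \<Rightarrow> real" where
  "part_avg V A c a b = (\<Sum>x | x \<in> V \<and> c x = a. \<Sum>y | y \<in> V \<and> c y = b. A x y) /
     (real (card {x \<in> V. c x = a}) * real (card {y \<in> V. c y = b}))"

lemma part_avg_bounds:
  assumes "\<And>x y. A x y \<in> {0..1}"
  shows "part_avg V A c a b \<in> {0..1}"
proof -
  let ?X = "{x \<in> V. c x = a}" and ?Y = "{y \<in> V. c y = b}"
  have "(\<Sum>x\<in>?X. \<Sum>y\<in>?Y. A x y) \<le> (\<Sum>x\<in>?X. \<Sum>y\<in>?Y. 1)"
    by (intro sum_mono) (use assms in auto)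
  then have "(\<Sum>x\<in>?X. \<Sum>y\<in>?Y. A x y) \<le> real (card ?X) * real (card ?Y)" by simp
  moreover have "0 \<le> (\<Sum>x\<in>?X. \<Sum>y\<in>?Y. A x y)"
    by (intro sum_nonneg) (use assms in auto)
  moreover have "s / k \<in> {0..1}" if "0 \<le> s" "s \<le> k" for s k :: real
    using that by (cases "k = 0") auto
  ultimately show ?thesis unfolding part_avg_def by blast
qed

lemma part_avg_sym:
  assumes "\<And>x y. A x y = A y x"
  shows "part_avg V A c a b = part_avg V A c b a"
  unfolding part_avg_def by (subst sum.swap) (simp add: assms[of _ "_ :: 'a"] mult.commute cong: sum.cong)

lemma sum_over_parts:
  fixes g :: "'v \<Rightarrow> 'v \<Rightarrow> real"
  assumes "finite V"
  shows "(\<Sum>x\<in>V. \<Sum>y\<in>V. g x y) = (\<Sum>a\<in>c ` V. \<Sum>b\<in>c ` V. \<Sum>x | x \<in> V \<and> c x = a. \<Sum>y | y \<in> V \<and> c y = b. g x y)"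
proof -
  have "(\<Sum>x\<in>V. \<Sum>y\<in>V. g x y) = (\<Sum>a\<in>c ` V. \<Sum>x | x \<in> V \<and> c x = a. \<Sum>y\<in>V. g x y)"
    by (rule sum.image_gen[OF assms])
  also have "\<dots> = (\<Sum>a\<in>c ` V. \<Sum>x | x \<in> V \<and> c x = a. \<Sum>b\<in>c ` V. \<Sum>y | y \<in> V \<and> c y = b. g x y)"
    by (intro sum.cong refl sum.image_gen[OF assms])
  also have "\<dots> = (\<Sum>a\<in>c ` V. \<Sum>b\<in>c ` V. \<Sum>x | x \<in> V \<and> c x = a. \<Sum>y | y \<in> V \<and> c y = b. g x y)"
    by (intro sum.cong refl) (rule sum.swap)
  finally show ?thesis .
qed

text \<open>Averaging over blocks is the orthogonal projection onto kernels that depend on codes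
  only, so a test kernel of codes cannot tell \<open>A\<close> from its averages. Only codes that
  occur in \<open>V\<close> are summed, so no block is empty.\<close>

lemma part_avg_projection:
  assumes "finite V"
  shows "(\<Sum>x\<in>V. \<Sum>y\<in>V. A x y * \<phi> (c x) (c y)) = (\<Sum>x\<in>V. \<Sum>y\<in>V. part_avg V A c (c x) (c y) * \<phi> (c x) (c y))"
proof -
  have *: "(\<Sum>x | x \<in> V \<and> c x = a. \<Sum>y | y \<in> V \<and> c y = b. A x y * \<phi> (c x) (c y)) =
      (\<Sum>x | x \<in> V \<and> c x = a. \<Sum>y | y \<in> V \<and> c y = b. part_avg V A c (c x) (c y) * \<phi> (c x) (c y))"
    if "a \<in> c ` V" "b \<in> c ` V" for a b
  proof -
    let ?X = "{x. x \<in> V \<and> c x = a}" and ?Y = "{y. y \<in> V \<and> c y = b}"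
    have "?X \<noteq> {}" "?Y \<noteq> {}" using that by auto
    then have "card ?X \<noteq> 0" "card ?Y \<noteq> 0" using assms by simp_all
    then have "part_avg V A c a b * (real (card ?X) * real (card ?Y)) = (\<Sum>x\<in>?X. \<Sum>y\<in>?Y. A x y)"
      by (simp add: part_avg_def)
    note e1 = this
    have e2: "(\<Sum>x\<in>?X. \<Sum>y\<in>?Y. A x y * \<phi> (c x) (c y)) = (\<Sum>x\<in>?X. \<Sum>y\<in>?Y. A x y) * \<phi> a b"
      by (simp add: sum_distrib_right)
    have e3: "(\<Sum>x\<in>?X. \<Sum>y\<in>?Y. part_avg V A c (c x) (c y) * \<phi> (c x) (c y)) =
        part_avg V A c a b * (real (card ?X) * real (card ?Y)) * \<phi> a b"
      by simp
    show ?thesis unfolding e2 e3 e1 ..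
  qed
  show ?thesis
    unfolding sum_over_parts[OF assms, of _ c]
    by (rule sum.cong[OF refl], rule sum.cong[OF refl], rule *)
qed

section \<open>Energy and greedy refinement\<close>

definition energy :: "'v set \<Rightarrow> ('v \<Rightarrow> 'v \<Rightarrow> real) \<Rightarrow> ('v \<Rightarrow> nat) \<Rightarrow> real" where
  "energy V A c = (\<Sum>x\<in>V. \<Sum>y\<in>V. (part_avg V A c (c x) (c y))\<^sup>2) / (real (card V))\<^sup>2"

text \<open>Pythagoras: coarse averages are also functions of the finer codes, via
  \<open>div k\<close>, so two uses of the projection turn the cross term into the coarse
  energy.\<close>

lemma energy_refine:
  assumes V: "finite V" and c: "\<And>x. c x = c' x div k"
  shows "(\<Sum>x\<in>V. \<Sum>y\<in>V. (part_avg V A c' (c' x) (c' y) - part_avg V A c (c x) (c y))\<^sup>2) / (real (card V))\<^sup>2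
    = energy V A c' - energy V A c"
proof -
  let ?p = "\<lambda>x y. part_avg V A c (c x) (c y)" and ?p' = "\<lambda>x y. part_avg V A c' (c' x) (c' y)"
  have 1: "(\<Sum>x\<in>V. \<Sum>y\<in>V. A x y * ?p x y) = (\<Sum>x\<in>V. \<Sum>y\<in>V. (?p x y)\<^sup>2)"
    using part_avg_projection[OF V, of A "\<lambda>a b. part_avg V A c a b" c] by (simp add: power2_eq_square)
  have 2: "(\<Sum>x\<in>V. \<Sum>y\<in>V. A x y * ?p x y) = (\<Sum>x\<in>V. \<Sum>y\<in>V. ?p' x y * ?p x y)"
    using part_avg_projection[OF V, of A "\<lambda>a b. part_avg V A c (a div k) (b div k)" c'] by (simp add: c)
  have "(\<Sum>x\<in>V. \<Sum>y\<in>V. (?p' x y - ?p x y)\<^sup>2) =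
      (\<Sum>x\<in>V. \<Sum>y\<in>V. (?p' x y)\<^sup>2) - 2 * (\<Sum>x\<in>V. \<Sum>y\<in>V. ?p' x y * ?p x y) + (\<Sum>x\<in>V. \<Sum>y\<in>V. (?p x y)\<^sup>2)"
    by (simp add: power2_diff sum.distrib sum_subtractf sum_distrib_left mult.assoc)
  also have "\<dots> = (\<Sum>x\<in>V. \<Sum>y\<in>V. (?p' x y)\<^sup>2) - (\<Sum>x\<in>V. \<Sum>y\<in>V. (?p x y)\<^sup>2)"
    using 1 2 by simp
  finally show ?thesis by (simp add: energy_def diff_divide_distrib)
qed

lemma energy_bounds:
  assumes "finite V" "\<And>x y. A x y \<in> {0..1}"
  shows "energy V A c \<in> {0..1}"
proof -
  have "(\<Sum>x\<in>V. \<Sum>y\<in>V. (part_avg V A c (c x) (c y))\<^sup>2) \<le> (\<Sum>x\<in>V. \<Sum>y\<in>V. 1)"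
    using part_avg_bounds[of A, OF assms(2)] by (intro sum_mono) (auto intro: power_le_one)
  also have "\<dots> = (real (card V))\<^sup>2" by (simp add: power2_eq_square)
  finally show ?thesis
    by (auto simp: energy_def divide_le_eq_1 intro!: divide_nonneg_nonneg sum_nonneg)
qed

text \<open>The cut norm with weights in [0,1] in place of sets; weights are what arises in
  counting, as products of kernel values.\<close>

definition cut_le :: "'v set \<Rightarrow> ('v \<Rightarrow> 'v \<Rightarrow> real) \<Rightarrow> real \<Rightarrow> bool" where
  "cut_le V D \<delta> \<longleftrightarrow> (\<forall>f g. (\<forall>x\<in>V. f x \<in> {0..1}) \<longrightarrow> (\<forall>x\<in>V. g x \<in> {0..1}) \<longrightarrow>
     \<bar>\<Sum>x\<in>V. \<Sum>y\<in>V. f x * g y * D x y\<bar> \<le> \<delta> * (real (card V))\<^sup>2)"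

lemma weighted_sum_le:
  fixes h w :: "'v \<Rightarrow> real"
  assumes "finite V" "\<And>x. x \<in> V \<Longrightarrow> w x \<in> {0..1}"
  shows "(\<Sum>x\<in>V. w x * h x) \<le> (\<Sum>x | x \<in> V \<and> 0 < h x. h x)"
proof -
  have "(\<Sum>x\<in>V. w x * h x) \<le> (\<Sum>x\<in>V. if 0 < h x then h x else 0)"
  proof (rule sum_mono)
    fix x assume "x \<in> V"
    then have w: "0 \<le> w x" "w x \<le> 1" using assms(2) by auto
    show "w x * h x \<le> (if 0 < h x then h x else 0)"
    proof (cases "0 < h x")
      case True
      then show ?thesis using w mult_right_mono[of "w x" 1 "h x"] by simp
    next
      case False
      then show ?thesis using w by (simp add: mult_nonneg_nonpos)
    qed
  qed
  then show ?thesis using assms(1) by (simp add: sum.inter_filter)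
qed

text \<open>The form is linear in each weight separately, hence largest at 0-1 weights: first
  \<open>f\<close> becomes the indicator of \<open>S\<close>, then \<open>g\<close> that of
  \<open>T\<close>.\<close>

lemma cut_functions_le:
  assumes V: "finite V" and fg: "\<And>x. x \<in> V \<Longrightarrow> f x \<in> {0..1}" "\<And>x. x \<in> V \<Longrightarrow> g x \<in> {0..1}"
    and le: "\<And>S T. S \<subseteq> V \<Longrightarrow> T \<subseteq> V \<Longrightarrow> (\<Sum>x\<in>S. \<Sum>y\<in>T. D x y) \<le> (B::real)"
  shows "(\<Sum>x\<in>V. \<Sum>y\<in>V. f x * g y * D x y) \<le> B"
proof -
  define h where "h x = (\<Sum>y\<in>V. g y * D x y)" for x
  define S where "S = {x. x \<in> V \<and> 0 < h x}"
  define T where "T = {y. y \<in> V \<and> 0 < (\<Sum>x\<in>S. D x y)}"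
  have "(\<Sum>x\<in>V. \<Sum>y\<in>V. f x * g y * D x y) = (\<Sum>x\<in>V. f x * h x)"
    by (simp add: h_def sum_distrib_left mult.assoc)
  also have "\<dots> \<le> (\<Sum>x\<in>S. h x)"
    unfolding S_def by (rule weighted_sum_le[OF V fg(1)])
  also have "\<dots> = (\<Sum>y\<in>V. g y * (\<Sum>x\<in>S. D x y))"
    unfolding h_def by (subst sum.swap) (simp add: sum_distrib_left)
  also have "\<dots> \<le> (\<Sum>y\<in>T. \<Sum>x\<in>S. D x y)"
    unfolding T_def by (rule weighted_sum_le[OF V fg(2)])
  also have "\<dots> = (\<Sum>x\<in>S. \<Sum>y\<in>T. D x y)" by (rule sum.swap)
  also have "\<dots> \<le> B" by (rule le) (auto simp: S_def T_def)
  finally show ?thesis .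
qed

text \<open>\<open>\<delta>\<close> bounds the discrepancy of the coarse code, its square the energy
  gained by the finer one. Energies stay in [0,1], so repeated refinement drives the discrepancies
  to 0.\<close>

definition refinement :: "'v set \<Rightarrow> ('v \<Rightarrow> 'v \<Rightarrow> real) \<Rightarrow> ('v \<Rightarrow> nat) \<Rightarrow> ('v \<Rightarrow> nat) \<Rightarrow> real \<Rightarrow> bool" where
  "refinement V A c c' \<delta> \<longleftrightarrow> (\<forall>x. c' x div 4 = c x) \<and> 0 \<le> \<delta> \<and> \<delta>\<^sup>2 \<le> energy V A c' - energy V A c \<and>
     cut_le V (\<lambda>x y. A x y - part_avg V A c (c x) (c y)) \<delta>"

lemma refine_step:
  fixes c :: "'v \<Rightarrow> nat"
  assumes V: "finite V" "V \<noteq> {}"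
  shows "\<exists>c' \<delta>. refinement V A c c' \<delta>"
proof -
  define D where "D x y = A x y - part_avg V A c (c x) (c y)" for x y
  define b where "b = (\<lambda>(S, T). \<bar>\<Sum>x\<in>S. \<Sum>y\<in>T. D x y\<bar>)"
  let ?P = "Pow V \<times> Pow V" and ?N = "real (card V)"
  have N: "?N > 0" using V by (simp add: card_gt_0_iff)
  have fin: "finite (b ` ?P)" and ne: "b ` ?P \<noteq> {}" using V by auto
  from Max_in[OF fin ne] obtain S T where ST: "S \<subseteq> V" "T \<subseteq> V" "b (S, T) = Max (b ` ?P)" by auto
  have max: "\<bar>\<Sum>x\<in>S'. \<Sum>y\<in>T'. D x y\<bar> \<le> b (S, T)" if "S' \<subseteq> V" "T' \<subseteq> V" for S' T'
  proof -
    have "b (S', T') \<in> b ` ?P" using that by blast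
    from Max_ge[OF fin this] show ?thesis by (simp add: ST(3)) (simp add: b_def)
  qed
  define \<delta> where "\<delta> = b (S, T) / ?N\<^sup>2"
  \<comment> \<open>Each part splits into at most four pieces by membership in \<open>S\<close> and
    in \<open>T\<close>: a new base-4 digit with one bit for each set.\<close>
  define c' where "c' x = 4 * c x + (2 * of_bool (x \<in> S) + of_bool (x \<in> T))" for x
  have c': "c' x div 4 = c x" for x by (simp add: c'_def)
  have cS: "x \<in> S \<longleftrightarrow> odd (c' x div 2)" and cT: "x \<in> T \<longleftrightarrow> odd (c' x)" for x
    by (auto simp: c'_def of_bool_def)
  define d where "d x y = part_avg V A c' (c' x) (c' y) - part_avg V A c (c x) (c y)" for x y
  let ?i = "\<lambda>x y. of_bool (x \<in> S) * of_bool (y \<in> T) :: real"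
  have sumST: "(\<Sum>x\<in>S. \<Sum>y\<in>T. k x y) = (\<Sum>x\<in>V. \<Sum>y\<in>V. k x y * ?i x y)" for k :: "'v \<Rightarrow> 'v \<Rightarrow> real"
  proof -
    have "(\<Sum>y\<in>V. k x y * ?i x y) = of_bool (x \<in> S) * (\<Sum>y\<in>T. k x y)" for x
    proof -
      have "(\<Sum>y\<in>T. k x y) = (\<Sum>y\<in>V. k x y * of_bool (y \<in> T))"
        by (rule sum.mono_neutral_cong_left) (use V ST in auto)
      then show ?thesis by (simp add: sum_distrib_left mult_ac)
    qed
    moreover have "(\<Sum>x\<in>S. \<Sum>y\<in>T. k x y) = (\<Sum>x\<in>V. of_bool (x \<in> S) * (\<Sum>y\<in>T. k x y))"
      by (rule sum.mono_neutral_cong_left) (use V ST in auto)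
    ultimately show ?thesis by simp
  qed
  \<comment> \<open>The indicator of \<open>S \<times> T\<close> depends only on the new codes, so
    \<open>A\<close> may be replaced by its new block averages.\<close>
  have Dd: "(\<Sum>x\<in>S. \<Sum>y\<in>T. D x y) = (\<Sum>x\<in>V. \<Sum>y\<in>V. d x y * ?i x y)"
  proof -
    have "(\<Sum>x\<in>V. \<Sum>y\<in>V. A x y * ?i x y) = (\<Sum>x\<in>V. \<Sum>y\<in>V. part_avg V A c' (c' x) (c' y) * ?i x y)"
      using part_avg_projection[OF V(1), of A "\<lambda>a b. of_bool (odd (a div 2)) * of_bool (odd b)" c']
      by (simp only: cS[symmetric] cT[symmetric])
    then show ?thesis
      unfolding sumST D_def d_def by (simp add: left_diff_distrib sum_subtractf)
  qed
  \<comment> \<open>Cauchy-Schwarz against the indicator of \<open>S \<times> T\<close> turns the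
    maximal discrepancy into a lower bound for the energy increment.\<close>
  have "(\<Sum>x\<in>V. \<Sum>y\<in>V. d x y * ?i x y)\<^sup>2 \<le> ?N\<^sup>2 * (\<Sum>x\<in>V. \<Sum>y\<in>V. (d x y)\<^sup>2)"
  proof -
    have "(\<Sum>x\<in>V. \<Sum>y\<in>V. d x y * ?i x y) = (\<Sum>p\<in>V \<times> V. ?i (fst p) (snd p) * d (fst p) (snd p))"
      by (simp add: sum.cartesian_product case_prod_unfold mult.commute)
    also have "\<dots>\<^sup>2 \<le> (\<Sum>p\<in>V \<times> V. (?i (fst p) (snd p))\<^sup>2) * (\<Sum>p\<in>V \<times> V. (d (fst p) (snd p))\<^sup>2)"
      by (rule Cauchy_Schwarz_ineq_sum)
    also have "\<dots> \<le> ?N\<^sup>2 * (\<Sum>p\<in>V \<times> V. (d (fst p) (snd p))\<^sup>2)"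
    proof (intro mult_right_mono sum_nonneg)
      have "(\<Sum>p\<in>V \<times> V. (?i (fst p) (snd p))\<^sup>2) \<le> (\<Sum>p\<in>V \<times> V. 1)"
        by (rule sum_mono) simp
      then show "(\<Sum>p\<in>V \<times> V. (?i (fst p) (snd p))\<^sup>2) \<le> ?N\<^sup>2"
        by (simp add: card_cartesian_product power2_eq_square)
    qed simp
    finally show ?thesis by (simp add: sum.cartesian_product case_prod_unfold)
  qed
  also have "(\<Sum>x\<in>V. \<Sum>y\<in>V. (d x y)\<^sup>2) = (energy V A c' - energy V A c) * ?N\<^sup>2"
    using energy_refine[where c = c and c' = c' and k = 4, OF V(1) c'[symmetric], of A] N
    unfolding d_def[symmetric] by (simp add: divide_eq_eq)
  finally have "(b (S, T))\<^sup>2 \<le> ?N\<^sup>2 * ((energy V A c' - energy V A c) * ?N\<^sup>2)"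
    by (simp add: b_def Dd)
  then have e: "\<delta>\<^sup>2 \<le> energy V A c' - energy V A c"
    using N by (simp add: \<delta>_def power_divide divide_le_eq mult_ac)
  have "\<bar>\<Sum>x\<in>V. \<Sum>y\<in>V. f x * g y * D x y\<bar> \<le> \<delta> * ?N\<^sup>2"
    if f: "\<forall>x\<in>V. f x \<in> {0..1}" and g: "\<forall>x\<in>V. g x \<in> {0..1}" for f g
  proof -
    have dN: "\<delta> * ?N\<^sup>2 = b (S, T)" using N by (simp add: \<delta>_def)
    have f': "f x \<in> {0..1}" and g': "g x \<in> {0..1}" if "x \<in> V" for x using f g that by blast+
    have "(\<Sum>x\<in>V. \<Sum>y\<in>V. f x * g y * D x y) \<le> b (S, T)"
      by (rule cut_functions_le[OF V(1) f' g']) (use max abs_le_iff in blast)+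
    moreover have "(\<Sum>x\<in>V. \<Sum>y\<in>V. f x * g y * - D x y) \<le> b (S, T)"
    proof (rule cut_functions_le[OF V(1) f' g'])
      fix S' T' assume "S' \<subseteq> V" "T' \<subseteq> V"
      then show "(\<Sum>x\<in>S'. \<Sum>y\<in>T'. - D x y) \<le> b (S, T)"
        using max[of S' T'] by (simp add: sum_negf abs_le_iff)
    qed
    ultimately show ?thesis by (simp add: dN sum_negf abs_le_iff)
  qed
  then have "cut_le V D \<delta>" by (simp add: cut_le_def)
  moreover have "\<delta> \<ge> 0" by (simp add: \<delta>_def b_def)
  ultimately have "refinement V A c c' \<delta>" using c' e unfolding refinement_def D_def by simp
  then show ?thesis by blast
qed

text \<open>Iterate \<open>refine_step\<close> from the trivial code 0. Codes are strings of base-4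
  digits, one digit per level, so coarser codes are recovered by \<open>div\<close>.\<close>

lemma ex_refining_codes:
  assumes V: "finite V" "V \<noteq> {}"
  obtains c :: "nat \<Rightarrow> 'v \<Rightarrow> nat" and \<delta> where
    "\<forall>m. refinement V A (c m) (c (Suc m)) (\<delta> m)" "\<forall>m x. c m x < 4 ^ m"
proof -
  have "\<forall>c. \<exists>c' \<delta>. refinement V A c c' \<delta>" using refine_step[OF V] by blast
  from choice[OF this] obtain nx where "\<forall>c. \<exists>\<delta>. refinement V A c (nx c) \<delta>" ..
  from choice[OF this] obtain dl where nx: "\<forall>c. refinement V A c (nx c) (dl c)" ..
  define c where "c m = (nx ^^ m) (\<lambda>_. 0)" for m
  have r: "\<forall>m. refinement V A (c m) (c (Suc m)) (dl (c m))" using nx by (simp add: c_def)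
  have lt: "c m x < 4 ^ m" for m x
  proof (induction m)
    case 0
    then show ?case by (simp add: c_def)
  next
    case (Suc m)
    have "c (Suc m) x div 4 = c m x" using r by (simp add: refinement_def)
    then have "c (Suc m) x div 4 < 4 ^ m" using Suc by simp
    then show ?case by (simp add: div_less_iff_less_mult mult.commute)
  qed
  show thesis by (rule that[of c, OF r]) (simp add: lt)
qed

section \<open>Counting under small cut discrepancy\<close>

lemma sum_maps_upd:
  fixes g :: "('i \<Rightarrow> 'v) \<Rightarrow> real"
  assumes "finite I" "finite V" "i \<in> I"
  shows "(\<Sum>f\<in>I \<rightarrow>\<^sub>E V. \<Sum>x\<in>V. g (f(i := x))) = real (card V) * (\<Sum>f\<in>I \<rightarrow>\<^sub>E V. g f)"
proof -
  \<comment> \<open>Swapping \<open>x\<close> with the value at \<open>i\<close> is an involution on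
    pairs that turns the updated map into the map itself.\<close>
  let ?s = "\<lambda>(f, x). (f(i := x), f i)"
  have upd: "f(i := x) \<in> I \<rightarrow>\<^sub>E V" if "f \<in> I \<rightarrow>\<^sub>E V" "x \<in> V" for f x
  proof -
    have "f(i := x) \<in> insert i I \<rightarrow>\<^sub>E V" by (rule PiE_fun_upd) (use that in simp_all)
    then show ?thesis using assms(3) by (simp add: insert_absorb)
  qed
  have mem: "f i \<in> V" if "f \<in> I \<rightarrow>\<^sub>E V" for f using PiE_mem[OF that assms(3)] .
  have "(\<Sum>f\<in>I \<rightarrow>\<^sub>E V. \<Sum>x\<in>V. g (f(i := x))) = (\<Sum>(f, x)\<in>(I \<rightarrow>\<^sub>E V) \<times> V. g (f(i := x)))"
    by (simp add: sum.cartesian_product)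
  also have "\<dots> = (\<Sum>(f, x)\<in>(I \<rightarrow>\<^sub>E V) \<times> V. g f)"
    by (rule sum.reindex_bij_witness[where i = ?s and j = ?s]) (use upd mem in \<open>auto simp: mem_Sigma_iff\<close>)
  also have "\<dots> = real (card V) * (\<Sum>f\<in>I \<rightarrow>\<^sub>E V. g f)"
    by (simp add: sum.cartesian_product[symmetric] sum_distrib_left)
  finally show ?thesis .
qed

text \<open>With all coordinates except \<open>i\<close> and \<open>j\<close> frozen, no factor of
  the product involves both. So it splits into a weight in \<open>x\<close> and a weight in
  \<open>y\<close>, to which the cut bound applies.\<close>

lemma pair_discrepancy:
  fixes D :: "'v \<Rightarrow> 'v \<Rightarrow> real" and K :: "'i \<times> 'i \<Rightarrow> 'v \<Rightarrow> 'v \<Rightarrow> real"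
  assumes V: "finite V" "V \<noteq> {}" and I: "finite I" "i \<in> I" "j \<in> I" "i \<noteq> j"
    and Q: "finite Q" "\<And>p. p \<in> Q \<Longrightarrow> \<not> ({i, j} \<subseteq> {fst p, snd p})"
    and K: "\<And>p x y. K p x y \<in> {0..1}"
    and D: "cut_le V D \<delta>"
  shows "\<bar>\<Sum>f\<in>I \<rightarrow>\<^sub>E V. D (f i) (f j) * (\<Prod>p\<in>Q. K p (f (fst p)) (f (snd p)))\<bar> \<le> \<delta> * real (card V) ^ card I"
proof -
  let ?N = "real (card V)"
  have N: "?N > 0" using V by (simp add: card_gt_0_iff)
  define R where "R Q f = (\<Prod>p\<in>Q. K p (f (fst p)) (f (snd p)))" for Q f
  have R01: "R Q' f \<in> {0..1}" for Q' f
  proof -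
    have "0 \<le> K p x y" "K p x y \<le> 1" for p x y using K[of p x y] by auto
    then show ?thesis unfolding R_def by (simp add: prod_nonneg prod_le_1)
  qed
  define g where "g f = D (f i) (f j) * R Q f" for f
  \<comment> \<open>Resampling the coordinates \<open>j\<close> and \<open>i\<close> frees them from
    \<open>f\<close>, at the cost of a factor \<open>?N\<close> each.\<close>
  have "?N * (?N * (\<Sum>f\<in>I \<rightarrow>\<^sub>E V. g f)) = ?N * (\<Sum>f\<in>I \<rightarrow>\<^sub>E V. \<Sum>y\<in>V. g (f(j := y)))"
    by (simp add: sum_maps_upd[OF I(1) V(1) I(3)])
  also have "\<dots> = (\<Sum>f\<in>I \<rightarrow>\<^sub>E V. \<Sum>x\<in>V. \<Sum>y\<in>V. g ((f(i := x))(j := y)))"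
    by (rule sum_maps_upd[OF I(1) V(1) I(2), symmetric])
  finally have eq: "?N\<^sup>2 * (\<Sum>f\<in>I \<rightarrow>\<^sub>E V. g f) = (\<Sum>f\<in>I \<rightarrow>\<^sub>E V. \<Sum>x\<in>V. \<Sum>y\<in>V. g ((f(i := x))(j := y)))"
    by (simp add: power2_eq_square mult.assoc)
  have "\<bar>\<Sum>x\<in>V. \<Sum>y\<in>V. g ((f(i := x))(j := y))\<bar> \<le> \<delta> * ?N\<^sup>2" for f
  proof -
    define Q1 where "Q1 = {p \<in> Q. i \<in> {fst p, snd p}}"
    define Q2 where "Q2 = {p \<in> Q. i \<notin> {fst p, snd p}}"
    have Q12: "Q = Q1 \<union> Q2" "Q1 \<inter> Q2 = {}" "finite Q1" "finite Q2" using Q(1) by (auto simp: Q1_def Q2_def)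
    have "g ((f(i := x))(j := y)) = R Q1 (f(i := x)) * R Q2 (f(j := y)) * D x y" for x y
    proof -
      have "R Q ((f(i := x))(j := y)) = R Q1 ((f(i := x))(j := y)) * R Q2 ((f(i := x))(j := y))"
        unfolding R_def Q12(1) by (rule prod.union_disjoint[OF Q12(3,4,2)])
      also have "R Q1 ((f(i := x))(j := y)) = R Q1 (f(i := x))"
        unfolding R_def
      proof (rule prod.cong[OF refl])
        fix p assume "p \<in> Q1"
        then have "fst p \<noteq> j" "snd p \<noteq> j" using Q(2)[of p] by (auto simp: Q1_def)
        then show "K p (((f(i := x))(j := y)) (fst p)) (((f(i := x))(j := y)) (snd p)) = K p ((f(i := x)) (fst p)) ((f(i := x)) (snd p))"
          by simp
      qed
      also have "R Q2 ((f(i := x))(j := y)) = R Q2 (f(j := y))"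
        unfolding R_def
      proof (rule prod.cong[OF refl])
        fix p assume "p \<in> Q2"
        then have "fst p \<noteq> i" "snd p \<noteq> i" by (auto simp: Q2_def)
        then show "K p (((f(i := x))(j := y)) (fst p)) (((f(i := x))(j := y)) (snd p)) = K p ((f(j := y)) (fst p)) ((f(j := y)) (snd p))"
          by simp
      qed
      finally have RQ: "R Q ((f(i := x))(j := y)) = R Q1 (f(i := x)) * R Q2 (f(j := y))" .
      have "((f(i := x))(j := y)) i = x" "((f(i := x))(j := y)) j = y" using I(4) by simp_all
      then show ?thesis unfolding g_def RQ by (simp only: mult_ac)
    qed
    then show ?thesis
      using D[unfolded cut_le_def, rule_format, of "\<lambda>x. R Q1 (f(i := x))" "\<lambda>y. R Q2 (f(j := y))"] R01 by simp
  qed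
  then have "\<bar>\<Sum>f\<in>I \<rightarrow>\<^sub>E V. \<Sum>x\<in>V. \<Sum>y\<in>V. g ((f(i := x))(j := y))\<bar> \<le> (\<Sum>f\<in>I \<rightarrow>\<^sub>E V. \<delta> * ?N\<^sup>2)"
    by (rule order_trans[OF sum_abs sum_mono])
  also have "\<dots> = ?N\<^sup>2 * (\<delta> * ?N ^ card I)" using I(1) by (simp add: card_PiE)
  finally have "?N\<^sup>2 * \<bar>\<Sum>f\<in>I \<rightarrow>\<^sub>E V. g f\<bar> \<le> ?N\<^sup>2 * (\<delta> * ?N ^ card I)"
    unfolding eq[symmetric] by (simp add: abs_mult)
  then have "\<bar>\<Sum>f\<in>I \<rightarrow>\<^sub>E V. g f\<bar> \<le> \<delta> * ?N ^ card I"
    by (rule mult_left_le_imp_le) (use N in simp)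
  then show ?thesis by (simp add: g_def R_def)
qed

text \<open>Telescoping over the edges of \<open>F\<close>: exchanging the kernel on one edge leaves
  factors in [0,1] on the other edges and costs at most \<open>\<delta>\<close>.\<close>

lemma map_density_diff:
  fixes A B :: "'v \<Rightarrow> 'v \<Rightarrow> real"
  assumes V: "finite V" "V \<noteq> {}" and A: "\<And>x y. A x y \<in> {0..1}" and B: "\<And>x y. B x y \<in> {0..1}"
    and D: "cut_le V (\<lambda>x y. A x y - B x y) \<delta>"
  shows "\<bar>map_density V (verts F) (epairs F) A - map_density V (verts F) (epairs F) B\<bar> \<le> real (card (epairs F)) * \<delta>"
proof -
  let ?N = "real (card V)" and ?m = "card (verts F)" and ?E = "epairs F" and ?I = "verts F"
  have N: "?N > 0" using V by (simp add: card_gt_0_iff)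
  define K where "K S p = (if p \<in> S then A else B)" for S :: "(nat \<times> nat) set" and p
  have K01: "K S p x y \<in> {0..1}" for S p x y unfolding K_def using A B by simp
  define \<Psi> where "\<Psi> S = (\<Sum>f\<in>?I \<rightarrow>\<^sub>E V. \<Prod>p\<in>?E. K S p (f (fst p)) (f (snd p)))" for S
  have "\<bar>\<Psi> S - \<Psi> {}\<bar> \<le> real (card S) * \<delta> * ?N ^ ?m" if "S \<subseteq> ?E" for S
  proof -
    have "finite S" using that by (rule finite_subset) simp
    then show ?thesis using that
    proof (induction S)
      case (insert e S)
      have e: "e \<in> ?E" "e \<notin> S" using insert by auto
      let ?i = "fst e" and ?j = "snd e"
      have ij: "?i \<in> ?I" "?j \<in> ?I" "?i \<noteq> ?j" using epairsD[of ?i ?j F] e(1) by simp_all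
      have "\<Psi> (insert e S) - \<Psi> S = (\<Sum>f\<in>?I \<rightarrow>\<^sub>E V. (A (f ?i) (f ?j) - B (f ?i) (f ?j)) *
          (\<Prod>p\<in>?E - {e}. K S p (f (fst p)) (f (snd p))))"
      proof -
        have "(\<Prod>p\<in>?E. K (insert e S) p (f (fst p)) (f (snd p))) =
            A (f ?i) (f ?j) * (\<Prod>p\<in>?E - {e}. K S p (f (fst p)) (f (snd p)))" for f
        proof -
          have "(\<Prod>p\<in>?E. K (insert e S) p (f (fst p)) (f (snd p))) =
            K (insert e S) e (f ?i) (f ?j) * (\<Prod>p\<in>?E - {e}. K (insert e S) p (f (fst p)) (f (snd p)))"
            by (rule prod.remove[OF finite_epairs e(1)])
          also have "(\<Prod>p\<in>?E - {e}. K (insert e S) p (f (fst p)) (f (snd p))) = (\<Prod>p\<in>?E - {e}. K S p (f (fst p)) (f (snd p)))"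
            by (rule prod.cong) (auto simp: K_def)
          finally show ?thesis by (simp add: K_def)
        qed
        moreover have "(\<Prod>p\<in>?E. K S p (f (fst p)) (f (snd p))) =
            B (f ?i) (f ?j) * (\<Prod>p\<in>?E - {e}. K S p (f (fst p)) (f (snd p)))" for f
          using prod.remove[OF finite_epairs e(1), of "\<lambda>p. K S p (f (fst p)) (f (snd p))"] e(2) by (simp add: K_def)
        ultimately show ?thesis by (simp add: \<Psi>_def sum_subtractf left_diff_distrib)
      qed
      also have "\<bar>\<dots>\<bar> \<le> \<delta> * ?N ^ ?m"
      proof (rule pair_discrepancy[OF V finite_verts ij])
        fix p assume p: "p \<in> ?E - {e}"
        have lt: "fst p < snd p" "?i < ?j" using p e(1) by (auto simp: epairs_def vpairs_def)
        have "p \<noteq> e" using p by simp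
        then show "\<not> {?i, ?j} \<subseteq> {fst p, snd p}" using lt by (auto simp: prod_eq_iff)
      qed (use K01 D in simp_all)
      finally have "\<bar>\<Psi> (insert e S) - \<Psi> S\<bar> \<le> \<delta> * ?N ^ ?m" .
      moreover have "\<bar>\<Psi> S - \<Psi> {}\<bar> \<le> real (card S) * \<delta> * ?N ^ ?m" using insert by simp
      ultimately have "\<bar>\<Psi> (insert e S) - \<Psi> {}\<bar> \<le> \<delta> * ?N ^ ?m + real (card S) * \<delta> * ?N ^ ?m" by linarith
      then show ?case using insert by (simp add: algebra_simps)
    qed simp
  qed
  from this[of ?E] have "\<bar>\<Psi> ?E - \<Psi> {}\<bar> / ?N ^ ?m \<le> real (card ?E) * \<delta>"
    using N by (simp add: pos_divide_le_eq)
  moreover have "\<Psi> ?E / ?N ^ ?m = map_density V ?I ?E A" "\<Psi> {} / ?N ^ ?m = map_density V ?I ?E B"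
    by (simp_all add: \<Psi>_def map_density_def K_def case_prod_unfold cong: prod.cong)
  moreover have "\<bar>\<Psi> ?E - \<Psi> {}\<bar> / ?N ^ ?m = \<bar>\<Psi> ?E / ?N ^ ?m - \<Psi> {} / ?N ^ ?m\<bar>"
    using N by (simp add: diff_divide_distrib[symmetric] abs_divide)
  ultimately show ?thesis by simp
qed

section \<open>Block averages encoded as step graphons\<close>

definition part_mass :: "'v set \<Rightarrow> ('v \<Rightarrow> nat) \<Rightarrow> nat \<Rightarrow> real" where
  "part_mass V c a = real (card {x \<in> V. c x = a}) / real (card V)"

text \<open>Group the maps by the codes of their values: the fibre over \<open>\<phi>\<close> is a
  product of parts, and the summand is constant on it.\<close>

lemma sum_maps_by_parts:
  fixes H :: "('i \<Rightarrow> nat) \<Rightarrow> real"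
  assumes V: "finite V" "V \<noteq> {}" and I: "finite I" and c: "\<And>x. x \<in> V \<Longrightarrow> c x < K"
  shows "(\<Sum>f\<in>I \<rightarrow>\<^sub>E V. H (\<lambda>i\<in>I. c (f i))) / real (card V) ^ card I =
    (\<Sum>\<phi>\<in>I \<rightarrow>\<^sub>E {..<K}. (\<Prod>i\<in>I. part_mass V c (\<phi> i)) * H \<phi>)"
proof -
  have fin: "finite (I \<rightarrow>\<^sub>E V)" "finite (I \<rightarrow>\<^sub>E {..<K})" using V I by (auto intro: finite_PiE)
  let ?r = "\<lambda>f. \<lambda>i\<in>I. c (f i)"
  have fib: "{f \<in> I \<rightarrow>\<^sub>E V. ?r f = \<phi>} = (\<Pi>\<^sub>E i\<in>I. {x \<in> V. c x = \<phi> i})" if \<phi>: "\<phi> \<in> I \<rightarrow>\<^sub>E {..<K}" for \<phi>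
  proof (intro set_eqI iffI)
    fix f assume f: "f \<in> {f \<in> I \<rightarrow>\<^sub>E V. ?r f = \<phi>}"
    have "c (f i) = \<phi> i" if "i \<in> I" for i
      using f that by (metis (mono_tags, lifting) mem_Collect_eq restrict_apply')
    then show "f \<in> (\<Pi>\<^sub>E i\<in>I. {x \<in> V. c x = \<phi> i})" using f by (simp add: PiE_iff)
  next
    fix f assume f: "f \<in> (\<Pi>\<^sub>E i\<in>I. {x \<in> V. c x = \<phi> i})"
    have "?r f = \<phi>"
    proof (rule ext)
      fix i show "?r f i = \<phi> i"
        using f PiE_arb[OF \<phi>, of i] by (cases "i \<in> I") (simp_all add: PiE_iff)
    qed
    then show "f \<in> {f \<in> I \<rightarrow>\<^sub>E V. ?r f = \<phi>}" using f by (simp add: PiE_iff)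
  qed
  have "(\<Sum>f\<in>I \<rightarrow>\<^sub>E V. H (?r f)) = (\<Sum>\<phi>\<in>I \<rightarrow>\<^sub>E {..<K}. \<Sum>f\<in>{f \<in> I \<rightarrow>\<^sub>E V. ?r f = \<phi>}. H (?r f))"
  proof (rule sum.group[symmetric, OF fin])
    show "?r ` (I \<rightarrow>\<^sub>E V) \<subseteq> I \<rightarrow>\<^sub>E {..<K}" using c by (auto simp: PiE_iff)
  qed
  also have "\<dots> = (\<Sum>\<phi>\<in>I \<rightarrow>\<^sub>E {..<K}. (\<Prod>i\<in>I. real (card {x \<in> V. c x = \<phi> i})) * H \<phi>)"
  proof (rule sum.cong[OF refl])
    fix \<phi> assume \<phi>: "\<phi> \<in> I \<rightarrow>\<^sub>E {..<K}"
    have "(\<Sum>f\<in>{f \<in> I \<rightarrow>\<^sub>E V. ?r f = \<phi>}. H (?r f)) = (\<Sum>f\<in>{f \<in> I \<rightarrow>\<^sub>E V. ?r f = \<phi>}. H \<phi>)"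
      by (rule sum.cong) auto
    also have "\<dots> = (\<Prod>i\<in>I. real (card {x \<in> V. c x = \<phi> i})) * H \<phi>"
      by (simp add: fib[OF \<phi>] card_PiE[OF I])
    finally show "(\<Sum>f\<in>{f \<in> I \<rightarrow>\<^sub>E V. ?r f = \<phi>}. H (?r f)) = (\<Prod>i\<in>I. real (card {x \<in> V. c x = \<phi> i})) * H \<phi>" .
  qed
  finally show ?thesis
    by (simp add: part_mass_def prod_dividef sum_divide_distrib)
qed

lemma sum_pairs_by_parts:
  fixes h :: "nat \<Rightarrow> nat \<Rightarrow> real"
  assumes V: "finite V" "V \<noteq> {}" and c: "\<And>x. x \<in> V \<Longrightarrow> c x < K"
  shows "(\<Sum>x\<in>V. \<Sum>y\<in>V. h (c x) (c y)) / (real (card V))\<^sup>2 =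
    (\<Sum>a<K. \<Sum>b<K. part_mass V c a * part_mass V c b * h a b)"
proof -
  have one: "(\<Sum>x\<in>V. k (c x)) = (\<Sum>a<K. real (card {x \<in> V. c x = a}) * k a)" for k :: "nat \<Rightarrow> real"
  proof -
    have "(\<Sum>x\<in>V. k (c x)) = (\<Sum>a<K. \<Sum>x\<in>{x \<in> V. c x = a}. k (c x))"
      by (rule sum.group[symmetric]) (use V c in auto)
    also have "\<dots> = (\<Sum>a<K. \<Sum>x\<in>{x \<in> V. c x = a}. k a)" by (intro sum.cong) auto
    finally show ?thesis by simp
  qed
  have "(\<Sum>x\<in>V. \<Sum>y\<in>V. h (c x) (c y)) = (\<Sum>a<K. real (card {x \<in> V. c x = a}) * (\<Sum>b<K. real (card {x \<in> V. c x = b}) * h a b))"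
    by (subst one) (subst one, rule refl)
  then show ?thesis
    by (simp add: part_mass_def sum_divide_distrib sum_distrib_left power2_eq_square mult.assoc)
qed

lemma part_mass_refine:
  assumes V: "finite V" and c: "\<And>x. c' x div 4 = c x"
  shows "part_mass V c a = (\<Sum>j<4. part_mass V c' (4 * a + j))"
proof -
  have "{x \<in> V. c x = a} = (\<Union>j\<in>{..<4}. {x \<in> V. c' x = 4 * a + j})"
  proof (intro set_eqI iffI)
    fix x assume x: "x \<in> {x \<in> V. c x = a}"
    then have "c' x = 4 * a + c' x mod 4" using c[of x] mult_div_mod_eq[of 4 "c' x"] by simp
    moreover have "c' x mod 4 \<in> {..<4}" by simp
    ultimately show "x \<in> (\<Union>j\<in>{..<4}. {x \<in> V. c' x = 4 * a + j})" using x by blast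
  next
    fix x assume "x \<in> (\<Union>j\<in>{..<4}. {x \<in> V. c' x = 4 * a + j})"
    then obtain j where "j < 4" "x \<in> V" "c' x = 4 * a + j" by blast
    then show "x \<in> {x \<in> V. c x = a}" using c[of x] by simp
  qed
  then have "card {x \<in> V. c x = a} = (\<Sum>j<4. card {x \<in> V. c' x = 4 * a + j})"
    using V by (simp only:) (rule card_UN_disjoint, auto)
  then show ?thesis by (simp add: part_mass_def sum_divide_distrib)
qed

lemma codes_div:
  assumes "\<And>m x. c (Suc m) x div 4 = (c m x :: nat)"
  shows "c (m + k) x div 4 ^ k = c m x"
  by (induction k) (simp_all add: assms div_mult2_eq)

definition step_density :: "sgraph \<Rightarrow> nat \<Rightarrow> (nat \<Rightarrow> real) \<Rightarrow> (nat \<Rightarrow> nat \<Rightarrow> real) \<Rightarrow> real" where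
  "step_density F K \<mu> u = (\<Sum>\<phi>\<in>verts F \<rightarrow>\<^sub>E {..<K}. (\<Prod>i\<in>verts F. \<mu> (\<phi> i)) * (\<Prod>(i, j)\<in>epairs F. u (\<phi> i) (\<phi> j)))"

text \<open>\<open>\<mu> m\<close> and \<open>u m\<close> describe a step graphon with \<open>4 ^ m\<close> steps: the step masses and the values
  on pairs of steps. Step \<open>a\<close> at level \<open>m\<close> is split into \<open>4 * a, \<dots>, 4 * a + 3\<close> at the next level.\<close>

definition step_graphons ::
    "(sgraph \<Rightarrow> real) \<Rightarrow> (nat \<Rightarrow> nat \<Rightarrow> real) \<Rightarrow> (nat \<Rightarrow> nat \<Rightarrow> nat \<Rightarrow> real) \<Rightarrow> (nat \<Rightarrow> real) \<Rightarrow> (nat \<Rightarrow> real) \<Rightarrow> bool" where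
  "step_graphons \<gamma> \<mu> u q \<delta> \<longleftrightarrow>
    (\<forall>m a. 0 \<le> \<mu> m a) \<and> (\<forall>m. (\<Sum>a<4 ^ m. \<mu> m a) = 1) \<and>
    (\<forall>m a. \<mu> m a = (\<Sum>j<4. \<mu> (Suc m) (4 * a + j))) \<and>
    (\<forall>m a b. u m a b \<in> {0..1} \<and> u m a b = u m b a) \<and>
    (\<forall>m k. (\<Sum>a<4 ^ (m + k). \<Sum>b<4 ^ (m + k). \<mu> (m + k) a * \<mu> (m + k) b *
       (u (m + k) a b - u m (a div 4 ^ k) (b div 4 ^ k))\<^sup>2) = q (m + k) - q m) \<and>
    (\<forall>m. 0 \<le> \<delta> m \<and> (\<delta> m)\<^sup>2 \<le> q (Suc m) - q m \<and> q m \<in> {0..1}) \<and>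
    (\<forall>F m. \<bar>\<gamma> F - step_density F (4 ^ m) (\<mu> m) (u m)\<bar> \<le> real (card (epairs F)) * \<delta> m)"

text \<open>The refinement data of one graph, rewritten so that its vertex set disappears. Data of
  different graphs thus live in one space, where limits can be taken.\<close>

lemma finite_step_graphons:
  "\<exists>\<mu> u q \<delta>. step_graphons (\<lambda>F. hom_density F G) \<mu> u q \<delta>"
proof -
  let ?V = "verts G" and ?A = "adj G"
  obtain c \<delta> where r: "\<forall>m. refinement ?V ?A (c m) (c (Suc m)) (\<delta> m)" and lt0: "\<forall>m x. c m x < 4 ^ m"
    by (rule ex_refining_codes[OF finite_verts verts_nonempty])
  have lt: "c m x < 4 ^ m" and div: "c (Suc m) x div 4 = c m x" and d0: "0 \<le> \<delta> m"
    and dq: "(\<delta> m)\<^sup>2 \<le> energy ?V ?A (c (Suc m)) - energy ?V ?A (c m)"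
    and cut: "cut_le ?V (\<lambda>x y. ?A x y - part_avg ?V ?A (c m) (c m x) (c m y)) (\<delta> m)" for m x
    using r lt0 by (simp_all add: refinement_def)
  have V: "finite ?V" "?V \<noteq> {}" by simp_all
  define \<mu> where "\<mu> m = part_mass ?V (c m)" for m
  define u where "u m = part_avg ?V ?A (c m)" for m
  have u01: "u m a b \<in> {0..1}" for m a b unfolding u_def by (rule part_avg_bounds) (rule adj_bounds)
  have N: "real (card ?V) > 0" using card_verts_pos by simp
  have 1: "(\<Sum>a<4 ^ m. \<mu> m a) = 1" for m
  proof -
    have "(\<Sum>a<4 ^ m. \<Sum>x\<in>{x \<in> ?V. c m x = a}. 1::real) = (\<Sum>x\<in>?V. 1)"
      by (rule sum.group) (use lt in auto)
    then show ?thesis using N by (simp add: \<mu>_def part_mass_def sum_divide_distrib[symmetric])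
  qed
  have 2: "(\<Sum>a<4 ^ (m + k). \<Sum>b<4 ^ (m + k). \<mu> (m + k) a * \<mu> (m + k) b *
       (u (m + k) a b - u m (a div 4 ^ k) (b div 4 ^ k))\<^sup>2) = energy ?V ?A (c (m + k)) - energy ?V ?A (c m)" for m k
  proof -
    have cd: "c m x = c (m + k) x div 4 ^ k" for x by (rule codes_div[of c, OF div, symmetric])
    have "energy ?V ?A (c (m + k)) - energy ?V ?A (c m) =
      (\<Sum>x\<in>?V. \<Sum>y\<in>?V. (u (m + k) (c (m + k) x) (c (m + k) y) - u m (c (m + k) x div 4 ^ k) (c (m + k) y div 4 ^ k))\<^sup>2) / (real (card ?V))\<^sup>2"
      unfolding u_def cd[symmetric] by (rule energy_refine[OF V(1) cd, symmetric])
    also have "\<dots> = (\<Sum>a<4 ^ (m + k). \<Sum>b<4 ^ (m + k). \<mu> (m + k) a * \<mu> (m + k) b *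
       (u (m + k) a b - u m (a div 4 ^ k) (b div 4 ^ k))\<^sup>2)"
      unfolding \<mu>_def by (rule sum_pairs_by_parts[OF V lt])
    finally show ?thesis by simp
  qed
  have 3: "\<bar>hom_density F G - step_density F (4 ^ m) (\<mu> m) (u m)\<bar> \<le> real (card (epairs F)) * \<delta> m" for F m
  proof -
    have "map_density ?V (verts F) (epairs F) (\<lambda>x y. u m (c m x) (c m y)) =
        step_density F (4 ^ m) (\<mu> m) (u m)"
    proof -
      have "(\<Prod>(i, j)\<in>epairs F. u m (c m (f i)) (c m (f j))) =
          (\<Prod>(i, j)\<in>epairs F. u m ((\<lambda>i\<in>verts F. c m (f i)) i) ((\<lambda>i\<in>verts F. c m (f i)) j))" for f
        by (rule prod.cong) (auto dest: epairsD)
      then show ?thesis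
        unfolding map_density_def step_density_def \<mu>_def
        using sum_maps_by_parts[OF V finite_verts lt, where H = "\<lambda>\<phi>. \<Prod>(i, j)\<in>epairs F. u m (\<phi> i) (\<phi> j)"] by simp
    qed
    moreover have "\<bar>map_density ?V (verts F) (epairs F) ?A - map_density ?V (verts F) (epairs F) (\<lambda>x y. u m (c m x) (c m y))\<bar>
        \<le> real (card (epairs F)) * \<delta> m"
      by (rule map_density_diff[OF V adj_bounds(1) u01]) (use cut[of m] in \<open>simp add: u_def\<close>)
    ultimately show ?thesis by (simp add: hom_density_eq)
  qed
  have "step_graphons (\<lambda>F. hom_density F G) \<mu> u (\<lambda>m. energy ?V ?A (c m)) \<delta>"
    unfolding step_graphons_def
  proof (intro conjI allI)
    show "0 \<le> \<mu> m a" for m a by (simp add: \<mu>_def part_mass_def)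
    show "\<mu> m a = (\<Sum>j<4. \<mu> (Suc m) (4 * a + j))" for m a
      unfolding \<mu>_def by (rule part_mass_refine[OF V(1) div])
    show "u m a b = u m b a" for m a b unfolding u_def by (rule part_avg_sym) (rule adj_sym)
    show "energy ?V ?A (c m) \<in> {0..1}" for m by (rule energy_bounds[OF V(1) adj_bounds(1)])
  qed (rule 1 2 3 u01 d0 dq)+
  then show ?thesis by blast
qed

text \<open>Each instance of a clause of \<open>step_graphons\<close> is a closed condition on
  finitely many bounded numbers, and one ultrafilter makes all of these converge at once. As it
  refines \<open>sequentially\<close>, the densities of \<open>G n\<close> still tend to
  \<open>\<gamma>\<close>.\<close>

lemma limit_step_graphons:
  assumes G: "densities_converge G \<gamma>"
  shows "\<exists>\<mu> u q \<delta>. step_graphons \<gamma> \<mu> u q \<delta>"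
proof -
  obtain U where U: "U \<le> sequentially" "ultrafilter U"
    using ultrafilter_below[OF sequentially_bot] by blast
  have Ub: "U \<noteq> bot" using U(2) by (simp add: ultrafilter_def)
  have "\<forall>n. \<exists>\<mu> u q \<delta>. step_graphons (\<lambda>F. hom_density F (G n)) \<mu> u q \<delta>"
    using finite_step_graphons by blast
  then obtain M where "\<forall>n. \<exists>u q \<delta>. step_graphons (\<lambda>F. hom_density F (G n)) (M n) u q \<delta>" using choice by metis
  from choice[OF this] obtain u' where "\<forall>n. \<exists>q \<delta>. step_graphons (\<lambda>F. hom_density F (G n)) (M n) (u' n) q \<delta>" ..
  from choice[OF this] obtain q' where "\<forall>n. \<exists>\<delta>. step_graphons (\<lambda>F. hom_density F (G n)) (M n) (u' n) (q' n) \<delta>" ..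
  from choice[OF this] obtain d' where S: "\<forall>n. step_graphons (\<lambda>F. hom_density F (G n)) (M n) (u' n) (q' n) (d' n)" ..
  note S' = S[unfolded step_graphons_def]
  have M0: "0 \<le> M n m a" and M1: "(\<Sum>a<4 ^ m. M n m a) = 1" and Mr: "M n m a = (\<Sum>j<4. M n (Suc m) (4 * a + j))"
    and u01: "u' n m a b \<in> {0..1}" and us: "u' n m a b = u' n m b a"
    and en: "(\<Sum>a<4 ^ (m + k). \<Sum>b<4 ^ (m + k). M n (m + k) a * M n (m + k) b *
       (u' n (m + k) a b - u' n m (a div 4 ^ k) (b div 4 ^ k))\<^sup>2) = q' n (m + k) - q' n m"
    and d0: "0 \<le> d' n m" and dq: "(d' n m)\<^sup>2 \<le> q' n (Suc m) - q' n m" and q01: "q' n m \<in> {0..1}"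
    and dens: "\<bar>hom_density F (G n) - step_density F (4 ^ m) (M n m) (u' n m)\<bar> \<le> real (card (epairs F)) * d' n m" for n m a b k F
    using S' by (blast+)
  have M01: "M n m a \<in> {0..1}" if "a < 4 ^ m" for n m a
  proof -
    have "M n m a \<le> (\<Sum>a<4 ^ m. M n m a)" by (rule member_le_sum) (use that M0 in auto)
    then show ?thesis using M1 M0 by simp
  qed
  have d01: "d' n m \<in> {0..1}" for n m
  proof -
    have "(d' n m)\<^sup>2 \<le> 1\<^sup>2" using dq[of n m] q01[of n m] q01[of n "Suc m"] by auto
    then have "d' n m \<le> 1" by (rule power2_le_imp_le) simp
    then show ?thesis using d0 by simp
  qed
  \<comment> \<open>The clauses bound the masses only for labels below \<open>4 ^ m\<close>; the
    value 0 beyond keeps nonnegativity and the splitting identity.\<close>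
  define \<mu> where "\<mu> m a = (if a < 4 ^ m then Lim U (\<lambda>n. M n m a) else 0)" for m a
  define u where "u m a b = Lim U (\<lambda>n. u' n m a b)" for m a b
  define q where "q m = Lim U (\<lambda>n. q' n m)" for m
  define \<delta> where "\<delta> m = Lim U (\<lambda>n. d' n m)" for m
  note lims = ultrafilter_Lim[OF U(2) always_eventually, OF allI]
  have L\<mu>: "((\<lambda>n. M n m a) \<longlongrightarrow> \<mu> m a) U" "\<mu> m a \<in> {0..1}" if "a < 4 ^ m" for m a
    unfolding \<mu>_def if_P[OF that] by (rule lims[OF M01[OF that]])+
  have Lu: "((\<lambda>n. u' n m a b) \<longlongrightarrow> u m a b) U" "u m a b \<in> {0..1}" for m a b
    unfolding u_def by (rule lims[OF u01])+
  have Lq: "((\<lambda>n. q' n m) \<longlongrightarrow> q m) U" "q m \<in> {0..1}" for m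
    unfolding q_def by (rule lims[OF q01])+
  have L\<delta>: "((\<lambda>n. d' n m) \<longlongrightarrow> \<delta> m) U" "\<delta> m \<in> {0..1}" for m
    unfolding \<delta>_def by (rule lims[OF d01])+
  have "step_graphons \<gamma> \<mu> u q \<delta>"
    unfolding step_graphons_def
  proof (intro conjI allI)
    show "0 \<le> \<mu> m a" for m a using L\<mu>(2)[of a m] by (cases "a < 4 ^ m") (auto simp: \<mu>_def)
    show "(\<Sum>a<4 ^ m. \<mu> m a) = 1" for m
    proof (rule tendsto_unique[OF Ub])
      show "((\<lambda>n. \<Sum>a<4 ^ m. M n m a) \<longlongrightarrow> (\<Sum>a<4 ^ m. \<mu> m a)) U" by (intro tendsto_sum L\<mu>) simp
      show "((\<lambda>n. \<Sum>a<4 ^ m. M n m a) \<longlongrightarrow> 1) U" by (simp add: M1)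
    qed
    show "\<mu> m a = (\<Sum>j<4. \<mu> (Suc m) (4 * a + j))" for m a
    proof (cases "a < 4 ^ m")
      case True
      then have lt: "4 * a + j < 4 ^ Suc m" if "j < 4" for j using that by simp
      show ?thesis
      proof (rule tendsto_unique[OF Ub L\<mu>(1)[OF True]])
        show "((\<lambda>n. M n m a) \<longlongrightarrow> (\<Sum>j<4. \<mu> (Suc m) (4 * a + j))) U"
          unfolding Mr[of _ m a] by (intro tendsto_sum L\<mu>(1) lt) simp
      qed
    next
      case False
      then have "\<not> 4 * a + j < 4 ^ Suc m" for j by simp
      then show ?thesis using False unfolding \<mu>_def by simp
    qed
    show "u m a b \<in> {0..1}" for m a b by (rule Lu)
    show "u m a b = u m b a" for m a b unfolding u_def by (simp only: us[of _ m a b])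
    show "(\<Sum>a<4 ^ (m + k). \<Sum>b<4 ^ (m + k). \<mu> (m + k) a * \<mu> (m + k) b *
       (u (m + k) a b - u m (a div 4 ^ k) (b div 4 ^ k))\<^sup>2) = q (m + k) - q m" for m k
    proof (rule tendsto_unique[OF Ub])
      show "((\<lambda>n. \<Sum>a<4 ^ (m + k). \<Sum>b<4 ^ (m + k). M n (m + k) a * M n (m + k) b *
       (u' n (m + k) a b - u' n m (a div 4 ^ k) (b div 4 ^ k))\<^sup>2) \<longlongrightarrow>
        (\<Sum>a<4 ^ (m + k). \<Sum>b<4 ^ (m + k). \<mu> (m + k) a * \<mu> (m + k) b *
       (u (m + k) a b - u m (a div 4 ^ k) (b div 4 ^ k))\<^sup>2)) U"
        by (intro tendsto_sum tendsto_mult tendsto_power tendsto_diff L\<mu>(1) Lu(1)) simp_all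
      show "((\<lambda>n. \<Sum>a<4 ^ (m + k). \<Sum>b<4 ^ (m + k). M n (m + k) a * M n (m + k) b *
       (u' n (m + k) a b - u' n m (a div 4 ^ k) (b div 4 ^ k))\<^sup>2) \<longlongrightarrow> q (m + k) - q m) U"
        unfolding en by (intro tendsto_diff Lq)
    qed
    show "0 \<le> \<delta> m" for m using L\<delta>(2)[of m] by simp
    show "(\<delta> m)\<^sup>2 \<le> q (Suc m) - q m" for m
    proof (rule tendsto_le[OF Ub])
      show "((\<lambda>n. q' n (Suc m) - q' n m) \<longlongrightarrow> q (Suc m) - q m) U" by (intro tendsto_diff Lq)
      show "((\<lambda>n. (d' n m)\<^sup>2) \<longlongrightarrow> (\<delta> m)\<^sup>2) U" by (intro tendsto_power L\<delta>)
      show "eventually (\<lambda>n. (d' n m)\<^sup>2 \<le> q' n (Suc m) - q' n m) U" by (simp add: dq)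
    qed
    show "q m \<in> {0..1}" for m by (rule Lq)
    show "\<bar>\<gamma> F - step_density F (4 ^ m) (\<mu> m) (u m)\<bar> \<le> real (card (epairs F)) * \<delta> m" for F m
    proof (rule tendsto_le[OF Ub])
      show "((\<lambda>n. real (card (epairs F)) * d' n m) \<longlongrightarrow> real (card (epairs F)) * \<delta> m) U"
        by (intro tendsto_mult tendsto_const L\<delta>)
      have "(\<lambda>n. hom_density F (G n)) \<longlonglongrightarrow> \<gamma> F" using G by (simp add: densities_converge_def)
      then have hd: "((\<lambda>n. hom_density F (G n)) \<longlongrightarrow> \<gamma> F) U" by (rule tendsto_mono[OF U(1)])
      have "((\<lambda>n. \<Prod>i\<in>verts F. M n m (\<phi> i)) \<longlongrightarrow> (\<Prod>i\<in>verts F. \<mu> m (\<phi> i))) U"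
        if "\<phi> \<in> verts F \<rightarrow>\<^sub>E {..<4 ^ m}" for \<phi>
        using PiE_mem[OF that] by (intro tendsto_prod L\<mu>(1)) simp
      moreover have "((\<lambda>n. \<Prod>(i, j)\<in>epairs F. u' n m (\<phi> i) (\<phi> j)) \<longlongrightarrow> (\<Prod>(i, j)\<in>epairs F. u m (\<phi> i) (\<phi> j))) U" for \<phi>
        unfolding case_prod_unfold by (intro tendsto_prod Lu(1))
      ultimately show "((\<lambda>n. \<bar>hom_density F (G n) - step_density F (4 ^ m) (M n m) (u' n m)\<bar>) \<longlongrightarrow>
         \<bar>\<gamma> F - step_density F (4 ^ m) (\<mu> m) (u m)\<bar>) U"
        unfolding step_density_def by (intro tendsto_rabs tendsto_diff hd tendsto_sum tendsto_mult)
      show "eventually (\<lambda>n. \<bar>hom_density F (G n) - step_density F (4 ^ m) (M n m) (u' n m)\<bar> \<le> real (card (epairs F)) * d' n m) U"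
        by (rule always_eventually) (use dens in blast)
    qed
  qed
  then show ?thesis by blast
qed

section \<open>Existence of a representing graphon\<close>

text \<open>Step \<open>c\<close> of level \<open>m\<close> occupies the half-open interval from
  \<open>step_end \<mu> m c\<close> to \<open>step_end \<mu> m (Suc c)\<close>.\<close>

definition step_end :: "(nat \<Rightarrow> nat \<Rightarrow> real) \<Rightarrow> nat \<Rightarrow> nat \<Rightarrow> real" where
  "step_end \<mu> m c = (\<Sum>a<c. \<mu> m a)"

text \<open>The second disjunct caps the label at \<open>4 ^ m - 1\<close>, so that it exists also
  at \<open>x = 1\<close>, which no half-open step contains.\<close>

definition step_label :: "(nat \<Rightarrow> nat \<Rightarrow> real) \<Rightarrow> nat \<Rightarrow> real \<Rightarrow> nat" where
  "step_label \<mu> m x = (LEAST c. x < step_end \<mu> m (Suc c) \<or> 4 ^ m \<le> Suc c)"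

definition step_graphon :: "(nat \<Rightarrow> nat \<Rightarrow> real) \<Rightarrow> (nat \<Rightarrow> nat \<Rightarrow> nat \<Rightarrow> real) \<Rightarrow> nat \<Rightarrow> real \<Rightarrow> real \<Rightarrow> real" where
  "step_graphon \<mu> u m x y = u m (step_label \<mu> m x) (step_label \<mu> m y)"

locale step_graphon_sequence =
  fixes \<gamma> \<mu> u q \<delta>
  assumes steps: "step_graphons \<gamma> \<mu> u q \<delta>"
begin

lemma mass: "0 \<le> \<mu> m a" "(\<Sum>a<4 ^ m. \<mu> m a) = 1" "\<mu> m a = (\<Sum>j<4. \<mu> (Suc m) (4 * a + j))"
  and step_value: "u m a b \<in> {0..1}" "u m a b = u m b a"
  and energy_eq: "(\<Sum>a<4 ^ (m + k). \<Sum>b<4 ^ (m + k). \<mu> (m + k) a * \<mu> (m + k) b *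
       (u (m + k) a b - u m (a div 4 ^ k) (b div 4 ^ k))\<^sup>2) = q (m + k) - q m"
  and discr: "0 \<le> \<delta> m" "(\<delta> m)\<^sup>2 \<le> q (Suc m) - q m" "q m \<in> {0..1}"
  and density: "\<bar>\<gamma> F - step_density F (4 ^ m) (\<mu> m) (u m)\<bar> \<le> real (card (epairs F)) * \<delta> m"
  using steps unfolding step_graphons_def by blast+

abbreviation "lab \<equiv> step_label \<mu>"
abbreviation "e \<equiv> step_end \<mu>"
abbreviation "U \<equiv> step_graphon \<mu> u"

lemma e_mono: "a \<le> b \<Longrightarrow> e m a \<le> e m b"
  unfolding step_end_def by (rule sum_mono2) (use mass(1) in auto)

text \<open>A step has the total mass of its four children, which are numbered consecutively; hence
  the intervals of successive levels are nested.\<close>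

lemma e_refine: "e (Suc m) (4 * c) = e m c"
proof (induction c)
  case (Suc c)
  have "{..<4 * Suc c} = {..<4 * c} \<union> (\<lambda>j. 4 * c + j) ` {..<4}"
  proof (intro set_eqI iffI)
    fix x assume "x \<in> {..<4 * Suc c}"
    then have "x < 4 * c \<or> x = 4 * c + (x - 4 * c) \<and> x - 4 * c < 4" by auto
    then show "x \<in> {..<4 * c} \<union> (\<lambda>j. 4 * c + j) ` {..<4}" by blast
  qed auto
  moreover have "(\<Sum>a\<in>{..<4 * c} \<union> (\<lambda>j. 4 * c + j) ` {..<4}. \<mu> (Suc m) a) =
      (\<Sum>a<4 * c. \<mu> (Suc m) a) + (\<Sum>a\<in>(\<lambda>j. 4 * c + j) ` {..<4}. \<mu> (Suc m) a)"
    by (rule sum.union_disjoint) auto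
  moreover have "(\<Sum>a\<in>(\<lambda>j. 4 * c + j) ` {..<4}. \<mu> (Suc m) a) = (\<Sum>j<4. \<mu> (Suc m) (4 * c + j))"
    by (subst sum.reindex) (simp_all add: inj_on_def)
  ultimately have "e (Suc m) (4 * Suc c) = e (Suc m) (4 * c) + (\<Sum>j<4. \<mu> (Suc m) (4 * c + j))"
    unfolding step_end_def by (simp only:)
  then show ?case using Suc mass(3)[of m c] by (simp add: step_end_def)
qed (simp add: step_end_def)

lemma lab_lt: "lab m x < 4 ^ m"
proof -
  have "lab m x \<le> 4 ^ m - 1"
    unfolding step_label_def by (rule Least_le) simp
  moreover have "(0::nat) < 4 ^ m" by simp
  ultimately show ?thesis by linarith
qed

lemma lab_bounds:
  assumes "0 \<le> x" "x < 1"
  shows "e m (lab m x) \<le> x" "x < e m (Suc (lab m x))"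
proof -
  let ?P = "\<lambda>c. x < e m (Suc c) \<or> 4 ^ m \<le> Suc c"
  have "?P (4 ^ m - 1)" by simp
  then have P: "?P (lab m x)" unfolding step_label_def by (rule LeastI)
  show "x < e m (Suc (lab m x))"
  proof (cases "x < e m (Suc (lab m x))")
    case False
    with P have "4 ^ m \<le> Suc (lab m x)" by simp
    then have "Suc (lab m x) = 4 ^ m" using lab_lt[of m x] by linarith
    then have "e m (Suc (lab m x)) = 1" by (simp only: step_end_def mass(2))
    then show ?thesis using assms by simp
  qed
  show "e m (lab m x) \<le> x"
  proof (cases "lab m x")
    case 0
    then show ?thesis using assms by (simp add: step_end_def)
  next
    case (Suc c)
    then have "\<not> ?P c" unfolding step_label_def by (intro not_less_Least) simp
    then show ?thesis using Suc by simp
  qed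
qed

lemma lab_eqI:
  assumes "e m c \<le> x" "x < e m (Suc c)" "0 \<le> x" "x < 1"
  shows "lab m x = c"
proof (rule ccontr)
  assume "lab m x \<noteq> c"
  then consider "Suc (lab m x) \<le> c" | "Suc c \<le> lab m x" by linarith
  then show False
  proof cases
    case 1
    then have "e m (Suc (lab m x)) \<le> e m c" by (rule e_mono)
    then show ?thesis using lab_bounds(2)[OF assms(3,4), of m] assms(1) by linarith
  next
    case 2
    then have "e m (Suc c) \<le> e m (lab m x)" by (rule e_mono)
    then show ?thesis using lab_bounds(1)[OF assms(3,4), of m] assms(2) by linarith
  qed
qed

lemma lab_div:
  assumes "0 \<le> x" "x < 1"
  shows "lab (m + k) x div 4 ^ k = lab m x"
proof (rule codes_div[where c = "\<lambda>m _. lab m x"])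
  fix m
  let ?c = "lab (Suc m) x"
  have "lab m x = ?c div 4"
  proof (rule lab_eqI[OF _ _ assms])
    have "e m (?c div 4) = e (Suc m) (4 * (?c div 4))" by (rule e_refine[symmetric])
    also have "\<dots> \<le> e (Suc m) ?c" by (rule e_mono) simp
    also have "\<dots> \<le> x" by (rule lab_bounds[OF assms])
    finally show "e m (?c div 4) \<le> x" .
    have "x < e (Suc m) (Suc ?c)" by (rule lab_bounds[OF assms])
    also have "\<dots> \<le> e (Suc m) (4 * Suc (?c div 4))" by (rule e_mono) presburger
    also have "\<dots> = e m (Suc (?c div 4))" by (rule e_refine)
    finally show "x < e m (Suc (?c div 4))" .
  qed
  then show "?c div 4 = lab m x" by simp
qed

lemma lab_measurable: "lab m \<in> measurable borel (count_space UNIV)"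
  unfolding step_label_def by measurable

lemma lab_measurable_I01 [measurable]: "lab m \<in> measurable I01 (count_space UNIV)"
  using lab_measurable by (simp add: I01_def measurable_restrict_space1)

lemma AE_I01_less_1: "AE x in I01. x < 1"
proof -
  have "AE x in lborel. x \<noteq> (1::real)" by (rule AE_lborel_singleton)
  then show ?thesis unfolding AE_I01 by eventually_elim auto
qed

lemma integral_lab_eq:
  assumes "a < 4 ^ m"
  shows "(\<integral>x. of_bool (lab m x = a) \<partial>I01) = \<mu> m a"
proof -
  have e01: "0 \<le> e m a" "e m a \<le> e m (Suc a)" "e m (Suc a) \<le> 1"
  proof -
    show "0 \<le> e m a" unfolding step_end_def by (intro sum_nonneg mass(1))
    have "e m (Suc a) \<le> e m (4 ^ m)" using assms by (intro e_mono) simp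
    then show "e m (Suc a) \<le> 1" by (simp add: step_end_def mass(2))
  qed (simp add: e_mono)
  have "(\<integral>x. of_bool (lab m x = a) \<partial>I01) = (\<integral>x. indicat_real {e m a..<e m (Suc a)} x \<partial>I01)"
  proof (rule integral_cong_AE)
    show "(\<lambda>x. of_bool (lab m x = a) :: real) \<in> borel_measurable I01" unfolding of_bool_def by measurable
    show "AE x in I01. of_bool (lab m x = a) = indicat_real {e m a..<e m (Suc a)} x"
      using AE_I01_less_1 AE_space
    proof eventually_elim
      case (elim x)
      then have x: "0 \<le> x" "x < 1" by (auto simp: space_I01)
      have "lab m x = a \<longleftrightarrow> e m a \<le> x \<and> x < e m (Suc a)"
        using lab_bounds[OF x, of m] lab_eqI[of m a x] x by auto
      then show ?case by (simp add: indicator_def)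
    qed
    show "indicat_real {e m a..<e m (Suc a)} \<in> borel_measurable I01" by (rule I01_borel) simp
  qed
  also have "\<dots> = measure I01 {e m a..<e m (Suc a)}"
    using e01 by (subst Bochner_Integration.integral_indicator) (auto simp: space_I01 intro!: arg_cong[where f = "measure I01"])
  also have "\<dots> = measure lborel {e m a..<e m (Suc a)}"
    unfolding I01_def using e01 by (intro measure_restrict_space) auto
  also have "\<dots> = e m (Suc a) - e m a" using e01 by simp
  also have "\<dots> = \<mu> m a" by (simp add: step_end_def)
  finally show ?thesis .
qed

lemma integrable_lab: "integrable I01 (\<lambda>x. of_bool (lab m x = a) :: real)"
proof (rule I01.integrable_const_bound[where B = 1])
  show "(\<lambda>x. of_bool (lab m x = a) :: real) \<in> borel_measurable I01" unfolding of_bool_def by measurable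
qed simp

lemma of_bool_expand: "h (lab m x) = (\<Sum>a<4 ^ m. h a * of_bool (lab m x = a) :: real)"
proof -
  have "(\<Sum>a<4 ^ m. h a * of_bool (lab m x = a)) = (\<Sum>a<4 ^ m. if a = lab m x then h a else 0)"
    by (rule sum.cong) auto
  then show ?thesis using lab_lt[of m x] by simp
qed

lemma integral_lab:
  fixes h :: "nat \<Rightarrow> real"
  shows "(\<integral>x. h (lab m x) \<partial>I01) = (\<Sum>a<4 ^ m. \<mu> m a * h a)" "integrable I01 (\<lambda>x. h (lab m x))"
proof -
  have i: "integrable I01 (\<lambda>x. h a * of_bool (lab m x = a))" for a
    by (intro integrable_mult_right integrable_lab)
  show "integrable I01 (\<lambda>x. h (lab m x))"
    unfolding of_bool_expand[of h] by (intro Bochner_Integration.integrable_sum i)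
  have "(\<integral>x. h (lab m x) \<partial>I01) = (\<Sum>a<4 ^ m. h a * (\<integral>x. of_bool (lab m x = a) \<partial>I01))"
    unfolding of_bool_expand[of h] by (subst Bochner_Integration.integral_sum[OF i]) simp
  also have "\<dots> = (\<Sum>a<4 ^ m. \<mu> m a * h a)"
    by (rule sum.cong) (simp_all add: integral_lab_eq)
  finally show "(\<integral>x. h (lab m x) \<partial>I01) = (\<Sum>a<4 ^ m. \<mu> m a * h a)" .
qed

text \<open>The labels of independent uniform points are independent with law
  \<open>\<mu> m\<close>; this turns densities of step graphons into finite sums.\<close>

lemma integral_PiM_lab:
  assumes I: "finite I"
  shows "(\<integral>x. H (\<lambda>i\<in>I. lab m (x i)) \<partial>I01_pow I) = (\<Sum>\<phi>\<in>I \<rightarrow>\<^sub>E {..<4 ^ m}. (\<Prod>i\<in>I. \<mu> m (\<phi> i)) * H \<phi>)"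
proof -
  let ?P = "I \<rightarrow>\<^sub>E {..<4 ^ m :: nat}"
  have finP: "finite ?P" using I by (auto intro: finite_PiE)
  have ex: "H (\<lambda>i\<in>I. lab m (x i)) = (\<Sum>\<phi>\<in>?P. H \<phi> * (\<Prod>i\<in>I. of_bool (lab m (x i) = \<phi> i)))" for x
  proof -
    let ?l = "\<lambda>i\<in>I. lab m (x i)"
    have l: "?l \<in> ?P" using lab_lt by (simp add: PiE_iff)
    have "(\<Prod>i\<in>I. of_bool (lab m (x i) = \<phi> i)) = (if \<phi> = ?l then 1 else 0 :: real)" if \<phi>: "\<phi> \<in> ?P" for \<phi>
    proof -
      have "(\<forall>i\<in>I. lab m (x i) = \<phi> i) \<longleftrightarrow> \<phi> = ?l"
      proof
        assume *: "\<forall>i\<in>I. lab m (x i) = \<phi> i"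
        show "\<phi> = ?l"
        proof (rule ext)
          fix i show "\<phi> i = ?l i" using * PiE_arb[OF \<phi>, of i] by (cases "i \<in> I") simp_all
        qed
      qed simp
      then show ?thesis using prod_of_bool[OF I, of "\<lambda>i. lab m (x i) = \<phi> i"] by simp
    qed
    note * = this
    have "(\<Sum>\<phi>\<in>?P. H \<phi> * (\<Prod>i\<in>I. of_bool (lab m (x i) = \<phi> i))) = (\<Sum>\<phi>\<in>?P. if \<phi> = ?l then H \<phi> else 0)"
    proof (rule sum.cong[OF refl])
      fix \<phi> assume "\<phi> \<in> ?P"
      then show "H \<phi> * (\<Prod>i\<in>I. of_bool (lab m (x i) = \<phi> i)) = (if \<phi> = ?l then H \<phi> else 0)"
        by (simp only: * if_distrib[of "\<lambda>t. H \<phi> * t"] mult_1_right mult_zero_right)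
    qed
    also have "\<dots> = H ?l" using finP l by simp
    finally show ?thesis by simp
  qed
  have ip: "integrable (I01_pow I) (\<lambda>x. \<Prod>i\<in>I. of_bool (lab m (x i) = \<phi> i) :: real)" for \<phi>
    by (rule I01_prod.product_integrable_prod[OF I]) (rule integrable_lab)
  have "(\<integral>x. H (\<lambda>i\<in>I. lab m (x i)) \<partial>I01_pow I) =
     (\<Sum>\<phi>\<in>?P. H \<phi> * (\<integral>x. (\<Prod>i\<in>I. of_bool (lab m (x i) = \<phi> i)) \<partial>I01_pow I))"
    unfolding ex by (subst Bochner_Integration.integral_sum) (simp_all add: ip)
  also have "\<dots> = (\<Sum>\<phi>\<in>?P. (\<Prod>i\<in>I. \<mu> m (\<phi> i)) * H \<phi>)"
  proof (rule sum.cong[OF refl])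
    fix \<phi> assume \<phi>: "\<phi> \<in> ?P"
    have "(\<integral>x. (\<Prod>i\<in>I. of_bool (lab m (x i) = \<phi> i) :: real) \<partial>I01_pow I) = (\<Prod>i\<in>I. \<integral>x. of_bool (lab m x = \<phi> i) \<partial>I01)"
      by (rule I01_prod.product_integral_prod[OF I]) (rule integrable_lab)
    also have "\<dots> = (\<Prod>i\<in>I. \<mu> m (\<phi> i))"
      using PiE_mem[OF \<phi>] by (intro prod.cong refl integral_lab_eq) simp
    finally show "H \<phi> * (\<integral>x. (\<Prod>i\<in>I. of_bool (lab m (x i) = \<phi> i)) \<partial>I01_pow I) = (\<Prod>i\<in>I. \<mu> m (\<phi> i)) * H \<phi>"
      by simp
  qed
  finally show ?thesis .
qed

lemma borel_step_graphon: "borel_graphon (U m)"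
  unfolding borel_graphon_def
proof (intro conjI allI)
  have f: "(\<lambda>z. lab m (fst z)) \<in> measurable (borel :: (real \<times> real) measure) (count_space UNIV)"
    and s: "(\<lambda>z. lab m (snd z)) \<in> measurable (borel :: (real \<times> real) measure) (count_space UNIV)"
    by (rule measurable_compose[OF _ lab_measurable], simp add: borel_prod[symmetric])+
  show "(\<lambda>z. U m (fst z) (snd z)) \<in> borel_measurable borel"
    unfolding step_graphon_def
    by (rule measurable_compose_countable[OF _ f], rule measurable_compose_countable[OF _ s]) simp
  show "U m x y = U m y x" for x y unfolding step_graphon_def by (rule step_value)
  show "U m x y \<in> {0..1}" for x y unfolding step_graphon_def by (rule step_value)
qed

lemma step_graphon_density:
  "(\<integral>x. (\<Prod>(i, j)\<in>epairs F. U m (x i) (x j)) \<partial>I01_pow (verts F)) =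
   step_density F (4 ^ m) (\<mu> m) (u m)"
proof -
  have "(\<Prod>(i, j)\<in>epairs F. U m (x i) (x j)) =
      (\<Prod>(i, j)\<in>epairs F. u m ((\<lambda>i\<in>verts F. lab m (x i)) i) ((\<lambda>i\<in>verts F. lab m (x i)) j))" for x
    by (rule prod.cong) (auto simp: step_graphon_def dest: epairsD)
  then show ?thesis unfolding step_density_def
    using integral_PiM_lab[OF finite_verts, where H = "\<lambda>\<phi>. \<Prod>(i, j)\<in>epairs F. u m (\<phi> i) (\<phi> j)"] by simp
qed

section \<open>Convergence of the step graphons\<close>

lemma step_graphon_measurable [measurable]: "(\<lambda>z. U m (fst z) (snd z)) \<in> borel_measurable I01_sq"
  by (rule borel_pair_I01[OF borel_graphonD(1)[OF borel_step_graphon]])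

lemma U_bounds: "U m x y \<in> {0..1}"
  by (rule borel_graphonD(3)[OF borel_step_graphon])

lemma U_diff: "\<bar>U i x y - U j x y\<bar> \<le> 1"
  using U_bounds[of i x y] U_bounds[of j x y] by auto

text \<open>On nested intervals the coarse label is the fine one divided by \<open>4 ^ k\<close>, so
  the energy identity of the block averages becomes an L2 identity for step graphons.\<close>

lemma U_L2_distance:
  "(\<integral>z. (U (m + k) (fst z) (snd z) - U m (fst z) (snd z))\<^sup>2 \<partial>I01_sq) = q (m + k) - q m"
proof -
  let ?h = "\<lambda>a b. (u (m + k) a b - u m (a div 4 ^ k) (b div 4 ^ k))\<^sup>2"
  let ?f = "\<lambda>z. (U (m + k) (fst z) (snd z) - U m (fst z) (snd z))\<^sup>2"
  have int: "integrable I01_sq ?f"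
  proof (rule I01_sq.integrable_const_bound[where B = 1])
    have "(U (m + k) x y - U m x y)\<^sup>2 \<le> 1" for x y
      using U_diff[of "m + k" x y m] by (simp add: abs_square_le_1)
    then show "AE z in I01_sq. norm (?f z) \<le> 1" by simp
  qed measurable
  have "(\<integral>z. ?f z \<partial>I01_sq) = (\<integral>x. \<integral>y. ?f (x, y) \<partial>I01 \<partial>I01)"
    by (rule I01_pair.integral_fst'[symmetric, OF int])
  also have "\<dots> = (\<integral>x. \<integral>y. ?h (lab (m + k) x) (lab (m + k) y) \<partial>I01 \<partial>I01)"
  proof (rule integral_cong_AE)
    have g: "(\<lambda>z. ?h (lab (m + k) (fst z)) (lab (m + k) (snd z))) \<in> borel_measurable I01_sq"
    proof -
      have f: "(\<lambda>z. lab (m + k) (fst z)) \<in> measurable I01_sq (count_space UNIV)"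
        and s: "(\<lambda>z. lab (m + k) (snd z)) \<in> measurable I01_sq (count_space UNIV)"
        by measurable
      show ?thesis
        by (rule measurable_compose_countable[OF _ f], rule measurable_compose_countable[OF _ s]) simp
    qed
    show "(\<lambda>x. \<integral>y. ?h (lab (m + k) x) (lab (m + k) y) \<partial>I01) \<in> borel_measurable I01"
      using I01.borel_measurable_lebesgue_integral[of "\<lambda>x y. ?h (lab (m + k) x) (lab (m + k) y)" I01] g
      by (simp add: case_prod_unfold)
    show "(\<lambda>x. \<integral>y. ?f (x, y) \<partial>I01) \<in> borel_measurable I01"
      using int by (intro I01.borel_measurable_lebesgue_integral) (simp add: case_prod_unfold)
    show "AE x in I01. (\<integral>y. ?f (x, y) \<partial>I01) = (\<integral>y. ?h (lab (m + k) x) (lab (m + k) y) \<partial>I01)"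
      using AE_I01_less_1 AE_space
    proof eventually_elim
      case (elim x)
      then have x: "0 \<le> x" "x < 1" by (auto simp: space_I01)
      show ?case
      proof (rule integral_cong_AE)
        show "(\<lambda>y. ?f (x, y)) \<in> borel_measurable I01"
          using elim(2) by (intro borel_measurable_power borel_measurable_diff borel_graphon_measurable[OF borel_step_graphon]
              borel_measurable_const) (simp_all add: I01_borel)
        show "(\<lambda>y. ?h (lab (m + k) x) (lab (m + k) y)) \<in> borel_measurable I01"
          by (rule borel_measurable_integrable[OF integral_lab(2)])
        show "AE y in I01. ?f (x, y) = ?h (lab (m + k) x) (lab (m + k) y)"
          using AE_I01_less_1 AE_space
        proof eventually_elim
          case (elim y)
          then have y: "0 \<le> y" "y < 1" by (auto simp: space_I01)
          show ?case by (simp add: step_graphon_def lab_div[OF x] lab_div[OF y])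
        qed
      qed
    qed
  qed
  also have "\<dots> = (\<Sum>a<4 ^ (m + k). \<mu> (m + k) a * (\<Sum>b<4 ^ (m + k). \<mu> (m + k) b * ?h a b))"
    by (simp only: integral_lab(1)[of "\<lambda>b. ?h _ b"]
        integral_lab(1)[of "\<lambda>a. \<Sum>b<4 ^ (m + k). \<mu> (m + k) b * ?h a b"])
  also have "\<dots> = q (m + k) - q m"
    unfolding energy_eq[symmetric] by (simp add: sum_distrib_left mult.assoc)
  finally show ?thesis .
qed

lemma q_mono: "m \<le> m' \<Longrightarrow> q m \<le> q m'"
proof (rule lift_Suc_mono_le[of q])
  show "q n \<le> q (Suc n)" for n using discr(2)[of n] zero_le_power2[of "\<delta> n"] by linarith
qed

lemma q_convergent: "convergent q"
proof (rule Bseq_monoseq_convergent)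
  show "Bseq q" using discr(3) by (intro BseqI'[where K = 1]) auto
  show "monoseq q" using q_mono by (simp add: monoseq_def)
qed

lemma \<delta>_tendsto: "\<delta> \<longlonglongrightarrow> 0"
proof -
  obtain Q where Q: "q \<longlonglongrightarrow> Q" using q_convergent by (auto simp: convergent_def)
  have "(\<lambda>m. q (Suc m) - q m) \<longlonglongrightarrow> Q - Q" by (intro tendsto_diff Q LIMSEQ_Suc)
  then have *: "(\<lambda>m. q (Suc m) - q m) \<longlonglongrightarrow> 0" by simp
  have "(\<lambda>m. (\<delta> m)\<^sup>2) \<longlonglongrightarrow> 0"
    by (rule Lim_null_comparison[OF _ *]) (simp add: discr(2))
  then have "(\<lambda>m. sqrt ((\<delta> m)\<^sup>2)) \<longlonglongrightarrow> sqrt 0" by (rule tendsto_real_sqrt)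
  then show ?thesis using discr(1) by simp
qed

lemma U_L1_Cauchy:
  assumes \<epsilon>: "\<epsilon> > 0"
  shows "\<exists>N. \<forall>i\<ge>N. \<forall>j\<ge>N. (\<integral>z. norm (U i (fst z) (snd z) - U j (fst z) (snd z)) \<partial>I01_sq) < \<epsilon>"
proof -
  let ?M = "I01_sq"
  have "Cauchy q" using q_convergent by (simp add: Cauchy_convergent_iff)
  then obtain N where N: "\<And>i j. i \<ge> N \<Longrightarrow> j \<ge> N \<Longrightarrow> \<bar>q i - q j\<bar> < \<epsilon>\<^sup>2"
    using \<epsilon> unfolding Cauchy_def dist_real_def by (meson zero_less_power)
  have *: "(\<integral>z. norm (U (m + k) (fst z) (snd z) - U m (fst z) (snd z)) \<partial>?M) < \<epsilon>" if m: "m \<ge> N" for m k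
  proof -
    let ?d = "\<lambda>z. U (m + k) (fst z) (snd z) - U m (fst z) (snd z)"
    have int: "integrable ?M ?d" "integrable ?M (\<lambda>z. (?d z)\<^sup>2)"
    proof -
      show "integrable ?M ?d"
        by (rule I01_sq.integrable_const_bound[where B = 1]) (use U_diff in auto)
      have "(?d z)\<^sup>2 \<le> 1" for z using U_diff[of "m + k" "fst z" "snd z" m] by (simp add: abs_square_le_1)
      then show "integrable ?M (\<lambda>z. (?d z)\<^sup>2)"
        by (intro I01_sq.integrable_const_bound[where B = 1]) auto
    qed
    have c: "integrable ?M (\<lambda>z. \<epsilon> / 2)" by (rule I01_sq.integrable_const)
    have "(\<integral>z. norm (?d z) \<partial>?M) \<le> (\<integral>z. \<epsilon> / 2 + (?d z)\<^sup>2 / (2 * \<epsilon>) \<partial>?M)"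
    proof (rule integral_mono)
      fix z
      \<comment> \<open>From (|t| - eps)^2 >= 0. Divided by 2 eps, it passes from the squared L2
        distance to the L1 distance, each summand contributing at most eps / 2 after
        integration.\<close>
      have "2 * \<epsilon> * \<bar>t\<bar> \<le> \<epsilon>\<^sup>2 + t\<^sup>2" for t :: real
        using zero_le_power2[of "\<bar>t\<bar> - \<epsilon>"] by (simp add: power2_diff mult_ac)
      from this[of "?d z"] have "\<bar>?d z\<bar> \<le> (\<epsilon>\<^sup>2 + (?d z)\<^sup>2) / (2 * \<epsilon>)" using \<epsilon> by (simp add: field_simps)
      also have "\<dots> = \<epsilon> / 2 + (?d z)\<^sup>2 / (2 * \<epsilon>)" using \<epsilon> by (simp add: field_simps power2_eq_square)
      finally show "norm (?d z) \<le> \<epsilon> / 2 + (?d z)\<^sup>2 / (2 * \<epsilon>)" by simp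
    qed (use int c in auto)
    also have "\<dots> = \<epsilon> / 2 + (q (m + k) - q m) / (2 * \<epsilon>)"
      using int c emeasure_I01_sq_space by (simp add: U_L2_distance measure_def)
    also have "\<dots> < \<epsilon> / 2 + \<epsilon>\<^sup>2 / (2 * \<epsilon>)"
      using N[of "m + k" m] m \<epsilon> by (intro add_strict_left_mono divide_strict_right_mono) auto
    also have "\<dots> = \<epsilon>" using \<epsilon> by (simp add: field_simps power2_eq_square)
    finally show ?thesis .
  qed
  have "(\<integral>z. norm (U i (fst z) (snd z) - U j (fst z) (snd z)) \<partial>?M) < \<epsilon>" if "i \<ge> N" "j \<ge> N" for i j
  proof (cases "j \<le> i")
    case True
    then show ?thesis using *[OF that(2), of "i - j"] by simp
  next
    case False
    then show ?thesis using *[OF that(1), of "j - i"] by (simp add: abs_minus_commute)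
  qed
  then show ?thesis by blast
qed

lemma limit_graphon:
  "\<exists>W. graphon W \<and> (\<forall>F. graphon_density F W = \<gamma> F)"
proof -
  let ?M = "I01_sq"
  have int: "integrable ?M (\<lambda>z. U n (fst z) (snd z))" for n
    by (rule I01_sq.integrable_const_bound[where B = 1])
      (use U_bounds[of n] in auto)
  obtain r where r: "strict_mono r" "AE z in ?M. Cauchy (\<lambda>i. U (r i) (fst z) (snd z))"
    using cauchy_L1_AE_cauchy_subseq[OF int U_L1_Cauchy] by blast
  \<comment> \<open>Clamping covers the points where the sequence diverges and \<open>lim\<close> is
    arbitrary. Symmetry persists there, since \<open>(x, y)\<close> and \<open>(y, x)\<close> give
    the same sequence.\<close>
  define W where "W x y = max 0 (min 1 (lim (\<lambda>i. U (r i) x y)))" for x y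
  have Us: "U n x y = U n y x" for n x y by (rule borel_graphonD(2)[OF borel_step_graphon])
  have bW: "borel_graphon W"
    unfolding borel_graphon_def
  proof (intro conjI allI)
    have "(\<lambda>z. lim (\<lambda>i. U (r i) (fst z) (snd z))) \<in> borel_measurable borel"
      by (rule borel_measurable_lim_metric) (rule borel_graphonD(1)[OF borel_step_graphon])
    then show "(\<lambda>z. W (fst z) (snd z)) \<in> borel_measurable borel"
      unfolding W_def by measurable
    show "W x y = W y x" for x y unfolding W_def Us[of _ x y] by (rule refl)
    show "W x y \<in> {0..1}" for x y by (simp add: W_def)
  qed
  have Wr: "AE_eq_graphon W W" by (simp add: AE_eq_graphon_def)
  have gW: "graphon W"
    using borel_graphonD[OF bW] by (intro graphon_of_AE_eq[OF bW Wr]) auto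
  have conv: "AE z in ?M. (\<lambda>i. U (r i) (fst z) (snd z)) \<longlonglongrightarrow> W (fst z) (snd z)"
    using r(2)
  proof eventually_elim
    case (elim z)
    then have "convergent (\<lambda>i. U (r i) (fst z) (snd z))" by (simp add: Cauchy_convergent_iff)
    then have l: "(\<lambda>i. U (r i) (fst z) (snd z)) \<longlonglongrightarrow> lim (\<lambda>i. U (r i) (fst z) (snd z))"
      by (simp add: convergent_LIMSEQ_iff)
    have "lim (\<lambda>i. U (r i) (fst z) (snd z)) \<in> {0..1}"
      using l by (rule Lim_in_closed_set[rotated 3]) (use U_bounds in auto)
    then show ?case using l by (simp add: W_def)
  qed
  have "graphon_density F W = \<gamma> F" for F
  proof -
    let ?P = "I01_pow (verts F)"
    let ?t = "\<lambda>m. \<integral>x. (\<Prod>(i, j)\<in>epairs F. U m (x i) (x j)) \<partial>?P"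
    have "(\<lambda>n. ?t (r n)) \<longlonglongrightarrow> (\<integral>x. (\<Prod>(i, j)\<in>epairs F. W (x i) (x j)) \<partial>?P)"
    proof (rule integral_dominated_convergence[where w = "\<lambda>_. 1"])
      show "integrable ?P (\<lambda>_. 1 :: real)"
        by (rule finite_measure.integrable_const[OF finite_measure_PiM_I01]) simp
      show "(\<lambda>x. \<Prod>(i, j)\<in>epairs F. W (x i) (x j)) \<in> borel_measurable ?P"
        by (rule prod_borel_graphon_measurable[OF bW epairs_subset])
      show "(\<lambda>x. \<Prod>(i, j)\<in>epairs F. U (r n) (x i) (x j)) \<in> borel_measurable ?P" for n
        by (rule prod_borel_graphon_measurable[OF borel_step_graphon epairs_subset])
      show "AE x in ?P. norm (\<Prod>(i, j)\<in>epairs F. U (r n) (x i) (x j)) \<le> 1" for n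
        using prod_kernel_bounds(1)[of "epairs F" "U (r n)"] U_bounds by auto
      have "AE x in ?P. \<forall>p\<in>epairs F. (\<lambda>n. U (r n) (x (fst p)) (x (snd p))) \<longlonglongrightarrow> W (x (fst p)) (x (snd p))"
      proof (rule AE_ball_countable[THEN iffD2])
        show "\<forall>p\<in>epairs F. AE x in ?P. (\<lambda>n. U (r n) (x (fst p)) (x (snd p))) \<longlonglongrightarrow> W (x (fst p)) (x (snd p))"
        proof
          fix p assume "p \<in> epairs F"
          then have "fst p \<in> verts F" "snd p \<in> verts F" "fst p \<noteq> snd p"
            using epairsD[of "fst p" "snd p" F] by simp_all
          from AE_PiM_pair[OF finite_verts this conv]
          show "AE x in ?P. (\<lambda>n. U (r n) (x (fst p)) (x (snd p))) \<longlonglongrightarrow> W (x (fst p)) (x (snd p))" .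
        qed
      qed (simp add: countable_finite)
      then show "AE x in ?P. (\<lambda>n. \<Prod>(i, j)\<in>epairs F. U (r n) (x i) (x j)) \<longlonglongrightarrow> (\<Prod>(i, j)\<in>epairs F. W (x i) (x j))"
      proof eventually_elim
        case (elim x)
        show ?case unfolding case_prod_unfold by (rule tendsto_prod) (use elim in blast)
      qed
    qed
    then have 1: "(\<lambda>n. ?t (r n)) \<longlonglongrightarrow> graphon_density F W"
      by (simp only: graphon_density_borel[OF bW Wr])
    \<comment> \<open>The discrepancy bound holds at every level, so the whole sequence of densities
      tends to \<open>\<gamma> F\<close>, and with it the subsequence \<open>r\<close>.\<close>
    have "?t \<longlonglongrightarrow> \<gamma> F"
    proof (rule LIM_zero_cancel, rule Lim_null_comparison)
      show "eventually (\<lambda>m. norm (?t m - \<gamma> F) \<le> real (card (epairs F)) * \<delta> m) sequentially"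
        using density[of F] unfolding step_graphon_density by (simp add: abs_minus_commute always_eventually)
      show "(\<lambda>m. real (card (epairs F)) * \<delta> m) \<longlonglongrightarrow> 0"
        using tendsto_mult[OF tendsto_const \<delta>_tendsto] by simp
    qed
    from LIMSEQ_subseq_LIMSEQ[OF this r(1)] have "(\<lambda>n. ?t (r n)) \<longlonglongrightarrow> \<gamma> F" by (simp add: comp_def)
    with 1 show ?thesis by (rule LIMSEQ_unique)
  qed
  with gW show ?thesis by blast
qed

end

theorem graphon_represents_limit: "\<exists>W. represents W \<Gamma>"
proof -
  obtain G where "densities_converge G (limit_density \<Gamma>)" using limit_density[of \<Gamma>] by auto
  from limit_step_graphons[OF this] obtain \<mu> u q \<delta> where "step_graphons (limit_density \<Gamma>) \<mu> u q \<delta>" by blast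
  then interpret step_graphon_sequence "limit_density \<Gamma>" \<mu> u q \<delta> by unfold_locales
  show ?thesis using limit_graphon by (auto simp: represents_def)
qed

section \<open>The equivalence\<close>

theorem theorem7p2:
  fixes P :: "sgraph set" and \<Gamma> :: graph_limit
  assumes "hereditary P"
  shows
    "((\<Gamma> \<in> class_limits P) \<longleftrightarrow>
        (\<forall>W. represents W \<Gamma> \<longrightarrow> (\<forall>G. G \<notin> P \<longrightarrow> graph_free G W))) \<and>
     ((\<Gamma> \<in> class_limits P) \<longleftrightarrow>
        (\<exists>W. represents W \<Gamma> \<and> (\<forall>G. G \<notin> P \<longrightarrow> graph_free G W))) \<and>
     ((\<Gamma> \<in> class_limits P) \<longleftrightarrow>
        (\<exists>W. represents W \<Gamma> \<and> (\<forall>G. G \<notin> P \<longrightarrow> completely_graph_free G W))) \<and>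
     (\<forall>(r :: nat) (A :: nat \<Rightarrow> real set) (E :: (nat \<times> nat) set) (a :: nat \<Rightarrow> nat \<Rightarrow> real) W.
        (\<Union>k\<in>{1..r}. A k) = {0..1} \<and> disjoint_family_on A {1..r} \<and>
        (\<forall>k\<in>{1..r}. A k \<in> sets lebesgue \<and> measure lebesgue (A k) > 0) \<and>
        E \<subseteq> {1..r} \<times> {1..r} \<and> (\<forall>(k, l)\<in>E. a k l \<in> {0..1}) \<and>
        \<Gamma> \<in> class_limits P \<and>
        represents W \<Gamma> \<and> (\<forall>(k, l)\<in>E. \<forall>x\<in>A k. \<forall>y\<in>A l. W x y = a k l) \<longrightarrow>
        (\<exists>W'. represents W' \<Gamma> \<and> (\<forall>G. G \<notin> P \<longrightarrow> completely_graph_free G W') \<and>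
           (\<forall>(k, l)\<in>E. \<forall>x\<in>A k. \<forall>y\<in>A l. W' x y = a k l)))"
proof -
  have i_ii: "\<forall>W. represents W \<Gamma> \<longrightarrow> (\<forall>G. G \<notin> P \<longrightarrow> graph_free G W)" if "\<Gamma> \<in> class_limits P"
    using class_limit_imp_graph_free[OF assms that] by blast
  have iii_i: "\<Gamma> \<in> class_limits P" if "represents W \<Gamma>" "\<forall>G. G \<notin> P \<longrightarrow> graph_free G W" for W
    by (rule graph_free_imp_class_limit[OF that(1)]) (use that(2) in blast)
  \<comment> \<open>Without a representing graphon (ii) would hold vacuously; existence is what
    makes it imply (i).\<close>
  have ii_i: "\<Gamma> \<in> class_limits P" if "\<forall>W. represents W \<Gamma> \<longrightarrow> (\<forall>G. G \<notin> P \<longrightarrow> graph_free G W)"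
    using graphon_represents_limit[of \<Gamma>] iii_i that by blast
  have i_iii: "\<exists>W. represents W \<Gamma> \<and> (\<forall>G. G \<notin> P \<longrightarrow> graph_free G W)" if "\<Gamma> \<in> class_limits P"
    using graphon_represents_limit[of \<Gamma>] i_ii[OF that] by blast
  have completely: "graph_free G W" if "completely_graph_free G W" for G W
  proof -
    have "psi G W x = 0" if "x \<in> space (cube (verts G))" for x
    proof -
      have "x \<in> verts G \<rightarrow> {0..1}" using that by (auto simp: cube_def space_PiM space_restrict_space PiE_iff)
      then show ?thesis using \<open>completely_graph_free G W\<close> by (simp add: completely_graph_free_def)
    qed
    then have "t_ind G W = (\<integral>x. 0 \<partial>cube (verts G))"
      unfolding t_ind_def by (intro Bochner_Integration.integral_cong) simp_all
    then show ?thesis by (simp add: graph_free_def)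
  qed
  \<comment> \<open>Keeps every block on which \<open>W\<close> is constant, whichever blocks
    \<open>E\<close> singles out.\<close>
  have modification: "\<exists>W'. represents W' \<Gamma> \<and> (\<forall>G. G \<notin> P \<longrightarrow> completely_graph_free G W') \<and>
      (\<forall>k\<in>{1..r}. \<forall>l\<in>{1..r}. \<forall>c. (\<forall>x\<in>A k. \<forall>y\<in>A l. W x y = c) \<longrightarrow> (\<forall>x\<in>A k. \<forall>y\<in>A l. W' x y = c))"
    if \<Gamma>: "\<Gamma> \<in> class_limits P" and W: "represents W \<Gamma>"
      and A: "(\<Union>k\<in>{1..r}. A k) = {0..1}" "disjoint_family_on A {1..r}"
        "\<forall>k\<in>{1..r}. A k \<in> sets lebesgue \<and> measure lebesgue (A k) > 0"
    for W and r :: nat and A :: "nat \<Rightarrow> real set"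
  proof -
    have gW: "graphon W" and dW: "graphon_density F W = limit_density \<Gamma> F" for F
      using W by (simp_all add: represents_def)
    have free: "\<forall>G\<in>- P. graph_free G W" using i_ii[OF \<Gamma>] W by blast
    from completely_free_version[OF gW free A] obtain W' where
      "graphon W'" "\<forall>F. graphon_density F W' = graphon_density F W" "\<forall>G\<in>- P. completely_graph_free G W'"
      "\<forall>k\<in>{1..r}. \<forall>l\<in>{1..r}. \<forall>c. (\<forall>x\<in>A k. \<forall>y\<in>A l. W x y = c) \<longrightarrow> (\<forall>x\<in>A k. \<forall>y\<in>A l. W' x y = c)"
      by (elim exE conjE)
    then show ?thesis by (intro exI[of _ W']) (simp add: represents_def dW)
  qed
  have i_iv: "\<exists>W. represents W \<Gamma> \<and> (\<forall>G. G \<notin> P \<longrightarrow> completely_graph_free G W)" if "\<Gamma> \<in> class_limits P"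
  proof -
    obtain W where W: "represents W \<Gamma>" using graphon_represents_limit by blast
    \<comment> \<open>With no blocks prescribed, the partition into a single part will do.\<close>
    have A: "(\<Union>k\<in>{1..1::nat}. {0..1::real}) = {0..1}" "disjoint_family_on (\<lambda>_. {0..1::real}) {1..1::nat}"
      "\<forall>k\<in>{1..1::nat}. {0..1::real} \<in> sets lebesgue \<and> measure lebesgue {0..1::real} > 0"
      by (simp_all add: disjoint_family_on_def)
    from modification[OF that W A] show ?thesis by blast
  qed
  have iv_i: "\<Gamma> \<in> class_limits P" if "represents W \<Gamma>" "\<forall>G. G \<notin> P \<longrightarrow> completely_graph_free G W" for W
    using iii_i[OF that(1)] completely that(2) by blast
  show ?thesis
  proof (intro conjI allI impI)
    show "\<Gamma> \<in> class_limits P \<longleftrightarrow> (\<forall>W. represents W \<Gamma> \<longrightarrow> (\<forall>G. G \<notin> P \<longrightarrow> graph_free G W))"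
      using i_ii ii_i by blast
    show "\<Gamma> \<in> class_limits P \<longleftrightarrow> (\<exists>W. represents W \<Gamma> \<and> (\<forall>G. G \<notin> P \<longrightarrow> graph_free G W))"
      using i_iii iii_i by blast
    show "\<Gamma> \<in> class_limits P \<longleftrightarrow> (\<exists>W. represents W \<Gamma> \<and> (\<forall>G. G \<notin> P \<longrightarrow> completely_graph_free G W))"
      using i_iv iv_i by blast
    fix r :: nat and A :: "nat \<Rightarrow> real set" and E :: "(nat \<times> nat) set" and a :: "nat \<Rightarrow> nat \<Rightarrow> real" and W
    assume H: "(\<Union>k\<in>{1..r}. A k) = {0..1} \<and> disjoint_family_on A {1..r} \<and>
        (\<forall>k\<in>{1..r}. A k \<in> sets lebesgue \<and> measure lebesgue (A k) > 0) \<and>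
        E \<subseteq> {1..r} \<times> {1..r} \<and> (\<forall>(k, l)\<in>E. a k l \<in> {0..1}) \<and>
        \<Gamma> \<in> class_limits P \<and>
        represents W \<Gamma> \<and> (\<forall>(k, l)\<in>E. \<forall>x\<in>A k. \<forall>y\<in>A l. W x y = a k l)"
    then have A: "(\<Union>k\<in>{1..r}. A k) = {0..1}" "disjoint_family_on A {1..r}"
      "\<forall>k\<in>{1..r}. A k \<in> sets lebesgue \<and> measure lebesgue (A k) > 0"
      and \<Gamma>: "\<Gamma> \<in> class_limits P" and W: "represents W \<Gamma>" by simp_all
    from H have E: "E \<subseteq> {1..r} \<times> {1..r}" "\<forall>(k, l)\<in>E. \<forall>x\<in>A k. \<forall>y\<in>A l. W x y = a k l" by simp_all
    from modification[OF \<Gamma> W A] obtain W' where W': "represents W' \<Gamma>"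
      "\<forall>G. G \<notin> P \<longrightarrow> completely_graph_free G W'"
      "\<forall>k\<in>{1..r}. \<forall>l\<in>{1..r}. \<forall>c. (\<forall>x\<in>A k. \<forall>y\<in>A l. W x y = c) \<longrightarrow> (\<forall>x\<in>A k. \<forall>y\<in>A l. W' x y = c)"
      by (elim exE conjE)
    have "\<forall>(k, l)\<in>E. \<forall>x\<in>A k. \<forall>y\<in>A l. W' x y = a k l"
    proof (rule ballI, unfold split_paired_all prod.case)
      fix k l assume "(k, l) \<in> E"
      then have "k \<in> {1..r}" "l \<in> {1..r}" "\<forall>x\<in>A k. \<forall>y\<in>A l. W x y = a k l" using E by auto
      then show "\<forall>x\<in>A k. \<forall>y\<in>A l. W' x y = a k l" by (rule W'(3)[THEN bspec, THEN bspec, THEN spec, THEN mp])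
    qed
    then show "\<exists>W'. represents W' \<Gamma> \<and> (\<forall>G. G \<notin> P \<longrightarrow> completely_graph_free G W') \<and>
           (\<forall>(k, l)\<in>E. \<forall>x\<in>A k. \<forall>y\<in>A l. W' x y = a k l)"
      using W'(1,2) by blast
  qed
qed

end
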